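(* If there exists a $T(n)$ time algorithm for the Single Source Replacement Paths problem in $n$-vertex directed graphs with edge weights in $\{-1,0,1\}$, then there exists an $O(T(n)\sqrt{n})$ time algorithm for the Bounded-Difference Min-Plus Product of $n\times n$ matrices.
   Context: In the Single Source Replacement Paths (SSRP) problem, one is given a directed edge-weighted graph $G$ and a source vertex $s$, and must compute, for every edge $e$ and every vertex $v$, the shortest path distance $d_G(s,v,e)$ from $s$ to $v$ in $G\setminus\{e\}$. The min-plus product $C=A\star B$ of matrices is defined by $C_{i,j}=\min_k\{A_{i,k}+B_{k,j}\}$. An $n\times m$ integer matrix $A$ is a bounded-difference matrix if $|A_{i,j}-A_{i,j+1}|\le 1$ for all $1\le i\le n$, $1\le j<m$ and $|A_{i,j}-A_{i+1,j}|\le 1$ for all $1\le i<n$, $1\le j\le m$. In Bounded-Difference Min-Plus Product, one is given two bounded-difference integer matrices $A,B$ and must compute $A\star B$. *)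

theory Defs
  imports
    "Jordan_Normal_Form.Matrix"
    "Graph_Theory.Shortest_Path"
    "Graph_Theory.Pair_Digraph"
    "HOL-Library.Landau_Symbols"
begin

section \<open>The word RAM\<close>

text \<open>
  The model of computation is the unit-cost word RAM, programmed with structured control flow.
  A state consists of registers (a program mentions only finitely many) and of an addressable
  memory.  The parameter \<open>W\<close> of the semantics is the largest absolute value that fits into a
  machine word: an instruction whose result does not fit has no successor state, so that a
  terminating execution is one without overflow.
\<close>

datatype binop = Add | Sub | Mul | Div | Mod | Less | Equal | And | Or | Xor | Shl | Shr

fun apply_op :: "binop \<Rightarrow> int \<Rightarrow> int \<Rightarrow> int" where
  "apply_op Add a b = a + b"
| "apply_op Sub a b = a - b"
| "apply_op Mul a b = a * b"
| "apply_op Div a b = a div b"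
| "apply_op Mod a b = a mod b"
| "apply_op Less a b = of_bool (a < b)"
| "apply_op Equal a b = of_bool (a = b)"
| "apply_op And a b = and a b"
| "apply_op Or a b = or a b"
| "apply_op Xor a b = xor a b"
| "apply_op Shl a b = push_bit (nat b) a"
| "apply_op Shr a b = drop_bit (nat b) a"

type_synonym reg = nat

datatype prog =
  Skip
| Const reg int
| Op binop reg reg reg
| Load reg reg
| Store reg reg
| Seq prog prog
| Cond reg prog prog
| While reg prog

type_synonym state = "(reg \<Rightarrow> int) \<times> (nat \<Rightarrow> int)"

text \<open>\<open>exec W p \<sigma> t \<sigma>'\<close>: on words of absolute value at most \<open>W\<close>, the program \<open>p\<close> started in \<open>\<sigma>\<close>
  halts in \<open>\<sigma>'\<close> after exactly \<open>t\<close> steps.\<close>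

inductive exec :: "int \<Rightarrow> prog \<Rightarrow> state \<Rightarrow> nat \<Rightarrow> state \<Rightarrow> bool" for W :: int where
  Skip: "exec W Skip (r, m) 1 (r, m)"
| Const: "\<bar>k\<bar> \<le> W \<Longrightarrow> exec W (Const x k) (r, m) 1 (r(x := k), m)"
| Op: "\<bar>apply_op f (r y) (r z)\<bar> \<le> W \<Longrightarrow>
    exec W (Op f x y z) (r, m) 1 (r(x := apply_op f (r y) (r z)), m)"
| Load: "0 \<le> r y \<Longrightarrow> exec W (Load x y) (r, m) 1 (r(x := m (nat (r y))), m)"
| Store: "0 \<le> r x \<Longrightarrow> exec W (Store x y) (r, m) 1 (r, m(nat (r x) := r y))"
| Seq: "exec W p \<sigma> t \<sigma>' \<Longrightarrow> exec W q \<sigma>' t' \<sigma>'' \<Longrightarrow> exec W (Seq p q) \<sigma> (t + t') \<sigma>''"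
| CondTrue: "r x \<noteq> 0 \<Longrightarrow> exec W p (r, m) t \<sigma>' \<Longrightarrow> exec W (Cond x p q) (r, m) (t + 1) \<sigma>'"
| CondFalse: "r x = 0 \<Longrightarrow> exec W q (r, m) t \<sigma>' \<Longrightarrow> exec W (Cond x p q) (r, m) (t + 1) \<sigma>'"
| WhileTrue: "r x \<noteq> 0 \<Longrightarrow> exec W p (r, m) t \<sigma>' \<Longrightarrow> exec W (While x p) \<sigma>' t' \<sigma>'' \<Longrightarrow>
    exec W (While x p) (r, m) (t + t' + 1) \<sigma>''"
| WhileFalse: "r x = 0 \<Longrightarrow> exec W (While x p) (r, m) 1 (r, m)"

inductive_cases exec_elims:
  "exec W Skip \<sigma> t \<sigma>'" "exec W (Const x k) \<sigma> t \<sigma>'" "exec W (Op f x y z) \<sigma> t \<sigma>'"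
  "exec W (Load x y) \<sigma> t \<sigma>'" "exec W (Store x y) \<sigma> t \<sigma>'" "exec W (Seq p q) \<sigma> t \<sigma>'"
  "exec W (Cond x p q) \<sigma> t \<sigma>'" "exec W (While x p) \<sigma> t \<sigma>'"

lemma exec_deterministic:
  assumes "exec W p \<sigma> t \<sigma>'" and "exec W p \<sigma> u \<tau>"
  shows "u = t \<and> \<tau> = \<sigma>'"
  using assms
proof (induction arbitrary: u \<tau> rule: exec.induct)
  case (Seq p \<sigma> t \<sigma>' q t' \<sigma>'')
  from Seq.prems obtain a \<rho> b
    where "exec W p \<sigma> a \<rho>" and "exec W q \<rho> b \<tau>" and "u = a + b"
    by (rule exec_elims(6))
  with Seq.IH show ?case by metis
next
  case (WhileTrue r x p m t \<sigma>' t' \<sigma>'')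
  from WhileTrue.prems WhileTrue.hyps(1) obtain a \<rho> b
    where "exec W p (r, m) a \<rho>" and "exec W (While x p) \<rho> b \<tau>" and "u = a + b + 1"
    by (auto elim: exec_elims(8))
  with WhileTrue.IH show ?case by metis
next
  case (CondTrue r x p m t \<sigma>' q)
  from CondTrue.prems CondTrue.hyps(1) obtain a where "exec W p (r, m) a \<tau>" and "u = a + 1"
    by (auto elim: exec_elims(7))
  with CondTrue.IH show ?case by metis
next
  case (CondFalse r x q m t \<sigma>' p)
  from CondFalse.prems CondFalse.hyps(1) obtain a where "exec W q (r, m) a \<tau>" and "u = a + 1"
    by (auto elim: exec_elims(7))
  with CondFalse.IH show ?case by metis
next
  case (WhileFalse r x p m)
  from WhileFalse.prems WhileFalse.hyps show ?case by (auto elim: exec_elims(8))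
qed (auto elim: exec_elims)

definition init_regs :: "int list \<Rightarrow> reg \<Rightarrow> int" where
  "init_regs xs i = (if i < length xs then xs ! i else 0)"


section \<open>Single source replacement paths\<close>

definition no_negative_cycle :: "nat pair_pre_digraph \<Rightarrow> (nat \<times> nat \<Rightarrow> int) \<Rightarrow> bool" where
  "no_negative_cycle G w \<longleftrightarrow>
     (\<forall>p. pre_digraph.cycle (with_proj G) p \<longrightarrow> 0 \<le> (\<Sum>e\<leftarrow>p. w e))"

text \<open>Without negative cycles all the distances in question are well defined; they are infinite
  for unreachable vertices.\<close>

definition ssrp_instance ::
    "nat \<Rightarrow> nat pair_pre_digraph \<Rightarrow> (nat \<times> nat \<Rightarrow> int) \<Rightarrow> nat \<Rightarrow> bool" where
  "ssrp_instance n G w s \<longleftrightarrow>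
     pair_digraph G \<and> pverts G = {..<n} \<and> (\<forall>e \<in> parcs G. w e \<in> {-1, 0, 1}) \<and>
     no_negative_cycle G w \<and> s \<in> pverts G"

definition replacement_dist ::
    "nat pair_pre_digraph \<Rightarrow> (nat \<times> nat \<Rightarrow> int) \<Rightarrow> nat \<Rightarrow> nat \<Rightarrow> nat \<times> nat \<Rightarrow> ereal" where
  "replacement_dist G w s v e =
     wf_digraph.\<mu> (pre_digraph.del_arc (with_proj G) e) (\<lambda>a. real_of_int (w a)) s v"

text \<open>The graph is given by its row-major adjacency matrix, in which \<open>2\<close> marks a missing edge.\<close>

definition graph_memory ::
    "nat \<Rightarrow> nat pair_pre_digraph \<Rightarrow> (nat \<times> nat \<Rightarrow> int) \<Rightarrow> nat \<Rightarrow> int" where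
  "graph_memory n G w a =
     (if a < n * n then
        if (a div n, a mod n) \<in> parcs G then w (a div n, a mod n) else 2
      else 0)"

definition dist_regs :: "(reg \<Rightarrow> int) \<Rightarrow> ereal \<Rightarrow> bool" where
  "dist_regs r d \<longleftrightarrow>
     (if d = \<infinity> then r 0 = 0 else r 0 = 1 \<and> ereal (real_of_int (r 1)) = d)"

text \<open>
  A table listing the distances for all pairs of an edge and a vertex has cubic size on dense
  graphs, whereas algorithms for this problem are subcubic and leave an implicit table (e.g. one
  row for each edge of a shortest path tree only).  Hence \<open>p\<close> may leave any representation of the
  table in memory, as long as a program \<open>q\<close> that does not alter the memory reads off each single
  entry in constant time.  Only \<open>p\<close> is charged to \<open>T\<close>.  Words have \<open>O(log n)\<close> bits.
\<close>

definition ssrp_algorithm :: "prog \<Rightarrow> prog \<Rightarrow> (nat \<Rightarrow> real) \<Rightarrow> bool" where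
  "ssrp_algorithm p q T \<longleftrightarrow>
     (\<exists>c k. \<forall>n G w s. ssrp_instance n G w s \<longrightarrow>
       (\<exists>t r m. exec ((int n + 2) ^ c) p
             (init_regs [int n, int s], graph_memory n G w) t (r, m) \<and>
          real t \<le> T n \<and>
          (\<forall>(x, y) \<in> parcs G. \<forall>v \<in> pverts G. \<exists>t' r'.
             exec ((int n + 2) ^ c) q (init_regs [int x, int y, int v], m) t' (r', m) \<and>
             t' \<le> k \<and> dist_regs r' (replacement_dist G w s v (x, y)))))"


section \<open>Bounded-difference min-plus product\<close>

definition min_plus_product :: "int mat \<Rightarrow> int mat \<Rightarrow> int mat"  (infixl \<open>\<star>\<close> 70) where
  "A \<star> B = mat (dim_row A) (dim_col B)
     (\<lambda>(i, j). Min ((\<lambda>k. A $$ (i, k) + B $$ (k, j)) ` {..<dim_col A}))"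

definition bounded_difference :: "int mat \<Rightarrow> bool" where
  "bounded_difference A \<longleftrightarrow>
     (\<forall>i j. i < dim_row A \<and> j + 1 < dim_col A \<longrightarrow> \<bar>A $$ (i, j) - A $$ (i, j + 1)\<bar> \<le> 1) \<and>
     (\<forall>i j. i + 1 < dim_row A \<and> j < dim_col A \<longrightarrow> \<bar>A $$ (i, j) - A $$ (i + 1, j)\<bar> \<le> 1)"

definition matrices_memory :: "nat \<Rightarrow> int mat \<Rightarrow> int mat \<Rightarrow> nat \<Rightarrow> int" where
  "matrices_memory n A B a =
     (if a < n * n then A $$ (a div n, a mod n)
      else if a < 2 * (n * n) then B $$ ((a - n * n) div n, (a - n * n) mod n)
      else 0)"

text \<open>The product is left in row-major order at address \<open>0\<close>.  Since the entries of
  bounded-difference matrices can be arbitrarily large, words have \<open>O(log (n + M))\<close> bits, where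
  \<open>M\<close> bounds the absolute values of the entries.\<close>

definition bd_min_plus_algorithm :: "prog \<Rightarrow> (nat \<Rightarrow> real) \<Rightarrow> bool" where
  "bd_min_plus_algorithm p T \<longleftrightarrow>
     (\<exists>c. \<forall>n M A B.
       A \<in> carrier_mat n n \<and> B \<in> carrier_mat n n \<and>
       bounded_difference A \<and> bounded_difference B \<and>
       (\<forall>i<n. \<forall>j<n. \<bar>A $$ (i, j)\<bar> \<le> int M \<and> \<bar>B $$ (i, j)\<bar> \<le> int M) \<longrightarrow>
       (\<exists>t r m. exec ((int n + int M + 2) ^ c) p
             (init_regs [int n], matrices_memory n A B) t (r, m) \<and>
          real t \<le> T n \<and>
          (\<forall>i<n. \<forall>j<n. m (i * n + j) = (A \<star> B) $$ (i, j))))"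

end

theory Submission
  imports Defs
begin

text \<open>
  Split the inner dimension into blocks of width \<open>b\<close> of order \<open>sqrt n\<close>.  After subtracting the first column of a block
  from \<open>A\<close> and the first row from \<open>B\<close>, the entries \<open>\<alpha> i k\<close> and \<open>\<beta> k j\<close> are smaller than \<open>b\<close> in absolute value,
  so that one chain of \<open>4 * b\<close> unit weight arcs for each inner index realises them: row \<open>i\<close> enters chain \<open>k\<close> at
  position \<open>b - \<alpha> i k\<close> and column \<open>j\<close> is reached from position \<open>3 * b + \<beta> k j\<close>.  All chains of a block have
  \<open>4 * b * b \<le> n / 4\<close> vertices.  The rows hang on a path of arcs of weight -1, two arcs per row.  Deleting the
  path arc behind row \<open>i\<close> leaves the rows up to \<open>i\<close>, and among them row \<open>i\<close> is the best one, because the path gains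
  2 per row while \<open>\<alpha>\<close> changes by at most 2.  Hence one SSRP instance solves one block.

  The graphs must have exactly \<open>n\<close> vertices, as \<open>T\<close> is arbitrary; therefore rows and columns are also
  split into 8 groups each.  The remaining work is \<open>O(n\<^sup>2)\<close> per instance, which is \<open>O(T n)\<close> since an SSRP
  algorithm has to read quadratically many cells of the adjacency matrix.
\<close>

section \<open>The gadget graph\<close>

text \<open>The constants: a row takes two path arcs because \<alpha> is a difference of two entries
  of \<open>A\<close>, each of which moves by at most 1 per row. A chain has 4 * b positions so that
  entries at b - \<alpha> fall strictly between 0 and 2 * b and exits at 3 * b + \<beta> strictly
  between 2 * b and 4 * b: every exit lies behind every entry. With N = V div 4, the 2 * N path
  vertices and N targets leave a quarter of the V vertices for the chains, hence 16 * b * b \<le> V;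
  since V \<le> 8 * N, 8 groups of N indices suffice. The 64 pairs of groups times O(sqrt n) blocks
  give the number of phases. All arcs lead to larger vertex numbers, so the negative weights close
  no cycle. The magnitude of the matrix entries never enters a graph, only differences do, so the
  SSRP calls run on words whose size depends on V alone. The SSRP programs are black boxes: which
  cells they write is unknown, yet each run expects zeros behind its input. Hence every phase gets
  memory of its own, interleaved with that of the others, which enlarges addresses only by a
  polynomial factor.\<close>

definition weight_graph :: "nat \<Rightarrow> (nat \<Rightarrow> nat \<Rightarrow> int) \<Rightarrow> nat pair_pre_digraph" where
  "weight_graph n f = \<lparr>pverts = {..<n}, parcs = {(u, v). u < n \<and> v < n \<and> f u v \<noteq> 2}\<rparr>"

lemma pverts_weight_graph [simp]: "pverts (weight_graph n f) = {..<n}"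
  by (simp add: weight_graph_def)

lemma parcs_weight_graph [simp]:
  "(u, v) \<in> parcs (weight_graph n f) \<longleftrightarrow> u < n \<and> v < n \<and> f u v \<noteq> 2"
  by (simp add: weight_graph_def)

text \<open>Both encodings mark a missing arc by 2, so writing down the table of \<open>f\<close>
  produces exactly the input memory of an SSRP program.\<close>

lemma graph_memory_weight_graph:
  "graph_memory n (weight_graph n f) (case_prod f) a =
     (if a < n * n then f (a div n) (a mod n) else 0)"
proof (cases "a < n * n")
  case True
  then have "a div n < n" "a mod n < n"
    by (auto simp: less_mult_imp_div_less intro!: mod_less_divisor gr0I)
  then show ?thesis
    using True by (simp add: graph_memory_def)
qed (simp add: graph_memory_def)

text \<open>Vertex numbers increase along every nonempty walk, so there are no cycles at all and the
  condition on negative cycles is vacuous.\<close>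

lemma ssrp_instance_weight_graph:
  assumes f: "\<And>u v. u < n \<Longrightarrow> v < n \<Longrightarrow> f u v \<noteq> 2 \<Longrightarrow> u < v \<and> f u v \<in> {-1, 0, 1}"
    and s: "s < n"
  shows "ssrp_instance n (weight_graph n f) (case_prod f) s"
proof -
  let ?G = "weight_graph n f"
  have "parcs ?G \<subseteq> {..<n} \<times> {..<n}"
    by auto
  then have "finite (parcs ?G)"
    by (rule finite_subset) simp
  then interpret pair_digraph ?G
    by unfold_locales (use f in fastforce)+
  have incr: "p = [] \<or> u < v" if "awalk u p v" for u p v
    using that
  proof (induction p arbitrary: u)
    case (Cons e p)
    then obtain x y where e: "e = (x, y)" "(x, y) \<in> parcs ?G" "u = x" "awalk y p v"
      by (cases e) (auto simp: awalk_Cons_iff)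
    with f have "x < y"
      by simp
    with Cons.IH[OF e(4)] e show ?case
      by (auto simp: awalk_Nil_iff)
  qed simp
  have "\<not> cycle p" for p
    using incr by (auto simp: cycle_def)
  then have "no_negative_cycle ?G (case_prod f)"
    by (simp add: no_negative_cycle_def)
  moreover have "\<forall>e \<in> parcs ?G. case_prod f e \<in> {-1, 0, 1}"
    using f by (auto dest: f)
  ultimately show ?thesis
    using s pair_digraph_axioms by (simp add: ssrp_instance_def)
qed

section \<open>Replacement distances as infima over walks\<close>

inductive walk_cost ::
    "nat pair_pre_digraph \<Rightarrow> (nat \<times> nat \<Rightarrow> int) \<Rightarrow> nat \<Rightarrow> nat \<times> nat \<Rightarrow> nat \<Rightarrow> int \<Rightarrow> bool"
  for G w s e where
  source: "walk_cost G w s e s 0"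
| arc: "walk_cost G w s e u d \<Longrightarrow> (u, v) \<in> parcs G \<Longrightarrow> (u, v) \<noteq> e \<Longrightarrow>
    walk_cost G w s e v (d + w (u, v))"

text \<open>Trades arc lists in the digraph with a deleted arc for an inductive predicate, so that
  later bounds are plain rule inductions. An unreachable vertex yields the infimum of the empty set,
  which is infinite as required.\<close>

lemma replacement_dist_eq_INF:
  assumes G: "pair_digraph G" and s: "s \<in> pverts G"
  shows "replacement_dist G w s v e = (INF d \<in> {d. walk_cost G w s e v d}. ereal (real_of_int d))"
proof -
  interpret G: pair_digraph G by fact
  interpret H: wf_digraph "pre_digraph.del_arc (with_proj G) e"
    by (rule G.wf_digraph_del_arc)
  let ?c = "\<lambda>a. real_of_int (w a)"
  have arcs: "arcs (pre_digraph.del_arc (with_proj G) e) = parcs G - {e}"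
    by (simp add: pre_digraph.del_arc_simps)
  have ends: "tail (pre_digraph.del_arc (with_proj G) e) = fst"
       "head (pre_digraph.del_arc (with_proj G) e) = snd"
       "verts (pre_digraph.del_arc (with_proj G) e) = pverts G"
    by (simp_all add: pre_digraph.del_arc_simps)
  have to_walk: "\<exists>p. H.awalk s p v \<and> H.awalk_cost ?c p = d" if "walk_cost G w s e v d" for v d
    using that
  proof induction
    case source
    show ?case
      using s ends by (intro exI[of _ "[]"]) (simp add: H.awalk_Nil_iff)
  next
    case (arc u d v)
    then obtain p where p: "H.awalk s p u" "H.awalk_cost ?c p = d"
      by blast
    have "H.awalk u [(u, v)] v"
      using H.arc_implies_awalk[of "(u, v)"] arc.hyps arcs ends by simp
    with p have "H.awalk s (p @ [(u, v)]) v"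
      by (meson H.awalk_appendI)
    with p show ?case
      by (intro exI[of _ "p @ [(u, v)]"]) simp
  qed
  \<comment> \<open>Arc lists grow at the front but \<open>walk_cost\<close> grows at the end;
    allowing an arbitrary cost \<open>d\<close> already spent on reaching \<open>u\<close>
    reconciles the two directions.\<close>
  have of_walk: "\<exists>d'. walk_cost G w s e v (d + d') \<and> real_of_int d' = H.awalk_cost ?c p"
    if "H.awalk u p v" "walk_cost G w s e u d" for u p v d
    using that
  proof (induction p arbitrary: u d)
    case Nil
    then show ?case by (auto simp: H.awalk_Nil_iff)
  next
    case (Cons a p)
    obtain x y where a: "a = (x, y)" by fastforce
    with Cons.prems have xy: "u = x" "(x, y) \<in> parcs G" "(x, y) \<noteq> e" "H.awalk y p v"
      by (simp_all add: H.awalk_Cons_iff arcs ends)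
    with Cons.prems have "walk_cost G w s e y (d + w (x, y))"
      by (auto intro: walk_cost.arc)
    with Cons.IH[OF xy(4)] a show ?case
      by (fastforce simp: add.assoc intro: exI[where x = "w (x, y) + _"])
  qed
  have "(\<lambda>p. ereal (H.awalk_cost ?c p)) ` {p. H.awalk s p v} =
      (\<lambda>d. ereal (real_of_int d)) ` {d. walk_cost G w s e v d}" (is "?A = ?B")
  proof
    show "?A \<subseteq> ?B"
      using of_walk[OF _ walk_cost.source] by (fastforce simp: image_iff)
    show "?B \<subseteq> ?A"
      using to_walk by (fastforce simp: image_iff)
  qed
  then show ?thesis
    unfolding replacement_dist_def H.\<mu>_def by simp
qed

section \<open>The gadget graph of one block\<close>

locale gadget =
  fixes N b V :: nat and \<alpha> \<beta> :: "nat \<Rightarrow> nat \<Rightarrow> int"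
  assumes b_pos: "0 < b"
    and size: "3 * N + 4 * (b * b) \<le> V"
    and \<alpha>_bound: "\<And>i k. k < b \<Longrightarrow> \<bar>\<alpha> i k\<bar> < int b"
    and \<beta>_bound: "\<And>k j. k < b \<Longrightarrow> \<bar>\<beta> k j\<bar> < int b"
    and \<alpha>_lipschitz: "\<And>i i' k. i' \<le> i \<Longrightarrow> k < b \<Longrightarrow> \<alpha> i k - \<alpha> i' k \<le> 2 * (int i - int i')"
begin

text \<open>Vertices are numbered path first, then chains, then targets, which makes all arcs
  increasing. Only even path vertices are rows; an odd one has no exit, so cutting behind vertex 2 *
  i separates row i from all later rows. The test for residue 0 severs consecutive chains. All
  vertices behind the chains are targets, also those beyond the first N; no arc leaves them.\<close>

definition weight :: "nat \<Rightarrow> nat \<Rightarrow> int" where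
  "weight u v =
     (if u < 2 * N then
        if v < 2 * N then if v = u + 1 then -1 else 2
        else if v < 2 * N + 4 * (b * b) then
          if u mod 2 = 0 then
            if int ((v - 2 * N) mod (4 * b)) = int b - \<alpha> (u div 2) ((v - 2 * N) div (4 * b))
            then 0 else 2
          else 2
        else 2
      else if u < 2 * N + 4 * (b * b) then
        if v < 2 * N + 4 * (b * b) then
          if v = u + 1 then if (v - 2 * N) mod (4 * b) = 0 then 2 else 1 else 2
        else if int ((u - 2 * N) mod (4 * b)) =
            3 * int b + \<beta> ((u - 2 * N) div (4 * b)) (v - (2 * N + 4 * (b * b)))
          then 0 else 2
      else 2)"

abbreviation G :: "nat pair_pre_digraph" where
  "G \<equiv> weight_graph V weight"

definition chain :: "nat \<Rightarrow> nat \<Rightarrow> nat" where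
  "chain k x = 2 * N + (k * (4 * b) + x)"

definition target :: "nat \<Rightarrow> nat" where
  "target j = 2 * N + 4 * (b * b) + j"

lemma weight_increasing:
  "weight u v \<noteq> 2 \<Longrightarrow> u < v \<and> weight u v \<in> {-1, 0, 1}"
proof -
  \<comment> \<open>Only the shape of the case tree matters here, so the arithmetic conditions are
    abstracted to arbitrary propositions before splitting.\<close>
  have "u < v \<and> z \<in> {-1, 0, 1}"
    if "z = (if u < l then if v < l then if v = u + 1 then -1 else 2
          else if v < h then if P then if Q then 0 else 2 else 2 else 2
        else if u < h then if v < h then if v = u + 1 then if R then 2 else 1 else 2
          else if S then 0 else 2
        else 2)" and "z \<noteq> 2"
    for l h z P Q R S
    using that by (simp split: if_split_asm)
  from this[OF weight_def] show "weight u v \<noteq> 2 \<Longrightarrow> u < v \<and> weight u v \<in> {-1, 0, 1}"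
    by blast
qed

lemma ssrp_instance_gadget: "0 < N \<Longrightarrow> ssrp_instance V G (case_prod weight) 0"
  using size by (intro ssrp_instance_weight_graph weight_increasing) auto

lemma chain_bound: "k < b \<Longrightarrow> x < 4 * b \<Longrightarrow> k * (4 * b) + x < 4 * (b * b)"
proof -
  assume "k < b" "x < 4 * b"
  then have "k * (4 * b) + x < Suc k * (4 * b)" by simp
  also have "\<dots> \<le> b * (4 * b)"
    using \<open>k < b\<close> by (intro mult_le_mono) auto
  finally show ?thesis by (simp add: algebra_simps)
qed

lemma weight_path: "u + 1 < 2 * N \<Longrightarrow> weight u (u + 1) = -1"
  by (simp add: weight_def)

lemma weight_enter:
  assumes "i < N" "k < b" "int x = int b - \<alpha> i k"
  shows "weight (2 * i) (chain k x) = 0"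
proof -
  have "x < 4 * b"
    using \<alpha>_bound[OF assms(2), of i] assms(3) by linarith
  then show ?thesis
    using assms chain_bound[of k x] by (simp add: weight_def chain_def)
qed

lemma weight_chain:
  assumes "k < b" "Suc x < 4 * b"
  shows "weight (chain k x) (chain k (Suc x)) = 1"
proof -
  have "(k * (4 * b) + Suc x) mod (4 * b) = Suc x"
    using assms by (metis mod_less mod_mult_self3)
  then show ?thesis
    using assms chain_bound[of k x] chain_bound[of k "Suc x"] by (simp add: weight_def chain_def)
qed

lemma weight_leave:
  assumes "k < b" "int x = 3 * int b + \<beta> k j"
  shows "weight (chain k x) (target j) = 0"
proof -
  have "x < 4 * b"
    using \<beta>_bound[OF assms(1), of j] assms(2) by linarith
  then show ?thesis
    using assms chain_bound[of k x] by (simp add: weight_def chain_def target_def)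
qed

context
  fixes i j :: nat
  assumes i: "i < N" and j: "j < N"
begin

abbreviation (input) wc :: "nat \<Rightarrow> int \<Rightarrow> bool" where
  "wc \<equiv> walk_cost G (case_prod weight) 0 (2 * i, 2 * i + 1)"

lemma walk_cost_path: "u \<le> 2 * i \<Longrightarrow> wc u (- int u)"
proof (induction u)
  case 0
  show ?case using walk_cost.source by simp
next
  case (Suc u)
  then have w: "weight u (Suc u) = -1"
    using weight_path[of u] i by simp
  from Suc have "wc u (- int u)" by simp
  from walk_cost.arc[OF this, of "Suc u"] Suc.prems w i size show ?case
    by (simp add: algebra_simps)
qed

text \<open>The intended walk: the path to row i costs -2 * i, entering at x and leaving at y are
  free, and the y - x = 2 * b + \<alpha> + \<beta> chain arcs between them cost 1 each.\<close>

lemma walk_cost_target: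
  assumes k: "k < b"
  shows "wc (target j) (- 2 * int i + 2 * int b + \<alpha> i k + \<beta> k j)"
proof -
  define x where "x = nat (int b - \<alpha> i k)"
  define y where "y = nat (3 * int b + \<beta> k j)"
  have x: "int x = int b - \<alpha> i k"
    using \<alpha>_bound[OF k, of i] by (simp add: x_def)
  have y: "int y = 3 * int b + \<beta> k j"
    using \<beta>_bound[OF k, of j] by (simp add: y_def)
  have y_less: "y < 4 * b" and x_le_y: "x \<le> y"
    using \<alpha>_bound[OF k, of i] \<beta>_bound[OF k, of j] x y by linarith+
  have inV: "chain k z < V" if "z < 4 * b" for z
    using chain_bound[OF k that] size by (simp add: chain_def)
  have "wc (chain k (x + z)) (- 2 * int i + int z)" if "x + z \<le> y" for z
    using that
  proof (induction z)
    case 0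
    from walk_cost.arc[OF walk_cost_path[of "2 * i"], of "chain k x"]
    show ?case
      using weight_enter[OF i k x] inV[of x] i size x_le_y y_less
      by (simp add: chain_def)
  next
    case (Suc z)
    then have "wc (chain k (x + z)) (- 2 * int i + int z)" by simp
    from walk_cost.arc[OF this, of "chain k (Suc (x + z))"]
    show ?case
      using weight_chain[OF k, of "x + z"] inV[of "x + z"] inV[of "Suc (x + z)"] Suc.prems y_less i
      by (simp add: chain_def algebra_simps)
  qed
  from this[of "y - x"] x_le_y have "wc (chain k y) (- 2 * int i + (int y - int x))"
    by (simp add: of_nat_diff)
  from walk_cost.arc[OF this, of "target j"]
  show ?thesis
    using weight_leave[OF k y] inV[OF y_less] j i size x y
    by (simp add: target_def algebra_simps)
qed

text \<open>The invariant of a walk avoiding the deleted arc: a row \<open>i' \<le> i\<close> at which it leaves the path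
  is at most as good as row \<open>i\<close>, since the path gains 2 per row and \<open>\<alpha>\<close> varies by at most 2.\<close>

lemma walk_cost_lower_bound:
  assumes "wc u d"
  shows "(u < 2 * N \<longrightarrow> u \<le> 2 * i \<and> d = - int u) \<and>
    (\<forall>k x. u = chain k x \<and> k < b \<and> x < 4 * b \<longrightarrow>
       - 2 * int i + int x - int b + \<alpha> i k \<le> d) \<and>
    (\<forall>j'. u = target j' \<longrightarrow> (\<exists>k<b. - 2 * int i + 2 * int b + \<alpha> i k + \<beta> k j' \<le> d))"
  using assms
proof induction
  case source
  then show ?case
    using i by (auto simp: chain_def target_def)
next
  case (arc u d v)
  have uv: "weight u v \<noteq> 2" "(u, v) \<noteq> (2 * i, 2 * i + 1)" "u < V" "v < V"
    using arc.hyps by auto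
  consider "v < 2 * N" | "2 * N \<le> v" "v < 2 * N + 4 * (b * b)" | "2 * N + 4 * (b * b) \<le> v"
    by linarith
  then show ?case
  proof cases
    case 1
    then have "u < 2 * N" "v = u + 1" "weight u v = -1"
      using uv by (auto simp: weight_def split: if_splits)
    \<comment> \<open>From u \<le> 2 * i and the deletion of the arc behind 2 * i, even v = u + 1
      stays at most 2 * i.\<close>
    with arc.IH uv 1 show ?thesis
      by (auto simp: chain_def target_def)
  next
    case 2
    have bound: "- 2 * int i + int x - int b + \<alpha> i k \<le> d + weight u v"
      if v: "v = chain k x" "k < b" "x < 4 * b" for k x
    proof -
      have divmod: "(v - 2 * N) div (4 * b) = k" "(v - 2 * N) mod (4 * b) = x"
        using v b_pos by (simp_all add: chain_def)
      show ?thesis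
      proof (cases "u < 2 * N")
        case True
        with 2 uv divmod have w: "weight u v = 0" "u mod 2 = 0"
            "int x = int b - \<alpha> (u div 2) k"
          by (auto simp: weight_def split: if_splits)
        define i' where "i' = u div 2"
        have u: "u = 2 * i'"
          using w(2) by (simp add: i'_def mod_0_imp_dvd)
        \<comment> \<open>A chain is entered from row i' at x = b - \<alpha> i' k with d = -2 * i',
          so the claimed bound amounts to \<alpha> i k - \<alpha> i' k \<le> 2 * (i - i'), the
          Lipschitz assumption.\<close>
        with arc.IH True have "i' \<le> i" "d = - 2 * int i'"
          by auto
        with \<alpha>_lipschitz[OF \<open>i' \<le> i\<close> \<open>k < b\<close>] w u show ?thesis
          by simp
      next
        case False
        \<comment> \<open>x \<noteq> 0 because the arc between two chains is missing; hence the
          predecessor lies on the same chain.\<close>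
        with 2 uv divmod have w: "weight u v = 1" "v = u + 1" "x \<noteq> 0"
          by (auto simp: weight_def split: if_splits)
        then have "u = chain k (x - 1)"
          using v by (simp add: chain_def)
        with arc.IH v have "- 2 * int i + int (x - 1) - int b + \<alpha> i k \<le> d"
          by auto
        with w show ?thesis
          by simp
      qed
    qed
    with 2 show ?thesis
      by (auto simp: target_def)
  next
    case 3
    have bound: "\<exists>k<b. - 2 * int i + 2 * int b + \<alpha> i k + \<beta> k j' \<le> d + weight u v"
      if v: "v = target j'" for j'
    proof -
      define k where "k = (u - 2 * N) div (4 * b)"
      define x where "x = (u - 2 * N) mod (4 * b)"
      have u: "2 * N \<le> u" "u < 2 * N + 4 * (b * b)" and w: "weight u v = 0"
          "int x = 3 * int b + \<beta> k j'"
        using uv v 3 by (auto simp: weight_def k_def x_def target_def split: if_splits)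
      then have "u = chain k x"
        by (simp add: chain_def k_def x_def div_mult_mod_eq)
      moreover have "x < 4 * b"
        using b_pos by (simp add: x_def)
      moreover have "k < b"
        using u b_pos by (simp add: k_def less_mult_imp_div_less algebra_simps)
      ultimately have "- 2 * int i + int x - int b + \<alpha> i k \<le> d"
        using arc.IH by blast
      with w \<open>k < b\<close> show ?thesis
        by (intro exI[of _ k]) simp
    qed
    moreover have "v \<noteq> chain k x" if "k < b" "x < 4 * b" for k x
      using chain_bound[OF that] 3 by (simp add: chain_def)
    ultimately show ?thesis
      using 3 by auto
  qed
qed

text \<open>The minimising index k gives a walk of this cost, and the invariant shows that every
  walk to the target is at least as expensive as the intended one for some k. The terms -2 * i + 2 *
  b are known, so the query reveals the block minimum.\<close>

lemma replacement_dist_gadget: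
  "replacement_dist G (case_prod weight) 0 (target j) (2 * i, 2 * i + 1) =
     ereal (real_of_int (- 2 * int i + 2 * int b + Min ((\<lambda>k. \<alpha> i k + \<beta> k j) ` {..<b})))"
    (is "_ = ereal (real_of_int ?m)")
proof -
  have ne: "(\<lambda>k. \<alpha> i k + \<beta> k j) ` {..<b} \<noteq> {}"
    using b_pos by auto
  then obtain k where k: "k < b" "Min ((\<lambda>k. \<alpha> i k + \<beta> k j) ` {..<b}) = \<alpha> i k + \<beta> k j"
    using Min_in[OF _ ne] by fastforce
  have "pair_digraph G" "0 \<in> pverts G"
    using ssrp_instance_gadget i by (auto simp: ssrp_instance_def)
  note eq = replacement_dist_eq_INF[OF this]
  show ?thesis
    unfolding eq
  proof (rule antisym)
    have "wc (target j) ?m"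
      using walk_cost_target[OF k(1)] k(2) by (simp add: add.assoc)
    then show "(INF d \<in> {d. wc (target j) d}. ereal (real_of_int d)) \<le> ereal (real_of_int ?m)"
      by (intro INF_lower) (rule CollectI)
    show "ereal (real_of_int ?m) \<le> (INF d \<in> {d. wc (target j) d}. ereal (real_of_int d))"
    proof (rule INF_greatest)
      fix d assume "d \<in> {d. wc (target j) d}"
      then obtain k where "k < b" "- 2 * int i + 2 * int b + \<alpha> i k + \<beta> k j \<le> d"
        using walk_cost_lower_bound[of "target j" d] by blast
      moreover from \<open>k < b\<close> have "Min ((\<lambda>k. \<alpha> i k + \<beta> k j) ` {..<b}) \<le> \<alpha> i k + \<beta> k j"
        by (intro Min_le) auto
      ultimately have "?m \<le> d" by linarith
      then show "ereal (real_of_int ?m) \<le> ereal (real_of_int d)"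
        by simp
    qed
  qed
qed

end

end

section \<open>Programming the word RAM\<close>

lemma exec_mono: "exec W p \<sigma> t \<sigma>' \<Longrightarrow> W \<le> W' \<Longrightarrow> exec W' p \<sigma> t \<sigma>'"
  by (induction rule: exec.induct) (auto simp del: One_nat_def intro: exec.intros)

text \<open>Addresses computed by a program are register contents, so this bounds them and thereby
  the addresses after relocation; it also bounds the table that an SSRP program leaves
  behind.\<close>

lemma exec_bounded:
  assumes "exec W p \<sigma> t \<sigma>'"
    and "\<forall>x. \<bar>fst \<sigma> x\<bar> \<le> W" "\<forall>a. \<bar>snd \<sigma> a\<bar> \<le> W"
  shows "(\<forall>x. \<bar>fst \<sigma>' x\<bar> \<le> W) \<and> (\<forall>a. \<bar>snd \<sigma>' a\<bar> \<le> W)"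
  using assms by (induction rule: exec.induct) simp_all

subsection \<open>Expressions\<close>

datatype exp = Reg reg | Lit int | Bin binop exp exp | Deref exp | Ite exp exp exp

fun eval :: "exp \<Rightarrow> (reg \<Rightarrow> int) \<Rightarrow> (nat \<Rightarrow> int) \<Rightarrow> int" where
  "eval (Reg x) r m = r x"
| "eval (Lit k) r m = k"
| "eval (Bin f a b) r m = apply_op f (eval a r m) (eval b r m)"
| "eval (Deref a) r m = m (nat (eval a r m))"
| "eval (Ite c a b) r m = (if eval c r m \<noteq> 0 then eval a r m else eval b r m)"

text \<open>Registers from \<open>d\<close> upwards serve as an evaluation stack with the result in
  \<open>d\<close>. The bitwise or of a register with itself replaces the missing move instruction
  and cannot overflow on a word that fits.\<close>

fun code :: "exp \<Rightarrow> reg \<Rightarrow> prog" where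
  "code (Reg x) d = Op Or d x x"
| "code (Lit k) d = Const d k"
| "code (Bin f a b) d = Seq (code a d) (Seq (code b (Suc d)) (Op f d d (Suc d)))"
| "code (Deref a) d = Seq (code a d) (Load d d)"
| "code (Ite c a b) d = Seq (code c d) (Cond d (code a d) (code b d))"

fun cost :: "exp \<Rightarrow> nat" where
  "cost (Reg x) = 1"
| "cost (Lit k) = 1"
| "cost (Bin f a b) = cost a + cost b + 1"
| "cost (Deref a) = cost a + 1"
| "cost (Ite c a b) = cost c + cost a + cost b + 1"

fun below :: "reg \<Rightarrow> exp \<Rightarrow> bool" where
  "below d (Reg x) \<longleftrightarrow> x < d"
| "below d (Lit k) \<longleftrightarrow> True"
| "below d (Bin f a b) \<longleftrightarrow> below d a \<and> below d b"
| "below d (Deref a) \<longleftrightarrow> below d a"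
| "below d (Ite c a b) \<longleftrightarrow> below d c \<and> below d a \<and> below d b"

text \<open>If all leaves of an evaluated expression have absolute value at most \<open>X\<close>, no intermediate result
  exceeds \<open>X ^ leaves e\<close>; overflow checks thereby reduce to bounds on the leaves.\<close>

fun safe :: "int \<Rightarrow> exp \<Rightarrow> (reg \<Rightarrow> int) \<Rightarrow> (nat \<Rightarrow> int) \<Rightarrow> bool" where
  "safe X (Reg x) r m \<longleftrightarrow> \<bar>r x\<bar> \<le> X"
| "safe X (Lit k) r m \<longleftrightarrow> \<bar>k\<bar> \<le> X"
| "safe X (Bin f a b) r m \<longleftrightarrow>
     f \<in> {Add, Sub, Mul, Div, Mod, Less, Equal} \<and> safe X a r m \<and> safe X b r m"
| "safe X (Deref a) r m \<longleftrightarrow> safe X a r m \<and> 0 \<le> eval a r m \<and> \<bar>m (nat (eval a r m))\<bar> \<le> X"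
| "safe X (Ite c a b) r m \<longleftrightarrow>
     safe X c r m \<and> (if eval c r m \<noteq> 0 then safe X a r m else safe X b r m)"

fun leaves :: "exp \<Rightarrow> nat" where
  "leaves (Reg x) = 1"
| "leaves (Lit k) = 1"
| "leaves (Bin f a b) = leaves a + leaves b"
| "leaves (Deref a) = leaves a"
| "leaves (Ite c a b) = leaves c + leaves a + leaves b"

lemma leaves_pos [simp]: "0 < leaves e"
  by (induction e) auto

lemma abs_div_le: "\<bar>a div b\<bar> \<le> \<bar>a :: int\<bar>"
proof (cases "b = 0")
  case False
  \<comment> \<open>Reduces to a positive divisor. Division rounds down, so a negative dividend
    needs its own argument: its quotient lies between the dividend and 0.\<close>
  have "\<bar>a div b\<bar> = \<bar>(a * sgn b) div \<bar>b\<bar>\<bar>"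
    using False by (cases "b > 0") (simp_all add: sgn_if)
  also have "\<dots> \<le> \<bar>a * sgn b\<bar>"
  proof -
    define c where "c = a * sgn b"
    have b: "\<bar>b\<bar> \<ge> 1" using False by simp
    show ?thesis
    proof (cases "c \<ge> 0")
      case True
      then show ?thesis
        using b by (simp add: c_def[symmetric] zdiv_mono2[of c 1 "\<bar>b\<bar>", simplified]
            pos_imp_zdiv_nonneg_iff abs_of_nonneg)
    next
      case False
      then have "c \<le> c div \<bar>b\<bar>" "c div \<bar>b\<bar> < 0"
        using b zdiv_mono2_neg[of c 1 "\<bar>b\<bar>"] by (simp_all add: div_neg_pos_less0)
      with False show ?thesis
        by (simp add: c_def[symmetric])
    qed
  qed
  also have "\<dots> = \<bar>a\<bar>"
    using False by (simp add: abs_mult abs_sgn_eq)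
  finally show ?thesis .
qed simp

lemma abs_mod_le: "\<bar>a mod b\<bar> \<le> \<bar>a\<bar> + \<bar>b :: int\<bar>"
proof (cases "b = 0")
  case False
  have "\<bar>a mod b\<bar> < \<bar>b\<bar>"
    using False by (rule abs_mod_less)
  then show ?thesis
    by linarith
qed simp

text \<open>For numbers P, Q \<ge> 2 the product (P - 2) * (Q - 2) is nonnegative, so P * Q \<ge> 2
  * (P + Q) - 4 \<ge> P + Q.\<close>

lemma power_add_le_mult:
  fixes X :: int
  assumes "2 \<le> X" "0 < p" "0 < q"
  shows "X ^ p + X ^ q \<le> X ^ (p + q)"
proof -
  have "2 \<le> X ^ p" "2 \<le> X ^ q"
    using assms self_le_power[of X p] self_le_power[of X q] by linarith+
  then have "0 \<le> (X ^ p - 2) * (X ^ q - 2)" "4 \<le> X ^ p + X ^ q"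
    by (simp_all add: mult_nonneg_nonneg)
  then have "X ^ p + X ^ q \<le> X ^ p * X ^ q"
    by (simp add: algebra_simps)
  then show ?thesis
    by (simp add: power_add)
qed

text \<open>Sums, differences and remainders are bounded by the sum of the operand bounds, products
  by their product, quotients by the left operand and comparisons by 1. All of these are absorbed by
  adding the exponents.\<close>

lemma safe_abs_eval:
  assumes "safe X e r m" "2 \<le> X"
  shows "\<bar>eval e r m\<bar> \<le> X ^ leaves e"
  using assms
proof (induction e)
  case (Bin f a b)
  then have a: "\<bar>eval a r m\<bar> \<le> X ^ leaves a" and b: "\<bar>eval b r m\<bar> \<le> X ^ leaves b"
    by simp_all
  have sum: "X ^ leaves a + X ^ leaves b \<le> X ^ (leaves a + leaves b)"
    using Bin.prems by (intro power_add_le_mult) simp_all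
  have one: "1 \<le> X ^ (leaves a + leaves b)"
    using Bin.prems by (intro one_le_power) simp
  have mult: "\<bar>eval a r m * eval b r m\<bar> \<le> X ^ (leaves a + leaves b)"
    using a b by (simp add: abs_mult power_add mult_mono')
  from Bin.prems have "f \<in> {Add, Sub, Mul, Div, Mod, Less, Equal}" by simp
  with a b sum one mult abs_div_le[of "eval a r m" "eval b r m"]
    abs_mod_le[of "eval a r m" "eval b r m"]
  show ?case
    by (auto simp: of_bool_def)
next
  case (Deref a)
  then show ?case
    using self_le_power[of X "leaves a"] by simp
next
  case (Ite c a b)
  have "X ^ leaves a \<le> X ^ leaves (Ite c a b)" "X ^ leaves b \<le> X ^ leaves (Ite c a b)"
    using Ite.prems by (auto intro!: power_increasing)
  from this[THEN order_trans[rotated]] Ite show ?case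
    by (auto split: if_splits)
qed simp_all

lemma exec_codeI:
  "exec W p (r0, m) t (r', m) \<Longrightarrow> t \<le> c \<Longrightarrow> r' d = v \<Longrightarrow> (\<And>x. x < d \<Longrightarrow> r' x = r0 x) \<Longrightarrow>
    \<exists>t r'. exec W p (r0, m) t (r', m) \<and> t \<le> c \<and> r' d = v \<and> (\<forall>x<d. r' x = r0 x)"
  by blast

text \<open>The actual registers \<open>r0\<close> need to agree with \<open>r\<close> only below
  \<open>d0\<close>, where the variables of the expression live. This lets the induction run with
  intermediate results already on the stack.\<close>

lemma exec_code:
  assumes "safe X e r m" "2 \<le> X" "below d0 e" "d0 \<le> d" "X ^ leaves e \<le> W"
    and "\<forall>x<d0. r0 x = r x"
  shows "\<exists>t r'. exec W (code e d) (r0, m) t (r', m) \<and> t \<le> cost e \<and> r' d = eval e r m \<and>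
    (\<forall>x<d. r' x = r0 x)"
  using assms
proof (induction e arbitrary: d r0)
  case (Reg x)
  then have "exec W (Op Or d x x) (r0, m) 1 (r0(d := apply_op Or (r0 x) (r0 x)), m)"
    by (intro exec.Op) simp
  note e = this
  show ?case
    unfolding code.simps by (rule exec_codeI[OF e]) (use Reg in simp_all)
next
  case (Lit k)
  then have "exec W (Const d k) (r0, m) 1 (r0(d := k), m)"
    by (intro exec.Const) simp
  note e = this
  show ?case
    unfolding code.simps by (rule exec_codeI[OF e]) simp_all
next
  case (Bin f a b)
  have le: "X ^ leaves a \<le> W" "X ^ leaves b \<le> W"
    using Bin.prems by (auto intro!: order_trans[OF power_increasing Bin.prems(5)])
  with Bin.prems obtain t1 r1 where 1: "exec W (code a d) (r0, m) t1 (r1, m)" "t1 \<le> cost a"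
      "r1 d = eval a r m" "\<forall>x<d. r1 x = r0 x"
    using Bin.IH(1)[of d r0] by auto
  with Bin.prems le obtain t2 r2 where 2: "exec W (code b (Suc d)) (r1, m) t2 (r2, m)"
      "t2 \<le> cost b" "r2 (Suc d) = eval b r m" "\<forall>x<Suc d. r2 x = r1 x"
    using Bin.IH(2)[of "Suc d" r1] by auto
  have "r2 d = eval a r m"
    using 1 2 by simp
  moreover have "\<bar>eval (Bin f a b) r m\<bar> \<le> W"
    using safe_abs_eval[OF Bin.prems(1,2)] Bin.prems(5) by linarith
  ultimately have "exec W (Op f d d (Suc d)) (r2, m) 1 (r2(d := eval (Bin f a b) r m), m)"
    using exec.Op[of f r2 d "Suc d" W d m] 2 by simp
  note e = exec.Seq[OF 1(1) exec.Seq[OF 2(1) this]]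
  show ?case
    unfolding code.simps by (rule exec_codeI[OF e]) (use 1 2 in simp_all)
next
  case (Deref a)
  then obtain t1 r1 where 1: "exec W (code a d) (r0, m) t1 (r1, m)" "t1 \<le> cost a"
      "r1 d = eval a r m" "\<forall>x<d. r1 x = r0 x"
    using Deref.IH[of d r0] by fastforce
  have "exec W (Load d d) (r1, m) 1 (r1(d := m (nat (r1 d))), m)"
    using 1 Deref.prems by (intro exec.Load) simp
  note e = exec.Seq[OF 1(1) this]
  show ?case
    unfolding code.simps by (rule exec_codeI[OF e]) (use 1 in simp_all)
next
  case (Ite c a b)
  have le: "X ^ leaves c \<le> W" "X ^ leaves a \<le> W" "X ^ leaves b \<le> W"
    using Ite.prems by (auto intro!: order_trans[OF power_increasing Ite.prems(5)])
  with Ite.prems obtain t1 r1 where 1: "exec W (code c d) (r0, m) t1 (r1, m)" "t1 \<le> cost c"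
      "r1 d = eval c r m" "\<forall>x<d. r1 x = r0 x"
    using Ite.IH(1)[of d r0] by auto
  show ?case
  proof (cases "eval c r m = 0")
    case False
    with Ite.prems le 1 obtain t2 r2 where 2: "exec W (code a d) (r1, m) t2 (r2, m)"
      "t2 \<le> cost a" "r2 d = eval a r m" "\<forall>x<d. r2 x = r1 x"
      using Ite.IH(2)[of d r1] by auto
    have "exec W (Cond d (code a d) (code b d)) (r1, m) (t2 + 1) (r2, m)"
      using 1 2 False by (intro exec.CondTrue) simp_all
    note e = exec.Seq[OF 1(1) this]
    show ?thesis
      unfolding code.simps by (rule exec_codeI[OF e]) (use 1 2 False in simp_all)
  next
    case True
    with Ite.prems le 1 obtain t2 r2 where 2: "exec W (code b d) (r1, m) t2 (r2, m)"
      "t2 \<le> cost b" "r2 d = eval b r m" "\<forall>x<d. r2 x = r1 x"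
      using Ite.IH(3)[of d r1] by auto
    have "exec W (Cond d (code a d) (code b d)) (r1, m) (t2 + 1) (r2, m)"
      using 1 2 True by (intro exec.CondFalse) simp_all
    note e = exec.Seq[OF 1(1) this]
    show ?thesis
      unfolding code.simps by (rule exec_codeI[OF e]) (use 1 2 True in simp_all)
  qed
qed

subsection \<open>A program logic with time bounds\<close>

text \<open>Registers below 20 are program variables; all others are scratch registers, whose contents the
  assertions do not see.\<close>

definition same_vars :: "(reg \<Rightarrow> int) \<Rightarrow> (reg \<Rightarrow> int) \<Rightarrow> bool" where
  "same_vars r r' \<longleftrightarrow> (\<forall>x<20. r x = r' x)"

text \<open>Starting from any \<open>r0\<close> and ending up to \<open>same_vars\<close> hides the
  scratch registers on both sides. Postconditions can then speak of exact updates of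
  \<open>r\<close>, although the real registers also contain debris.\<close>

definition wp :: "int \<Rightarrow> prog \<Rightarrow> nat \<Rightarrow> ((reg \<Rightarrow> int) \<Rightarrow> (nat \<Rightarrow> int) \<Rightarrow> bool) \<Rightarrow>
    (reg \<Rightarrow> int) \<Rightarrow> (nat \<Rightarrow> int) \<Rightarrow> bool" where
  "wp W p t Q r m \<longleftrightarrow> (\<forall>r0. same_vars r0 r \<longrightarrow>
     (\<exists>t' r1 r2 m'. exec W p (r0, m) t' (r1, m') \<and> t' \<le> t \<and> same_vars r1 r2 \<and> Q r2 m'))"

lemma wpI:
  "(\<And>r0. same_vars r0 r \<Longrightarrow> \<exists>t' r1 m'. exec W p (r0, m) t' (r1, m') \<and> t' \<le> t \<and>
    (\<exists>r2. same_vars r1 r2 \<and> Q r2 m')) \<Longrightarrow> wp W p t Q r m"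
  unfolding wp_def by blast

lemma wp_execI:
  "exec W p (r0, m) t' (r1, m') \<Longrightarrow> t' \<le> t \<Longrightarrow> same_vars r1 r2 \<Longrightarrow> Q r2 m' \<Longrightarrow>
    \<exists>t' r1 m'. exec W p (r0, m) t' (r1, m') \<and> t' \<le> t \<and> (\<exists>r2. same_vars r1 r2 \<and> Q r2 m')"
  by blast

lemma wp_mono:
  "wp W p t Q r m \<Longrightarrow> t \<le> t' \<Longrightarrow> (\<And>r' m'. Q r' m' \<Longrightarrow> Q' r' m') \<Longrightarrow> wp W p t' Q' r m"
  unfolding wp_def by (meson order_trans)

lemma wp_Seq:
  assumes "wp W p t (wp W q t' Q) r m"
  shows "wp W (Seq p q) (t + t') Q r m"
  unfolding wp_def
proof (intro allI impI)
  fix r0 assume "same_vars r0 r"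
  with assms obtain t1 r1 r2 m1 where 1: "exec W p (r0, m) t1 (r1, m1)" "t1 \<le> t"
      "same_vars r1 r2" "wp W q t' Q r2 m1"
    unfolding wp_def[of W p] by blast
  then obtain t2 r3 r4 m2 where 2: "exec W q (r1, m1) t2 (r3, m2)" "t2 \<le> t'"
      "same_vars r3 r4" "Q r4 m2"
    unfolding wp_def by blast
  with exec.Seq[OF 1(1) 2(1)] 1
  show "\<exists>t'' r1 r2 m'. exec W (Seq p q) (r0, m) t'' (r1, m') \<and> t'' \<le> t + t' \<and>
      same_vars r1 r2 \<and> Q r2 m'"
    by (meson add_mono)
qed

datatype instr = Asg reg exp | Sto exp exp

fun code_instr :: "instr \<Rightarrow> prog" where
  "code_instr (Asg x e) = Seq (code e 20) (Op Or x 20 20)"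
| "code_instr (Sto a e) = Seq (code a 20) (Seq (code e 21) (Store 20 21))"

fun cost_instr :: "instr \<Rightarrow> nat" where
  "cost_instr (Asg x e) = cost e + 1"
| "cost_instr (Sto a e) = cost a + cost e + 1"

text \<open>The bound 300 is a generous limit on the leaves of any expression in the program,
  \<open>weight_exp\<close> included; it reappears as the exponent in all assumptions
  \<open>X ^ 300 \<le> W\<close>.\<close>

fun wf_instr :: "instr \<Rightarrow> bool" where
  "wf_instr (Asg x e) \<longleftrightarrow> x < 20 \<and> below 20 e \<and> leaves e \<le> 300"
| "wf_instr (Sto a e) \<longleftrightarrow> below 20 a \<and> leaves a \<le> 300 \<and> below 20 e \<and> leaves e \<le> 300"

fun block :: "instr list \<Rightarrow> prog" where
  "block [] = Skip"
| "block (i # is) = Seq (code_instr i) (block is)"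

fun cost_block :: "instr list \<Rightarrow> nat" where
  "cost_block [] = 1"
| "cost_block (i # is) = cost_instr i + cost_block is"

fun wp_block :: "int \<Rightarrow> instr list \<Rightarrow> ((reg \<Rightarrow> int) \<Rightarrow> (nat \<Rightarrow> int) \<Rightarrow> bool) \<Rightarrow>
    (reg \<Rightarrow> int) \<Rightarrow> (nat \<Rightarrow> int) \<Rightarrow> bool" where
  "wp_block X [] Q r m \<longleftrightarrow> Q r m"
| "wp_block X (Asg x e # is) Q r m \<longleftrightarrow>
     safe X e r m \<and> wp_block X is Q (r(x := eval e r m)) m"
| "wp_block X (Sto a e # is) Q r m \<longleftrightarrow>
     safe X a r m \<and> safe X e r m \<and> 0 \<le> eval a r m \<and>
     wp_block X is Q r (m(nat (eval a r m) := eval e r m))"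

lemma wp_Asg:
  assumes safe: "safe X e r m" and wf: "wf_instr (Asg x e)" and X: "2 \<le> X" "X ^ 300 \<le> W"
    and Q: "Q (r(x := eval e r m)) m"
  shows "wp W (code_instr (Asg x e)) (cost e + 1) Q r m"
proof (rule wpI)
  fix r0 assume r0: "same_vars r0 r"
  have le: "X ^ leaves e \<le> W"
    using wf X by (auto intro!: order_trans[OF power_increasing X(2)])
  obtain t r1 where 1: "exec W (code e 20) (r0, m) t (r1, m)" "t \<le> cost e"
      "r1 20 = eval e r m" "\<forall>x<20. r1 x = r0 x"
    using exec_code[OF safe X(1), of 20 20 W r0] wf r0 le by (auto simp: same_vars_def)
  have "\<bar>eval e r m\<bar> \<le> W"
    using safe_abs_eval[OF safe X(1)] le by linarith
  then have "exec W (Op Or x 20 20) (r1, m) 1 (r1(x := eval e r m), m)"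
    using exec.Op[of Or r1 20 20 W x m] 1 by simp
  note e = exec.Seq[OF 1(1) this]
  show "\<exists>t' r1 m'. exec W (code_instr (Asg x e)) (r0, m) t' (r1, m') \<and> t' \<le> cost e + 1 \<and>
      (\<exists>r2. same_vars r1 r2 \<and> Q r2 m')"
    unfolding code_instr.simps
    by (rule wp_execI[where ?r2.0 = "r(x := eval e r m)", OF e])
      (use 1 r0 Q in \<open>simp_all add: same_vars_def\<close>)
qed

lemma wp_Sto:
  assumes safe: "safe X a r m" "safe X e r m" and wf: "wf_instr (Sto a e)"
    and X: "2 \<le> X" "X ^ 300 \<le> W" and nonneg: "0 \<le> eval a r m"
    and Q: "Q r (m(nat (eval a r m) := eval e r m))"
  shows "wp W (code_instr (Sto a e)) (cost a + cost e + 1) Q r m"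
proof (rule wpI)
  fix r0 assume r0: "same_vars r0 r"
  have le: "X ^ leaves a \<le> W" "X ^ leaves e \<le> W"
    using wf X by (auto intro!: order_trans[OF power_increasing X(2)])
  obtain t r1 where 1: "exec W (code a 20) (r0, m) t (r1, m)" "t \<le> cost a"
      "r1 20 = eval a r m" "\<forall>x<20. r1 x = r0 x"
    using exec_code[OF safe(1) X(1), of 20 20 W r0] wf r0 le by (auto simp: same_vars_def)
  obtain t' r2 where 2: "exec W (code e 21) (r1, m) t' (r2, m)" "t' \<le> cost e"
      "r2 21 = eval e r m" "\<forall>x<21. r2 x = r1 x"
    using exec_code[OF safe(2) X(1), of 20 21 W r1] wf r0 le 1 by (auto simp: same_vars_def)
  have "exec W (Store 20 21) (r2, m) 1 (r2, m(nat (eval a r m) := eval e r m))"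
    using exec.Store[of r2 20 W 21 m] 1 2 nonneg by simp
  note e = exec.Seq[OF 1(1) exec.Seq[OF 2(1) this]]
  show "\<exists>t' r1 m'. exec W (code_instr (Sto a e)) (r0, m) t' (r1, m') \<and>
      t' \<le> cost a + cost e + 1 \<and> (\<exists>r2. same_vars r1 r2 \<and> Q r2 m')"
    unfolding code_instr.simps
    by (rule wp_execI[where ?r2.0 = r, OF e]) (use 1 2 r0 Q in \<open>simp_all add: same_vars_def\<close>)
qed

lemma wp_block:
  assumes "wp_block X is Q r m" "list_all wf_instr is" and X: "2 \<le> X" "X ^ 300 \<le> W"
  shows "wp W (block is) (cost_block is) Q r m"
  using assms(1,2)
proof (induction "is" arbitrary: r m)
  case Nil
  then show ?case
    by (intro wpI wp_execI[OF exec.Skip[folded block.simps(1)]]) simp_all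
next
  case (Cons i "is")
  show ?case
  proof (cases i)
    case (Asg x e)
    then show ?thesis
      using Cons by (auto simp del: One_nat_def code_instr.simps intro!: wp_Seq wp_Asg[OF _ _ X])
  next
    case (Sto a e)
    then show ?thesis
      using Cons by (auto simp del: One_nat_def code_instr.simps intro!: wp_Seq wp_Sto[OF _ _ _ X])
  qed
qed

text \<open>The outcome of the test sits in scratch register 20, which the body may overwrite; it is
  therefore recomputed at the end of every round.\<close>

definition For :: "reg \<Rightarrow> reg \<Rightarrow> prog \<Rightarrow> prog" where
  "For x bd body =
     (let test = code (Bin Less (Reg x) (Reg bd)) 20 in
      Seq (block [Asg x (Lit 0)]) (Seq test
        (While 20 (Seq body (Seq (block [Asg x (Bin Add (Reg x) (Lit 1))]) test)))))"

text \<open>Each round adds at most 5 steps for the increment, 3 for the test and 1 for the loop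
  itself, and the start and the final exit take 7 in total; 10 covers either. The body must preserve
  the counter and establish the invariant for the incremented one.\<close>

lemma wp_For:
  fixes cnt :: nat
  assumes x: "x < 20" "bd < 20" "x \<noteq> bd" and X: "2 \<le> X" "X ^ 300 \<le> W" "int cnt \<le> X"
    and bd: "r bd = int cnt"
    and init: "Inv 0 (r(x := 0)) m"
    and body: "\<And>i r m. i < cnt \<Longrightarrow> r x = int i \<Longrightarrow> r bd = int cnt \<Longrightarrow> Inv i r m \<Longrightarrow>
      wp W body tb (\<lambda>r' m'. r' x = int i \<and> r' bd = int cnt \<and>
        Inv (Suc i) (r'(x := int (Suc i))) m') r m"
    and final: "\<And>r m. r x = int cnt \<Longrightarrow> r bd = int cnt \<Longrightarrow> Inv cnt r m \<Longrightarrow> Q r m"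
  shows "wp W (For x bd body) (cnt * (tb + 10) + 10) Q r m"
proof -
  define test where "test = code (Bin Less (Reg x) (Reg bd)) 20"
  have X3: "X ^ 2 \<le> W"
    using X power_increasing[of 2 300 X] by linarith
  have test: "\<exists>t r'. exec W test (r0, m) t (r', m) \<and> t \<le> 3 \<and> same_vars r' r \<and>
      r' 20 = of_bool (i < cnt)"
    if "same_vars r0 r" "r x = int i" "r bd = int cnt" "i \<le> cnt" for i r r0 m
  proof -
    have "\<exists>t r'. exec W test (r0, m) t (r', m) \<and> t \<le> cost (Bin Less (Reg x) (Reg bd)) \<and>
        r' 20 = eval (Bin Less (Reg x) (Reg bd)) r m \<and> (\<forall>x<20. r' x = r0 x)"
      unfolding test_def
      using that x X X3 by (intro exec_code[where X = X and ?d0.0 = 20])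
        (auto simp: same_vars_def numeral_2_eq_2)
    moreover have "eval (Bin Less (Reg x) (Reg bd)) r m = of_bool (i < cnt)"
        "cost (Bin Less (Reg x) (Reg bd)) = 3"
      using that by simp_all
    moreover have "same_vars r' r" if "\<forall>x<20. r' x = r0 x" for r'
      using that \<open>same_vars r0 r\<close> by (simp add: same_vars_def)
    ultimately show ?thesis
      by metis
  qed
  define step where "step = block [Asg x (Bin Add (Reg x) (Lit 1))]"
  have loop: "\<exists>t r1 r2 m'. exec W (While 20 (Seq body (Seq step test))) (r0, m) t (r1, m') \<and>
      t \<le> k * (tb + 10) + 1 \<and> same_vars r1 r2 \<and> Q r2 m'"
    if "i + k = cnt" "Inv i r m" "r x = int i" "r bd = int cnt" "same_vars r0 r"
      "r0 20 = of_bool (i < cnt)" for i k r m r0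
    using that
  proof (induction k arbitrary: i r m r0)
    case 0
    then have "exec W (While 20 (Seq body (Seq step test))) (r0, m) 1 (r0, m)"
      by (intro exec.WhileFalse) simp
    moreover have "Q r m"
      using final[of r m] 0 by simp
    ultimately show ?case
      using 0 by (metis le_add2)
  next
    case (Suc k)
    obtain t1 r1 r2 m1 where 1: "exec W body (r0, m) t1 (r1, m1)" "t1 \<le> tb" "same_vars r1 r2"
        "r2 x = int i" "r2 bd = int cnt" "Inv (Suc i) (r2(x := int (Suc i))) m1"
      using body[of i r m] Suc.prems unfolding wp_def by auto
    have "wp W step 5 (\<lambda>r' m'. r' = r2(x := int (Suc i)) \<and> m' = m1) r2 m1"
    proof -
      have "wp W step (cost_block [Asg x (Bin Add (Reg x) (Lit 1))])
          (\<lambda>r' m'. r' = r2(x := int (Suc i)) \<and> m' = m1) r2 m1"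
        unfolding step_def using x X Suc.prems 1 by (intro wp_block[where X = X]) (simp_all add: add.commute)
      then show ?thesis
        by (rule wp_mono) auto
    qed
    with 1 obtain t2 r3 where 2: "exec W step (r1, m1) t2 (r3, m1)" "t2 \<le> 5"
        "same_vars r3 (r2(x := int (Suc i)))"
      unfolding wp_def by blast
    obtain t3 r4 where 3: "exec W test (r3, m1) t3 (r4, m1)" "t3 \<le> 3"
        "same_vars r4 (r2(x := int (Suc i)))" "r4 20 = of_bool (Suc i < cnt)"
      using test[OF 2(3), of "Suc i" m1] x 1 Suc.prems by auto
    obtain t4 r5 r6 m2 where 4: "exec W (While 20 (Seq body (Seq step test))) (r4, m1) t4 (r5, m2)"
        "t4 \<le> k * (tb + 10) + 1" "same_vars r5 r6" "Q r6 m2"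
      using Suc.IH[OF _ 1(6) _ _ 3(3,4)] 1(5) Suc.prems(1) x by auto
    have "exec W (While 20 (Seq body (Seq step test))) (r0, m) ((t1 + (t2 + t3)) + t4 + 1) (r5, m2)"
      using Suc.prems by (intro exec.WhileTrue[OF _ exec.Seq[OF 1(1) exec.Seq[OF 2(1) 3(1)]] 4(1)]) simp
    moreover have "(t1 + (t2 + t3)) + t4 + 1 \<le> Suc k * (tb + 10) + 1"
      using 1(2) 2(2) 3(2) 4(2) by simp
    ultimately show ?case
      using 4 by blast
  qed
  have first: "wp W (block [Asg x (Lit 0)]) 3 (\<lambda>r' m'. r' = r(x := 0) \<and> m' = m) r m"
  proof -
    have "wp W (block [Asg x (Lit 0)]) (cost_block [Asg x (Lit 0)])
        (\<lambda>r' m'. r' = r(x := 0) \<and> m' = m) r m"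
      using x X by (intro wp_block[where X = X]) simp_all
    then show ?thesis
      by (rule wp_mono) auto
  qed
  show ?thesis
    unfolding wp_def For_def test_def[symmetric] step_def[symmetric] Let_def
  proof (intro allI impI)
    fix r0 assume "same_vars r0 r"
    with first obtain t1 r1 where 1: "exec W (block [Asg x (Lit 0)]) (r0, m) t1 (r1, m)" "t1 \<le> 3"
        "same_vars r1 (r(x := 0))"
      unfolding wp_def by blast
    obtain t2 r2 where 2: "exec W test (r1, m) t2 (r2, m)" "t2 \<le> 3"
        "same_vars r2 (r(x := 0))" "r2 20 = of_bool (0 < cnt)"
      using test[OF 1(3), of 0 m] x bd by auto
    obtain t3 r3 r4 m' where 3: "exec W (While 20 (Seq body (Seq step test))) (r2, m) t3 (r3, m')"
        "t3 \<le> cnt * (tb + 10) + 1" "same_vars r3 r4" "Q r4 m'"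
      using loop[OF _ init _ _ 2(3,4)] x bd by auto
    have "t1 + (t2 + t3) \<le> cnt * (tb + 10) + 10"
      using 1(2) 2(2) 3(2) by linarith
    with exec.Seq[OF 1(1) exec.Seq[OF 2(1) 3(1)]] 3
    show "\<exists>t' r1 r2 m'. exec W (Seq (block [Asg x (Lit 0)]) (Seq test
        (While 20 (Seq body (Seq step test))))) (r0, m) t' (r1, m') \<and>
        t' \<le> cnt * (tb + 10) + 10 \<and> same_vars r1 r2 \<and> Q r2 m'"
      by blast
  qed
qed

subsection \<open>Running a program inside a slice of the memory\<close>

text \<open>Address \<open>a\<close> of \<open>p\<close> becomes \<open>off + a * str\<close>, where \<open>off\<close> and \<open>str\<close> are in registers 1 and 2.  Different
  offsets modulo \<open>str\<close> give disjoint slices, so a fresh slice need never be cleared.\<close>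

fun relocate :: "prog \<Rightarrow> prog" where
  "relocate Skip = Skip"
| "relocate (Const x k) = Const (24 + x) k"
| "relocate (Op f x y z) = Op f (24 + x) (24 + y) (24 + z)"
| "relocate (Load x y) = Seq (Op Mul 20 (24 + y) 2) (Seq (Op Add 20 20 1) (Load (24 + x) 20))"
| "relocate (Store x y) = Seq (Op Mul 20 (24 + x) 2) (Seq (Op Add 20 20 1) (Store 20 (24 + y)))"
| "relocate (Seq p q) = Seq (relocate p) (relocate q)"
| "relocate (Cond x p q) = Cond (24 + x) (relocate p) (relocate q)"
| "relocate (While x p) = While (24 + x) (relocate p)"

fun regs_below :: "nat \<Rightarrow> prog \<Rightarrow> bool" where
  "regs_below D Skip \<longleftrightarrow> True"
| "regs_below D (Const x k) \<longleftrightarrow> x < D"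
| "regs_below D (Op f x y z) \<longleftrightarrow> x < D \<and> y < D \<and> z < D"
| "regs_below D (Load x y) \<longleftrightarrow> x < D \<and> y < D"
| "regs_below D (Store x y) \<longleftrightarrow> x < D \<and> y < D"
| "regs_below D (Seq p q) \<longleftrightarrow> regs_below D p \<and> regs_below D q"
| "regs_below D (Cond x p q) \<longleftrightarrow> x < D \<and> regs_below D p \<and> regs_below D q"
| "regs_below D (While x p) \<longleftrightarrow> x < D \<and> regs_below D p"

lemma regs_below_mono: "regs_below D p \<Longrightarrow> D \<le> D' \<Longrightarrow> regs_below D' p"
  by (induction p) auto

text \<open>Only finitely many registers need clearing before a call, so the overhead of a call is a
  constant.\<close>

lemma ex_regs_below: "\<exists>D. regs_below D p"
proof (induction p)
  case (Const x k)
  show ?case by (rule exI[of _ "Suc x"]) simp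
next
  case (Op f x y z)
  show ?case by (rule exI[of _ "Suc (x + y + z)"]) simp
next
  case (Load x y)
  show ?case by (rule exI[of _ "Suc (x + y)"]) simp
next
  case (Store x y)
  show ?case by (rule exI[of _ "Suc (x + y)"]) simp
next
  case (Seq p q)
  then obtain D D' where "regs_below D p" "regs_below D' q" by blast
  then show ?case
    by (intro exI[of _ "D + D'"]) (auto intro: regs_below_mono)
next
  case (Cond x p q)
  then obtain D D' where "regs_below D p" "regs_below D' q" by blast
  then show ?case
    by (intro exI[of _ "Suc x + D + D'"]) (auto intro: regs_below_mono)
next
  case (While x p)
  then obtain D where "regs_below D p" by blast
  then show ?case
    by (intro exI[of _ "Suc x + D"]) (auto intro: regs_below_mono)
qed simp

text \<open>The shift by 24 keeps the registers of the embedded program apart from the variables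
  below 20 and from scratch register 20, in which relocated addresses are computed.\<close>

definition embeds :: "nat \<Rightarrow> nat \<Rightarrow> nat \<Rightarrow> state \<Rightarrow> state \<Rightarrow> bool" where
  "embeds D off str \<sigma> \<rho> \<longleftrightarrow>
     (\<forall>x<D. fst \<rho> (24 + x) = fst \<sigma> x) \<and> fst \<rho> 1 = int off \<and> fst \<rho> 2 = int str \<and>
     (\<forall>a. snd \<rho> (off + a * str) = snd \<sigma> a)"

definition same_outside :: "nat \<Rightarrow> nat \<Rightarrow> state \<Rightarrow> state \<Rightarrow> bool" where
  "same_outside off str \<rho> \<rho>' \<longleftrightarrow>
     (\<forall>x<20. fst \<rho>' x = fst \<rho> x) \<and>
     (\<forall>c. (\<forall>a. c \<noteq> off + a * str) \<longrightarrow> snd \<rho>' c = snd \<rho> c)"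

lemma same_outside_refl: "same_outside off str \<rho> \<rho>"
  by (simp add: same_outside_def)

lemma same_outside_trans:
  "same_outside off str \<rho> \<rho>' \<Longrightarrow> same_outside off str \<rho>' \<rho>'' \<Longrightarrow> same_outside off str \<rho> \<rho>''"
  by (simp add: same_outside_def)

lemma exec_address:
  assumes e: "embeds D off str \<sigma> (r, m)" and y: "y < D" "0 \<le> fst \<sigma> y" "fst \<sigma> y \<le> W"
    and W: "W * int str + int off \<le> W'"
  shows "exec W' (Op Mul 20 (24 + y) 2) (r, m) 1 (r(20 := fst \<sigma> y * int str), m)"
    and "exec W' (Op Add 20 20 1) (r(20 := fst \<sigma> y * int str), m) 1
      (r(20 := int (off + nat (fst \<sigma> y) * str)), m)"
proof -
  have r: "r (24 + y) = fst \<sigma> y" "r 1 = int off" "r 2 = int str"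
    using e y by (simp_all add: embeds_def)
  have "fst \<sigma> y * int str \<le> W * int str"
    using y by (intro mult_right_mono) simp_all
  then have le: "fst \<sigma> y * int str + int off \<le> W'"
    using W by linarith
  moreover have nonneg: "0 \<le> fst \<sigma> y * int str"
    using y by simp
  ultimately have "\<bar>fst \<sigma> y * int str\<bar> \<le> W'"
    by linarith
  then show "exec W' (Op Mul 20 (24 + y) 2) (r, m) 1 (r(20 := fst \<sigma> y * int str), m)"
    using exec.Op[of Mul r "24 + y" 2 W' 20 m] r by simp
  have "int (off + nat (fst \<sigma> y) * str) = fst \<sigma> y * int str + int off"
    using y by simp
  then show "exec W' (Op Add 20 20 1) (r(20 := fst \<sigma> y * int str), m) 1
      (r(20 := int (off + nat (fst \<sigma> y) * str)), m)"
    using exec.Op[of Add "r(20 := fst \<sigma> y * int str)" 20 1 W' 20 m] r le nonneg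
    by (simp del: of_nat_add of_nat_mult)
qed

lemma exec_relocateI:
  "exec W p \<rho> t' \<rho>' \<Longrightarrow> t' \<le> t \<Longrightarrow> embeds D off str \<sigma> \<rho>' \<Longrightarrow> same_outside off str \<rho> \<rho>' \<Longrightarrow>
    \<exists>t' \<rho>'. exec W p \<rho> t' \<rho>' \<and> t' \<le> t \<and> embeds D off str \<sigma> \<rho>' \<and> same_outside off str \<rho> \<rho>'"
  by blast

text \<open>A memory access turns into three instructions, everything else into one, hence the
  factor 3. The initial state must be within \<open>W\<close>: only then do all addresses, scaled
  and shifted, fit into \<open>W'\<close>.\<close>

lemma exec_relocate:
  assumes "exec W p \<sigma> t \<sigma>'" "regs_below D p"
    and "\<forall>x. \<bar>fst \<sigma> x\<bar> \<le> W" "\<forall>a. \<bar>snd \<sigma> a\<bar> \<le> W"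
    and "W \<le> W'" "W * int str + int off \<le> W'" "0 < str"
    and "embeds D off str \<sigma> \<rho>"
  shows "\<exists>t' \<rho>'. exec W' (relocate p) \<rho> t' \<rho>' \<and> t' \<le> 3 * t \<and> embeds D off str \<sigma>' \<rho>' \<and>
    same_outside off str \<rho> \<rho>'"
  using assms
proof (induction arbitrary: \<rho> rule: exec.induct)
  case (Skip r m)
  obtain r0 m0 where \<rho>: "\<rho> = (r0, m0)" by fastforce
  show ?case
    unfolding \<rho> relocate.simps
    by (rule exec_relocateI[OF exec.Skip]) (use Skip.prems \<rho> in \<open>auto intro: same_outside_refl\<close>)
next
  case (Const k x r m)
  obtain r0 m0 where \<rho>: "\<rho> = (r0, m0)" by fastforce
  have "exec W' (Const (24 + x) k) (r0, m0) 1 (r0(24 + x := k), m0)"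
    using Const by (intro exec.Const) linarith
  note e = this
  show ?case
    unfolding \<rho> relocate.simps
    by (rule exec_relocateI[OF e]) (use Const.prems \<rho> in \<open>auto simp: embeds_def same_outside_def\<close>)
next
  case (Op f r y z x m)
  obtain r0 m0 where \<rho>: "\<rho> = (r0, m0)" by fastforce
  have "r0 (24 + y) = r y" "r0 (24 + z) = r z"
    using Op.prems by (simp_all add: embeds_def \<rho>)
  then have "exec W' (Op f (24 + x) (24 + y) (24 + z)) (r0, m0) 1
      (r0(24 + x := apply_op f (r y) (r z)), m0)"
    using exec.Op[of f r0 "24 + y" "24 + z" W' "24 + x" m0] Op by simp
  note e = this
  show ?case
    unfolding \<rho> relocate.simps
    by (rule exec_relocateI[OF e]) (use Op.prems \<rho> in \<open>auto simp: embeds_def same_outside_def\<close>)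
next
  case (Load r y x m)
  obtain r0 m0 where \<rho>: "\<rho> = (r0, m0)" by fastforce
  have y: "y < D" "0 \<le> fst (r, m) y" "fst (r, m) y \<le> W"
    using Load abs_le_D1 by auto
  note addr = exec_address[OF Load.prems(7)[unfolded \<rho>] y Load.prems(5)]
  let ?r = "r0(20 := int (off + nat (r y) * str))"
  have "exec W' (Load (24 + x) 20) (?r, m0) 1 (?r(24 + x := m0 (nat (?r 20))), m0)"
    by (intro exec.Load) simp
  moreover have "m0 (nat (?r 20)) = m (nat (r y))"
    using Load.prems by (simp add: embeds_def \<rho> nat_int del: of_nat_add of_nat_mult)
  ultimately have "exec W' (Load (24 + x) 20) (?r, m0) 1 (?r(24 + x := m (nat (r y))), m0)"
    by simp
  note e = exec.Seq[OF addr(1)[unfolded fst_conv] exec.Seq[OF addr(2)[unfolded fst_conv] this]]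
  show ?case
    unfolding \<rho> relocate.simps
    by (rule exec_relocateI[OF e]) (use Load.prems \<rho> in \<open>auto simp: embeds_def same_outside_def\<close>)
next
  case (Store r x y m)
  obtain r0 m0 where \<rho>: "\<rho> = (r0, m0)" by fastforce
  have x: "x < D" "0 \<le> fst (r, m) x" "fst (r, m) x \<le> W"
    using Store abs_le_D1 by auto
  note addr = exec_address[OF Store.prems(7)[unfolded \<rho>] x Store.prems(5)]
  let ?a = "off + nat (r x) * str"
  let ?r = "r0(20 := int ?a)"
  have "exec W' (Store 20 (24 + y)) (?r, m0) 1 (?r, m0(nat (?r 20) := ?r (24 + y)))"
    by (intro exec.Store) simp
  moreover have "?r (24 + y) = r y"
    using Store.prems by (simp add: embeds_def \<rho>)
  moreover have "nat (?r 20) = ?a"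
    by (simp add: nat_int del: of_nat_add of_nat_mult)
  ultimately have "exec W' (Store 20 (24 + y)) (?r, m0) 1 (?r, m0(?a := r y))"
    by simp
  note e = exec.Seq[OF addr(1)[unfolded fst_conv] exec.Seq[OF addr(2)[unfolded fst_conv] this]]
  show ?case
    unfolding \<rho> relocate.simps
    by (rule exec_relocateI[OF e]) (use Store.prems \<rho> in \<open>auto simp: embeds_def same_outside_def\<close>)
next
  case (Seq p \<sigma> t \<sigma>' q t' \<sigma>'')
  obtain t1 \<rho>1 where 1: "exec W' (relocate p) \<rho> t1 \<rho>1" "t1 \<le> 3 * t" "embeds D off str \<sigma>' \<rho>1"
      "same_outside off str \<rho> \<rho>1"
    using Seq.IH(1)[of \<rho>] Seq.prems by auto
  obtain t2 \<rho>2 where 2: "exec W' (relocate q) \<rho>1 t2 \<rho>2" "t2 \<le> 3 * t'" "embeds D off str \<sigma>'' \<rho>2"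
      "same_outside off str \<rho>1 \<rho>2"
    using Seq.IH(2)[of \<rho>1] Seq.prems exec_bounded[OF Seq.hyps(1)] 1 by auto
  show ?case
    unfolding relocate.simps
    by (rule exec_relocateI[OF exec.Seq[OF 1(1) 2(1)]]) (use 1 2 in \<open>auto intro: same_outside_trans\<close>)
next
  case (CondTrue r x p m t \<sigma>' q)
  obtain r0 m0 where \<rho>: "\<rho> = (r0, m0)" by fastforce
  obtain t1 \<rho>1 where 1: "exec W' (relocate p) (r0, m0) t1 \<rho>1" "t1 \<le> 3 * t"
      "embeds D off str \<sigma>' \<rho>1" "same_outside off str \<rho> \<rho>1"
    using CondTrue.IH[of \<rho>] CondTrue.prems \<rho> by auto
  have "r0 (24 + x) \<noteq> 0"
    using CondTrue by (simp add: embeds_def \<rho>)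
  note e = exec.CondTrue[OF this 1(1)]
  show ?case
    unfolding \<rho> relocate.simps by (rule exec_relocateI[OF e]) (use 1 \<rho> in auto)
next
  case (CondFalse r x q m t \<sigma>' p)
  obtain r0 m0 where \<rho>: "\<rho> = (r0, m0)" by fastforce
  obtain t1 \<rho>1 where 1: "exec W' (relocate q) (r0, m0) t1 \<rho>1" "t1 \<le> 3 * t"
      "embeds D off str \<sigma>' \<rho>1" "same_outside off str \<rho> \<rho>1"
    using CondFalse.IH[of \<rho>] CondFalse.prems \<rho> by auto
  have "r0 (24 + x) = 0"
    using CondFalse by (simp add: embeds_def \<rho>)
  note e = exec.CondFalse[OF this 1(1)]
  show ?case
    unfolding \<rho> relocate.simps by (rule exec_relocateI[OF e]) (use 1 \<rho> in auto)
next
  case (WhileTrue r x p m t \<sigma>' t' \<sigma>'')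
  obtain r0 m0 where \<rho>: "\<rho> = (r0, m0)" by fastforce
  obtain t1 \<rho>1 where 1: "exec W' (relocate p) (r0, m0) t1 \<rho>1" "t1 \<le> 3 * t"
      "embeds D off str \<sigma>' \<rho>1" "same_outside off str \<rho> \<rho>1"
    using WhileTrue.IH(1)[of \<rho>] WhileTrue.prems \<rho> by auto
  obtain t2 \<rho>2 where 2: "exec W' (While (24 + x) (relocate p)) \<rho>1 t2 \<rho>2" "t2 \<le> 3 * t'"
      "embeds D off str \<sigma>'' \<rho>2" "same_outside off str \<rho>1 \<rho>2"
    using WhileTrue.IH(2)[of \<rho>1] WhileTrue.prems exec_bounded[OF WhileTrue.hyps(2)] 1 by auto
  have "r0 (24 + x) \<noteq> 0"
    using WhileTrue by (simp add: embeds_def \<rho>)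
  note e = exec.WhileTrue[OF this 1(1) 2(1)]
  show ?case
    unfolding \<rho> relocate.simps
    by (rule exec_relocateI[OF e]) (use 1 2 \<rho> in \<open>auto intro: same_outside_trans\<close>)
next
  case (WhileFalse r x p m)
  obtain r0 m0 where \<rho>: "\<rho> = (r0, m0)" by fastforce
  have "r0 (24 + x) = 0"
    using WhileFalse by (simp add: embeds_def \<rho>)
  note e = exec.WhileFalse[of r0, OF this]
  show ?case
    unfolding \<rho> relocate.simps
    by (rule exec_relocateI[OF e]) (use WhileFalse.prems \<rho> in \<open>auto intro: same_outside_refl\<close>)
qed

text \<open>A callee may rely on zero in every register that is not an argument, so the remains of
  the previous call have to be erased.\<close>

fun zero_regs :: "nat \<Rightarrow> prog" where
  "zero_regs 0 = Skip"
| "zero_regs (Suc D) = Seq (zero_regs D) (Const (24 + D) 0)"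

lemma exec_zero_regs:
  assumes "0 \<le> W"
  shows "exec W (zero_regs D) (r, m) (D + 1) ((\<lambda>x. if 24 \<le> x \<and> x < 24 + D then 0 else r x), m)"
proof (induction D)
  case 0
  have "(\<lambda>x. if 24 \<le> x \<and> x < 24 + 0 then 0 else r x) = r" by auto
  then show ?case using exec.Skip by simp
next
  case (Suc D)
  have "(\<lambda>x. if 24 \<le> x \<and> x < 24 + Suc D then 0 else r x) =
      (\<lambda>x. if 24 \<le> x \<and> x < 24 + D then 0 else r x)(24 + D := 0)"
    by auto
  then show ?case
    using exec.Seq[OF Suc exec.Const[of 0 W "24 + D"]] assms by simp
qed

fun pass_args :: "nat \<Rightarrow> reg list \<Rightarrow> prog" where
  "pass_args i [] = Skip"
| "pass_args i (x # xs) = Seq (Op Or (24 + i) x x) (pass_args (Suc i) xs)"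

lemma exec_pass_args:
  assumes "\<forall>x\<in>set xs. x < 20 \<and> \<bar>r x\<bar> \<le> W"
  shows "exec W (pass_args i xs) (r, m) (length xs + 1)
    ((\<lambda>x. if 24 + i \<le> x \<and> x < 24 + i + length xs then r (xs ! (x - (24 + i))) else r x), m)"
  using assms
proof (induction xs arbitrary: i r)
  case Nil
  have "(\<lambda>x. if 24 + i \<le> x \<and> x < 24 + i + length [] then r ([] ! (x - (24 + i))) else r x) = r"
    by auto
  then show ?case using exec.Skip by simp
next
  case (Cons y xs)
  let ?r = "r(24 + i := r y)"
  have "exec W (Op Or (24 + i) y y) (r, m) 1 (?r, m)"
    using exec.Op[of Or r y y W "24 + i" m] Cons.prems by simp
  moreover have "\<forall>x\<in>set xs. x < 20 \<and> \<bar>?r x\<bar> \<le> W"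
    using Cons.prems by auto
  note Cons.IH[OF this, of "Suc i"]
  moreover have "(\<lambda>x. if 24 + Suc i \<le> x \<and> x < 24 + Suc i + length xs
        then ?r (xs ! (x - (24 + Suc i))) else ?r x) =
      (\<lambda>x. if 24 + i \<le> x \<and> x < 24 + i + length (y # xs)
        then r ((y # xs) ! (x - (24 + i))) else r x)"
  proof
    fix x
    have xs: "xs ! (x - (24 + Suc i)) < 20" if "24 + Suc i \<le> x" "x < 24 + Suc i + length xs"
      using that Cons.prems by (auto simp: nth_mem)
    consider "x < 24 + i" | "x = 24 + i" | "24 + Suc i \<le> x" by linarith
    then show "(if 24 + Suc i \<le> x \<and> x < 24 + Suc i + length xs
        then ?r (xs ! (x - (24 + Suc i))) else ?r x) =
      (if 24 + i \<le> x \<and> x < 24 + i + length (y # xs)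
        then r ((y # xs) ! (x - (24 + i))) else r x)"
    proof cases
      case 3
      then obtain z where "x = 24 + Suc i + z"
        using le_Suc_ex by blast
      with xs show ?thesis by auto
    qed auto
  qed
  ultimately show ?case
    using exec.Seq by fastforce
qed

text \<open>Register 15 receives the contents of register 1 of the called program.\<close>

definition call :: "nat \<Rightarrow> prog \<Rightarrow> reg list \<Rightarrow> prog" where
  "call D p xs = Seq (zero_regs D) (Seq (pass_args 0 xs) (Seq (relocate p) (Op Or 15 25 25)))"

text \<open>The cost consists of D + 1 steps for clearing, at most D + 1 for the arguments, 3 * t
  for the relocated body and 1 for fetching the result from register 25 = 24 + 1.\<close>

lemma wp_call:
  assumes p: "exec W p (init_regs (map r xs), mem) t (r', mem')"
    and D: "regs_below D p" "2 \<le> D" "length xs \<le> D"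
    and xs: "\<forall>x\<in>set xs. x < 20 \<and> \<bar>r x\<bar> \<le> W"
    and bounds: "\<forall>a. \<bar>mem a\<bar> \<le> W" "0 \<le> W" "W \<le> W'" "W * int str + int off \<le> W'"
    and slice: "r 1 = int off" "r 2 = int str" "0 < str" "\<forall>a. m (off + a * str) = mem a"
    and Q: "\<And>m'. (\<forall>a. m' (off + a * str) = mem' a) \<Longrightarrow>
      (\<forall>c. (\<forall>a. c \<noteq> off + a * str) \<longrightarrow> m' c = m c) \<Longrightarrow> Q (r(15 := r' 1)) m'"
  shows "wp W' (call D p xs) (2 * D + 3 * t + 3) Q r m"
  unfolding wp_def
proof (intro allI impI)
  fix r0 assume r0: "same_vars r0 r"
  define r1 where "r1 = (\<lambda>x. if 24 \<le> x \<and> x < 24 + D then 0 else r0 x)"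
  have 1: "exec W' (zero_regs D) (r0, m) (D + 1) (r1, m)"
    unfolding r1_def using bounds by (intro exec_zero_regs) linarith
  have xs1: "\<forall>x\<in>set xs. x < 20 \<and> \<bar>r1 x\<bar> \<le> W'"
    using xs r0 bounds by (fastforce simp: r1_def same_vars_def)
  define r2 where "r2 = (\<lambda>x. if 24 + 0 \<le> x \<and> x < 24 + 0 + length xs
      then r1 (xs ! (x - (24 + 0))) else r1 x)"
  have 2: "exec W' (pass_args 0 xs) (r1, m) (length xs + 1) (r2, m)"
    unfolding r2_def by (rule exec_pass_args[OF xs1])
  have vars: "r2 x = r x" if "x < 20" for x
    using that r0 by (simp add: r2_def r1_def same_vars_def)
  have args: "r1 (xs ! x) = r (xs ! x)" if "x < length xs" for x
  proof -
    have "xs ! x < 20"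
      using xs nth_mem[OF that] by blast
    then show ?thesis
      using r0 by (simp add: r1_def same_vars_def)
  qed
  have emb: "embeds D off str (init_regs (map r xs), mem) (r2, m)"
    using slice vars D args by (auto simp: embeds_def init_regs_def r2_def r1_def)
  have init: "\<bar>init_regs (map r xs) x\<bar> \<le> W" for x
    using xs bounds by (auto simp: init_regs_def)
  obtain t3 \<rho> where 3: "exec W' (relocate p) (r2, m) t3 \<rho>" "t3 \<le> 3 * t"
      "embeds D off str (r', mem') \<rho>" "same_outside off str (r2, m) \<rho>"
    using exec_relocate[OF p D(1) _ _ bounds(3,4) slice(3) emb] init bounds by auto
  obtain r3 m3 where \<rho>: "\<rho> = (r3, m3)" by fastforce
  have r3: "r3 25 = r' 1"
    using 3(3) D(2) by (auto simp: embeds_def \<rho> dest: spec[of _ 1])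
  have "\<bar>r' 1\<bar> \<le> W"
    using exec_bounded[OF p] init bounds by simp
  then have 4: "exec W' (Op Or 15 25 25) (r3, m3) 1 (r3(15 := r' 1), m3)"
    using exec.Op[of Or r3 25 25 W' 15 m3] r3 bounds by simp
  have "same_vars (r3(15 := r' 1)) (r(15 := r' 1))"
    using 3(4) vars by (simp add: same_outside_def \<rho> same_vars_def)
  moreover have "Q (r(15 := r' 1)) m3"
    using 3 by (intro Q) (simp_all add: embeds_def same_outside_def \<rho>)
  moreover have "D + 1 + (length xs + 1 + (t3 + 1)) \<le> 2 * D + 3 * t + 3"
    using 3(2) D by linarith
  moreover have "exec W' (call D p xs) (r0, m) (D + 1 + (length xs + 1 + (t3 + 1)))
      (r3(15 := r' 1), m3)"
    unfolding call_def using 1 2 3(1) 4 unfolding \<rho> by (intro exec.Seq)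
  ultimately show "\<exists>t' r1 r2 m'. exec W' (call D p xs) (r0, m) t' (r1, m') \<and>
      t' \<le> 2 * D + 3 * t + 3 \<and> same_vars r1 r2 \<and> Q r2 m'"
    by blast
qed

section \<open>A quadratic lower bound for replacement paths\<close>

text \<open>S is a certificate for the run: memories agreeing with the original one on S lead to the
  same time and registers. The final conjunct says that a run never destroys agreement at an
  address, even outside S.\<close>

definition depends_on :: "int \<Rightarrow> prog \<Rightarrow> state \<Rightarrow> nat \<Rightarrow> state \<Rightarrow> nat set \<Rightarrow> bool" where
  "depends_on W p \<sigma> t \<sigma>' S \<longleftrightarrow> (\<forall>m. (\<forall>a\<in>S. m a = snd \<sigma> a) \<longrightarrow>
    (\<exists>m'. exec W p (fst \<sigma>, m) t (fst \<sigma>', m') \<and> (\<forall>a. m a = snd \<sigma> a \<longrightarrow> m' a = snd \<sigma>' a)))"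

lemma depends_onI:
  assumes "\<And>m. (\<And>a. a \<in> S \<Longrightarrow> m a = snd \<sigma> a) \<Longrightarrow>
    \<exists>m'. exec W p (fst \<sigma>, m) t (fst \<sigma>', m') \<and> (\<forall>a. m a = snd \<sigma> a \<longrightarrow> m' a = snd \<sigma>' a)"
  shows "depends_on W p \<sigma> t \<sigma>' S"
  using assms by (simp add: depends_on_def)

lemma depends_onE:
  assumes "depends_on W p \<sigma> t \<sigma>' S" "\<And>a. a \<in> S \<Longrightarrow> m a = snd \<sigma> a"
  obtains m' where "exec W p (fst \<sigma>, m) t (fst \<sigma>', m')"
    "\<And>a. m a = snd \<sigma> a \<Longrightarrow> m' a = snd \<sigma>' a"
  using assms unfolding depends_on_def by blast

text \<open>S' concerns the memory in between, yet it is enough to demand agreement on S' at the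
  start, since agreement survives the first part.\<close>

lemma depends_on_trans:
  assumes S: "depends_on W p \<sigma> t \<sigma>' S" and S': "depends_on W q \<sigma>' t' \<sigma>'' S'"
    and step: "\<And>m m' m''. exec W p (fst \<sigma>, m) t (fst \<sigma>', m') \<Longrightarrow>
      exec W q (fst \<sigma>', m') t' (fst \<sigma>'', m'') \<Longrightarrow> exec W s (fst \<sigma>, m) u (fst \<sigma>'', m'')"
  shows "depends_on W s \<sigma> u \<sigma>'' (S \<union> S')"
proof (rule depends_onI)
  fix m assume m: "\<And>a. a \<in> S \<union> S' \<Longrightarrow> m a = snd \<sigma> a"
  obtain m' where m': "exec W p (fst \<sigma>, m) t (fst \<sigma>', m')"
      "\<And>a. m a = snd \<sigma> a \<Longrightarrow> m' a = snd \<sigma>' a"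
    by (rule depends_onE[OF S m]) auto
  obtain m'' where m'': "exec W q (fst \<sigma>', m') t' (fst \<sigma>'', m'')"
      "\<And>a. m' a = snd \<sigma>' a \<Longrightarrow> m'' a = snd \<sigma>'' a"
    by (rule depends_onE[OF S' m'(2)[OF m]]) auto
  show "\<exists>m''. exec W s (fst \<sigma>, m) u (fst \<sigma>'', m'') \<and>
      (\<forall>a. m a = snd \<sigma> a \<longrightarrow> m'' a = snd \<sigma>'' a)"
    using step[OF m'(1) m''(1)] m'(2) m''(2) by blast
qed

lemma depends_on_Cond:
  assumes "depends_on W p (r, m) t \<sigma>' S"
    and step: "\<And>m' \<tau>. exec W p (r, m') t \<tau> \<Longrightarrow> exec W q (r, m') u \<tau>"
  shows "depends_on W q (r, m) u \<sigma>' S"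
  using assms(1) step unfolding depends_on_def fst_conv snd_conv by blast

text \<open>Each step reads at most one cell, and only loads contribute to the certificate.\<close>

lemma exec_depends_on:
  assumes "exec W p \<sigma> t \<sigma>'"
  shows "\<exists>S. finite S \<and> card S \<le> t \<and> depends_on W p \<sigma> t \<sigma>' S"
  using assms
proof (induction rule: exec.induct)
  case (Skip r m)
  have "depends_on W Skip (r, m) 1 (r, m) {}"
    by (rule depends_onI) (auto simp del: One_nat_def intro: exec.Skip)
  then show ?case
    by (intro exI[of _ "{}"]) simp
next
  case (Const k x r m)
  then have "depends_on W (Const x k) (r, m) 1 (r(x := k), m) {}"
    by (intro depends_onI) (auto simp del: One_nat_def intro: exec.Const)
  then show ?case
    by (intro exI[of _ "{}"]) simp
next
  case (Op f r y z x m)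
  then have "depends_on W (Op f x y z) (r, m) 1 (r(x := apply_op f (r y) (r z)), m) {}"
    by (intro depends_onI) (auto simp del: One_nat_def intro: exec.Op)
  then show ?case
    by (intro exI[of _ "{}"]) simp
next
  case (Load r y x m)
  have "depends_on W (Load x y) (r, m) 1 (r(x := m (nat (r y))), m) {nat (r y)}"
  proof (rule depends_onI)
    fix m' assume "\<And>a. a \<in> {nat (r y)} \<Longrightarrow> m' a = snd (r, m) a"
    then have "m' (nat (r y)) = m (nat (r y))"
      by simp
    with exec.Load[of r y W x m'] Load
    have "exec W (Load x y) (r, m') 1 (r(x := m (nat (r y))), m')"
      by simp
    then show "\<exists>m''. exec W (Load x y) (fst (r, m), m') 1 (fst (r(x := m (nat (r y))), m), m'') \<and>
        (\<forall>a. m' a = snd (r, m) a \<longrightarrow> m'' a = snd (r(x := m (nat (r y))), m) a)"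
      unfolding fst_conv snd_conv by blast
  qed
  then show ?case
    by (intro exI[of _ "{nat (r y)}"]) simp
next
  case (Store r x y m)
  have "depends_on W (Store x y) (r, m) 1 (r, m(nat (r x) := r y)) {}"
  proof (rule depends_onI)
    fix m' :: "nat \<Rightarrow> int"
    have "\<forall>a. m' a = m a \<longrightarrow> (m'(nat (r x) := r y)) a = (m(nat (r x) := r y)) a"
      by simp
    with exec.Store[of r x W y m'] Store
    show "\<exists>m''. exec W (Store x y) (fst (r, m), m') 1 (fst (r, m(nat (r x) := r y)), m'') \<and>
        (\<forall>a. m' a = snd (r, m) a \<longrightarrow> m'' a = snd (r, m(nat (r x) := r y)) a)"
      unfolding fst_conv snd_conv by blast
  qed
  then show ?case
    by (intro exI[of _ "{}"]) simp
next
  case (Seq p \<sigma> t \<sigma>' q t' \<sigma>'')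
  from Seq.IH(1) obtain S where S: "finite S" "card S \<le> t" "depends_on W p \<sigma> t \<sigma>' S" by blast
  from Seq.IH(2) obtain S' where S': "finite S'" "card S' \<le> t'" "depends_on W q \<sigma>' t' \<sigma>'' S'"
    by blast
  have "depends_on W (Seq p q) \<sigma> (t + t') \<sigma>'' (S \<union> S')"
    by (rule depends_on_trans[OF S(3) S'(3)]) (rule exec.Seq)
  moreover have "card (S \<union> S') \<le> t + t'"
    using S(2) S'(2) card_Un_le[of S S'] by linarith
  ultimately show ?case
    using S(1) S'(1) by (intro exI[of _ "S \<union> S'"]) simp
next
  case (CondTrue r x p m t \<sigma>' q)
  then obtain S where S: "finite S" "card S \<le> t" "depends_on W p (r, m) t \<sigma>' S" by blast
  have "depends_on W (Cond x p q) (r, m) (t + 1) \<sigma>' S"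
    by (rule depends_on_Cond[OF S(3)]) (rule exec.CondTrue[of r, OF CondTrue.hyps(1)])
  with S show ?case
    by (intro exI[of _ S]) simp
next
  case (CondFalse r x q m t \<sigma>' p)
  then obtain S where S: "finite S" "card S \<le> t" "depends_on W q (r, m) t \<sigma>' S" by blast
  have "depends_on W (Cond x p q) (r, m) (t + 1) \<sigma>' S"
    by (rule depends_on_Cond[OF S(3)]) (rule exec.CondFalse[of r, OF CondFalse.hyps(1)])
  with S show ?case
    by (intro exI[of _ S]) simp
next
  case (WhileTrue r x p m t \<sigma>' t' \<sigma>'')
  from WhileTrue.IH(1) obtain S where S: "finite S" "card S \<le> t" "depends_on W p (r, m) t \<sigma>' S"
    by blast
  from WhileTrue.IH(2) obtain S' where S': "finite S'" "card S' \<le> t'"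
      "depends_on W (While x p) \<sigma>' t' \<sigma>'' S'"
    by blast
  have "depends_on W (While x p) (r, m) (t + t' + 1) \<sigma>'' (S \<union> S')"
    by (rule depends_on_trans[OF S(3) S'(3)])
      (use exec.WhileTrue[of r, OF WhileTrue.hyps(1)] in \<open>simp only: fst_conv\<close>)
  moreover have "card (S \<union> S') \<le> t + t' + 1"
    using S(2) S'(2) card_Un_le[of S S'] by linarith
  ultimately show ?case
    using S(1) S'(1) by (intro exI[of _ "S \<union> S'"]) simp
next
  case (WhileFalse r x p m)
  then have "depends_on W (While x p) (r, m) 1 (r, m) {}"
    by (intro depends_onI) (auto simp del: One_nat_def intro: exec.WhileFalse)
  then show ?case
    by (intro exI[of _ "{}"]) simp
qed

text \<open>Deleting \<open>(0, n - 1)\<close> disconnects \<open>n - 1\<close> from the source \<open>0\<close> in the base graph, but adding any of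
  the \<open>h * h\<close> arcs from \<open>{1..h}\<close> to \<open>{h+1..2*h}\<close> reconnects it.  So all these cells have to be read.\<close>

lemma ssrp_time_lower_bound:
  assumes "ssrp_algorithm p q T"
  shows "\<exists>k. \<forall>n\<ge>2. real (((n - 2) div 2) * ((n - 2) div 2)) \<le> T n + real k"
proof -
  from assms obtain c k where alg: "\<And>n G w s. ssrp_instance n G w s \<Longrightarrow>
       (\<exists>t r m. exec ((int n + 2) ^ c) p
             (init_regs [int n, int s], graph_memory n G w) t (r, m) \<and>
          real t \<le> T n \<and>
          (\<forall>(x, y) \<in> parcs G. \<forall>v \<in> pverts G. \<exists>t' r'.
             exec ((int n + 2) ^ c) q (init_regs [int x, int y, int v], m) t' (r', m) \<and>
             t' \<le> k \<and> dist_regs r' (replacement_dist G w s v (x, y))))"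
    unfolding ssrp_algorithm_def by blast
  have "real (((n - 2) div 2) * ((n - 2) div 2)) \<le> T n + real k" if n: "2 \<le> n" for n
  proof (rule ccontr)
    define h where "h = (n - 2) div 2"
    have h: "2 * h + 2 \<le> n"
      using n by (simp add: h_def)
    assume "\<not> ?thesis"
    then have small: "T n + real k < real (h * h)"
      by (simp add: h_def)
    define f where "f L u v = (if u = 0 \<and> 1 \<le> v \<and> v \<le> h then 0
      else if h < u \<and> u \<le> 2 * h \<and> v = n - 1 then 0
      else if u = 0 \<and> v = n - 1 then 0 else if (u, v) \<in> L then 0 else (2 :: int))"
      for L :: "(nat \<times> nat) set" and u v :: nat
    let ?G = "\<lambda>L. weight_graph n (f L)"
    let ?w = "\<lambda>L. case_prod (f L)"
    let ?e = "(0, n - 1)"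
    let ?cells = "{1..h} \<times> {h + 1..2 * h}"
    have inst: "ssrp_instance n (?G L) (?w L) 0" if "L \<subseteq> ?cells" for L
      using that n h by (intro ssrp_instance_weight_graph) (auto simp: f_def split: if_splits)
    have run: "\<exists>t r m t' r'. exec ((int n + 2) ^ c) p
          (init_regs [int n, 0], graph_memory n (?G L) (?w L)) t (r, m) \<and> real t \<le> T n \<and>
        exec ((int n + 2) ^ c) q (init_regs [0, int (n - 1), int (n - 1)], m) t' (r', m) \<and>
        t' \<le> k \<and> dist_regs r' (replacement_dist (?G L) (?w L) 0 (n - 1) ?e)"
      if sub: "L \<subseteq> ?cells" for L
    proof -
      have "?e \<in> parcs (?G L)" "n - 1 \<in> pverts (?G L)"
        using n by (auto simp: f_def)
      note e = this
      obtain t r m where 1: "exec ((int n + 2) ^ c) p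
          (init_regs [int n, int 0], graph_memory n (?G L) (?w L)) t (r, m)" "real t \<le> T n"
        and 2: "\<forall>(x, y) \<in> parcs (?G L). \<forall>v \<in> pverts (?G L). \<exists>t' r'.
          exec ((int n + 2) ^ c) q (init_regs [int x, int y, int v], m) t' (r', m) \<and>
          t' \<le> k \<and> dist_regs r' (replacement_dist (?G L) (?w L) 0 v (x, y))"
        using alg[OF inst[OF sub]] by blast
      from 2[THEN bspec, OF e(1), unfolded prod.case, THEN bspec, OF e(2)] 1 show ?thesis
        unfolding of_nat_0 by blast
    qed
    from run[of "{}"] obtain t r m t' r' where
        p: "exec ((int n + 2) ^ c) p
          (init_regs [int n, 0], graph_memory n (?G {}) (?w {})) t (r, m)" "real t \<le> T n"
      and q: "exec ((int n + 2) ^ c) q (init_regs [0, int (n - 1), int (n - 1)], m) t' (r', m)"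
        "t' \<le> k" "dist_regs r' (replacement_dist (?G {}) (?w {}) 0 (n - 1) ?e)"
      by auto
    obtain S where S: "finite S" "card S \<le> t" "depends_on ((int n + 2) ^ c) p
        (init_regs [int n, 0], graph_memory n (?G {}) (?w {})) t (r, m) S"
      using exec_depends_on[OF p(1)] by blast
    obtain S' where S': "finite S'" "card S' \<le> t'" "depends_on ((int n + 2) ^ c) q
        (init_regs [0, int (n - 1), int (n - 1)], m) t' (r', m) S'"
      using exec_depends_on[OF q(1)] by blast
    have inj: "inj_on (\<lambda>(l, r). l * n + r) ?cells"
    proof (intro inj_onI, clarify)
      fix l r l' r' assume *: "l * n + r = l' * n + r'" "r \<in> {h + 1..2 * h}" "r' \<in> {h + 1..2 * h}"
      then have r: "r < n" "r' < n"
        using h by auto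
      have "(l * n + r) mod n = r" "(l' * n + r') mod n = r'"
        using r by simp_all
      with * have "r = r'"
        by simp
      with * r show "l = l' \<and> r = r'"
        by simp
    qed
    have "real (t + k) < real (h * h)"
      using small p(2) by simp
    \<comment> \<open>The query may postpone the reading of input cells, so its at most k steps are
      added to the budget.\<close>
    then have "t + t' < h * h"
      using q(2) by linarith
    then have "card (S \<union> S') < card ((\<lambda>(l, r). l * n + r) ` ?cells)"
      using card_image[OF inj] card_Un_le[of S S'] S(2) S'(2) by simp
    then have "\<not> (\<lambda>(l, r). l * n + r) ` ?cells \<subseteq> S \<union> S'"
      using card_mono[OF finite_UnI[OF S(1) S'(1)]] linorder_not_less by blast
    then obtain z where z: "z \<in> ?cells" "(\<lambda>(l, r). l * n + r) z \<notin> S \<union> S'"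
      by blast
    obtain l r0 where lr_z: "z = (l, r0)"
      by (cases z)
    have lr: "(l, r0) \<in> ?cells" "l * n + r0 \<notin> S \<union> S'"
      using z unfolding lr_z by simp_all
    let ?L = "{(l, r0)}"
    have L: "?L \<subseteq> ?cells" "r0 < n"
      using lr h by auto
    have agree: "graph_memory n (?G ?L) (?w ?L) a = graph_memory n (?G {}) (?w {}) a"
      if "a \<noteq> l * n + r0" for a
    proof -
      have "(a div n, a mod n) \<noteq> (l, r0)"
        using that div_mult_mod_eq[of a n] by auto
      then have "f ?L (a div n) (a mod n) = f {} (a div n) (a mod n)"
        unfolding f_def by (simp only: singleton_iff empty_iff if_False)
      then show ?thesis
        unfolding graph_memory_weight_graph by simp
    qed
    obtain m2 where m2: "exec ((int n + 2) ^ c) p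
          (init_regs [int n, 0], graph_memory n (?G ?L) (?w ?L)) t (r, m2)"
        "\<And>a. a \<noteq> l * n + r0 \<Longrightarrow> m2 a = m a"
    proof (rule depends_onE[OF S(3), unfolded fst_conv snd_conv])
      show "graph_memory n (?G ?L) (?w ?L) a = graph_memory n (?G {}) (?w {}) a" if "a \<in> S" for a
        using that lr(2) by (intro agree) blast
    qed (use agree in blast)
    obtain m3 where m3: "exec ((int n + 2) ^ c) q
          (init_regs [0, int (n - 1), int (n - 1)], m2) t' (r', m3)"
    proof (rule depends_onE[OF S'(3), unfolded fst_conv snd_conv])
      show "m2 a = m a" if "a \<in> S'" for a
        using that lr(2) by (intro m2(2)) blast
    qed
    from run[OF L(1)] obtain t1 r1 m1 t1' r1' where
        p1: "exec ((int n + 2) ^ c) p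
          (init_regs [int n, 0], graph_memory n (?G ?L) (?w ?L)) t1 (r1, m1)"
      and q1: "exec ((int n + 2) ^ c) q (init_regs [0, int (n - 1), int (n - 1)], m1) t1' (r1', m1)"
        "dist_regs r1' (replacement_dist (?G ?L) (?w ?L) 0 (n - 1) ?e)"
      by auto
    \<comment> \<open>The run promised by the algorithm for the modified graph must be the copied
      run, since execution is deterministic; the query then also returns the same registers.\<close>
    have "m1 = m2"
      using exec_deterministic[OF p1 m2(1)] by simp
    with q1(1) m3 have "r1' = r'"
      using exec_deterministic by blast
    have digraph: "pair_digraph (?G K)" "0 \<in> pverts (?G K)" if "K \<subseteq> ?cells" for K
      using inst[OF that] by (auto simp: ssrp_instance_def)
    \<comment> \<open>With no middle arcs and without the deleted arc, walks from 0 end in the first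
      layer.\<close>
    have "u \<le> h" if "walk_cost (?G {}) (?w {}) 0 ?e u d" for u d
      using that by induction (auto simp: f_def split: if_splits)
    then have "{d. walk_cost (?G {}) (?w {}) 0 ?e (n - 1) d} = {}"
      using h by fastforce
    then have "replacement_dist (?G {}) (?w {}) 0 (n - 1) ?e = \<infinity>"
      unfolding replacement_dist_eq_INF[OF digraph[OF empty_subsetI]]
      by (simp only: image_empty Inf_empty top_ereal_def)
    with q(3) have "r' 0 = 0"
      by (simp add: dist_regs_def)
    have fL: "f ?L 0 l = 0" "f ?L l r0 = 0" "f ?L r0 (n - 1) = 0"
      using lr(1) by (auto simp: f_def)
    have bounds: "l < n" "l \<noteq> n - 1" "0 < l" "0 < r0" "r0 < n" "n - 1 < n"
      using lr(1) h n by auto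
    have "walk_cost (?G ?L) (?w ?L) 0 ?e l (0 + ?w ?L (0, l))"
      by (rule walk_cost.arc[OF walk_cost.source]) (use bounds fL in auto)
    then have "walk_cost (?G ?L) (?w ?L) 0 ?e r0 (0 + ?w ?L (0, l) + ?w ?L (l, r0))"
      by (rule walk_cost.arc) (use bounds fL in auto)
    then have "walk_cost (?G ?L) (?w ?L) 0 ?e (n - 1)
        (0 + ?w ?L (0, l) + ?w ?L (l, r0) + ?w ?L (r0, n - 1))"
      by (rule walk_cost.arc) (use bounds fL in auto)
    then have "walk_cost (?G ?L) (?w ?L) 0 ?e (n - 1) 0"
      using fL by simp
    then have "replacement_dist (?G ?L) (?w ?L) 0 (n - 1) ?e \<le> ereal (real_of_int 0)"
      unfolding replacement_dist_eq_INF[OF digraph[OF L(1)]] by (intro INF_lower) simp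
    then have "replacement_dist (?G ?L) (?w ?L) 0 (n - 1) ?e \<noteq> \<infinity>"
      by auto
    with q1(2) \<open>r1' = r'\<close> have "r' 0 = 1"
      by (simp add: dist_regs_def)
    with \<open>r' 0 = 0\<close> show False
      by simp
  qed
  then show ?thesis
    by blast
qed

section \<open>The reduction\<close>

definition evals :: "int \<Rightarrow> exp \<Rightarrow> (reg \<Rightarrow> int) \<Rightarrow> (nat \<Rightarrow> int) \<Rightarrow> int \<Rightarrow> bool" where
  "evals X e r m v \<longleftrightarrow> safe X e r m \<and> eval e r m = v"

lemma evals_Reg: "r x = v \<Longrightarrow> \<bar>v\<bar> \<le> X \<Longrightarrow> evals X (Reg x) r m v"
  by (simp add: evals_def)

lemma evals_Lit: "k = v \<Longrightarrow> \<bar>k\<bar> \<le> X \<Longrightarrow> evals X (Lit k) r m v"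
  by (simp add: evals_def)

lemma evals_Deref:
  "evals X a r m (int x) \<Longrightarrow> m x = v \<Longrightarrow> \<bar>v\<bar> \<le> X \<Longrightarrow> evals X (Deref a) r m v"
  by (auto simp: evals_def)

text \<open>Only the branch taken must be safe, so each guard may be used to justify the memory
  reads and natural-number subtractions behind it.\<close>

lemma evals_Ite:
  "evals X c r m (of_bool P) \<Longrightarrow> (P \<Longrightarrow> evals X a r m x) \<Longrightarrow> (\<not> P \<Longrightarrow> evals X b r m y) \<Longrightarrow>
    evals X (Ite c a b) r m (if P then x else y)"
  by (cases P) (simp_all add: evals_def)

lemma evals_Add:
  "evals X a r m x \<Longrightarrow> evals X b r m y \<Longrightarrow> evals X (Bin Add a b) r m (x + y)"
  "evals X a r m (int u) \<Longrightarrow> evals X b r m (int v) \<Longrightarrow> evals X (Bin Add a b) r m (int (u + v))"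
  by (simp_all add: evals_def)

text \<open>The second variants here and in the neighbouring lemmas keep the value in the form
  \<open>int _\<close>, as addresses and indices require; for subtraction this needs v \<le>
  u.\<close>

lemma evals_Sub:
  "evals X a r m x \<Longrightarrow> evals X b r m y \<Longrightarrow> evals X (Bin Sub a b) r m (x - y)"
  "evals X a r m (int u) \<Longrightarrow> evals X b r m (int v) \<Longrightarrow> v \<le> u \<Longrightarrow>
    evals X (Bin Sub a b) r m (int (u - v))"
  by (simp_all add: evals_def of_nat_diff)

lemma evals_Mul:
  "evals X a r m x \<Longrightarrow> evals X b r m y \<Longrightarrow> evals X (Bin Mul a b) r m (x * y)"
  "evals X a r m (int u) \<Longrightarrow> evals X b r m (int v) \<Longrightarrow> evals X (Bin Mul a b) r m (int (u * v))"
  by (simp_all add: evals_def)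

lemma evals_Div_Mod:
  "evals X a r m (int u) \<Longrightarrow> evals X b r m (int v) \<Longrightarrow> evals X (Bin Div a b) r m (int (u div v))"
  "evals X a r m (int u) \<Longrightarrow> evals X b r m (int v) \<Longrightarrow> evals X (Bin Mod a b) r m (int (u mod v))"
  by (simp_all add: evals_def zdiv_int zmod_int)

lemma evals_Less:
  "evals X a r m (int u) \<Longrightarrow> evals X b r m (int v) \<Longrightarrow> evals X (Bin Less a b) r m (of_bool (u < v))"
  "evals X a r m x \<Longrightarrow> evals X b r m y \<Longrightarrow> evals X (Bin Less a b) r m (of_bool (x < y))"
  by (simp_all add: evals_def)

lemma evals_Equal:
  "evals X a r m (int u) \<Longrightarrow> evals X b r m (int v) \<Longrightarrow> evals X (Bin Equal a b) r m (of_bool (u = v))"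
  "evals X a r m x \<Longrightarrow> evals X b r m y \<Longrightarrow> evals X (Bin Equal a b) r m (of_bool (x = y))"
  by (simp_all add: evals_def)

lemmas evals_intros = evals_Ite evals_Add evals_Sub evals_Mul evals_Div_Mod evals_Less evals_Equal
  evals_Reg evals_Lit

lemma wp_block_Asg:
  "evals X e r m v \<Longrightarrow> wp_block X is Q (r(x := v)) m \<Longrightarrow> wp_block X (Asg x e # is) Q r m"
  by (auto simp: evals_def)

lemma wp_block_Sto:
  "evals X a r m (int c) \<Longrightarrow> evals X e r m v \<Longrightarrow> wp_block X is Q r (m(c := v)) \<Longrightarrow>
    wp_block X (Sto a e # is) Q r m"
  by (auto simp: evals_def)

section \<open>The program of the reduction\<close>

abbreviation add_exp (infixl \<open>+\<^sub>e\<close> 65) where "a +\<^sub>e b \<equiv> Bin Add a b"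
abbreviation sub_exp (infixl \<open>-\<^sub>e\<close> 65) where "a -\<^sub>e b \<equiv> Bin Sub a b"
abbreviation mul_exp (infixl \<open>*\<^sub>e\<close> 70) where "a *\<^sub>e b \<equiv> Bin Mul a b"
abbreviation div_exp (infixl \<open>div\<^sub>e\<close> 70) where "a div\<^sub>e b \<equiv> Bin Div a b"
abbreviation mod_exp (infixl \<open>mod\<^sub>e\<close> 70) where "a mod\<^sub>e b \<equiv> Bin Mod a b"
abbreviation less_exp (infix \<open><\<^sub>e\<close> 50) where "a <\<^sub>e b \<equiv> Bin Less a b"
abbreviation eq_exp (infix \<open>=\<^sub>e\<close> 50) where "a =\<^sub>e b \<equiv> Bin Equal a b"

text \<open>The stride is also the number of phases, and the slice of a phase starts
  at the offset.  Indices beyond the matrix are clamped to the last row or column.\<close>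

abbreviation "n_reg \<equiv> Reg 0"
abbreviation "off_reg \<equiv> Reg 1"
abbreviation "str_reg \<equiv> Reg 2"
abbreviation "V_reg \<equiv> Reg 3"
abbreviation "N_reg \<equiv> Reg 4"
abbreviation "b_reg \<equiv> Reg 5"
abbreviation "phase_reg \<equiv> Reg 8"
abbreviation "row_reg \<equiv> Reg 9"
abbreviation "col_reg \<equiv> Reg 10"
abbreviation "inner_reg \<equiv> Reg 11"
abbreviation "ctr_reg \<equiv> Reg 12"
abbreviation "nn_reg \<equiv> Reg 16"

abbreviation clamp :: "exp \<Rightarrow> exp" where
  "clamp e \<equiv> Ite (e <\<^sub>e n_reg) e (n_reg -\<^sub>e Lit 1)"

abbreviation A_at :: "exp \<Rightarrow> exp \<Rightarrow> exp" where
  "A_at i k \<equiv> Deref (i *\<^sub>e n_reg +\<^sub>e k)"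

abbreviation B_at :: "exp \<Rightarrow> exp \<Rightarrow> exp" where
  "B_at k j \<equiv> Deref (nn_reg +\<^sub>e (k *\<^sub>e n_reg +\<^sub>e j))"

text \<open>Follows \<open>gadget.weight\<close> clause by clause, so that correctness reduces to
  the structural evaluation rules. The subtracted matrix entries at \<open>inner_reg\<close> are the
  normalisation in \<alpha> and \<beta>.\<close>

definition weight_exp :: exp where
  "weight_exp =
    (let u = Reg 13; v = Reg 14; lo = Lit 2 *\<^sub>e N_reg;
      hi = Lit 2 *\<^sub>e N_reg +\<^sub>e Lit 4 *\<^sub>e (b_reg *\<^sub>e b_reg); len = Lit 4 *\<^sub>e b_reg;
      i = clamp (row_reg +\<^sub>e u div\<^sub>e Lit 2); j = clamp (col_reg +\<^sub>e (v -\<^sub>e hi));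
      k = (\<lambda>x. clamp (inner_reg +\<^sub>e (x -\<^sub>e lo) div\<^sub>e len)) in
    Ite (u <\<^sub>e lo)
      (Ite (v <\<^sub>e lo) (Ite (v =\<^sub>e u +\<^sub>e Lit 1) (Lit (-1)) (Lit 2))
        (Ite (v <\<^sub>e hi)
          (Ite (u mod\<^sub>e Lit 2 =\<^sub>e Lit 0)
            (Ite ((v -\<^sub>e lo) mod\<^sub>e len =\<^sub>e b_reg -\<^sub>e (A_at i (k v) -\<^sub>e A_at i inner_reg))
              (Lit 0) (Lit 2))
            (Lit 2))
          (Lit 2)))
      (Ite (u <\<^sub>e hi)
        (Ite (v <\<^sub>e hi)
          (Ite (v =\<^sub>e u +\<^sub>e Lit 1) (Ite ((v -\<^sub>e lo) mod\<^sub>e len =\<^sub>e Lit 0) (Lit 2) (Lit 1)) (Lit 2))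
          (Ite ((u -\<^sub>e lo) mod\<^sub>e len =\<^sub>e Lit 3 *\<^sub>e b_reg +\<^sub>e (B_at (k u) j -\<^sub>e B_at inner_reg j))
            (Lit 0) (Lit 2)))
        (Lit 2)))"

text \<open>The phase number is read as mixed-radix digits: row group, column group, and block of
  the inner dimension. The offset lies behind the three n * n tables for \<open>A\<close>,
  \<open>B\<close> and the bounds.\<close>

definition phase_setup :: "instr list" where
  "phase_setup =
    [Asg 1 (Lit 3 *\<^sub>e nn_reg +\<^sub>e phase_reg),
     Asg 9 ((phase_reg mod\<^sub>e Lit 8) *\<^sub>e N_reg),
     Asg 10 ((phase_reg div\<^sub>e Lit 8) mod\<^sub>e Lit 8 *\<^sub>e N_reg),
     Asg 11 (clamp ((phase_reg div\<^sub>e Lit 64) *\<^sub>e b_reg))]"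

definition write_weight :: "instr list" where
  "write_weight =
    [Asg 13 (ctr_reg div\<^sub>e V_reg), Asg 14 (ctr_reg mod\<^sub>e V_reg),
     Sto (off_reg +\<^sub>e ctr_reg *\<^sub>e str_reg) weight_exp]"

definition query_setup :: "instr list" where
  "query_setup =
    [Asg 13 (Lit 2 *\<^sub>e (ctr_reg div\<^sub>e N_reg)), Asg 14 (Reg 13 +\<^sub>e Lit 1),
     Asg 17 (Lit 2 *\<^sub>e N_reg +\<^sub>e Lit 4 *\<^sub>e (b_reg *\<^sub>e b_reg) +\<^sub>e ctr_reg mod\<^sub>e N_reg)]"

text \<open>Inverts the formula for the replacement distance: register 13 holds 2 * i and cancels
  the gain of the path, 2 * b is the offset of the chains, and the two matrix entries undo the
  normalisation of the block.\<close>

definition query_update :: "instr list" where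
  "query_update =
    [Asg 18 (clamp (row_reg +\<^sub>e ctr_reg div\<^sub>e N_reg)), Asg 19 (clamp (col_reg +\<^sub>e ctr_reg mod\<^sub>e N_reg)),
     Asg 15 (Reg 15 +\<^sub>e Reg 13 -\<^sub>e Lit 2 *\<^sub>e b_reg +\<^sub>e
       (A_at (Reg 18) inner_reg +\<^sub>e B_at inner_reg (Reg 19))),
     Asg 18 (Lit 2 *\<^sub>e nn_reg +\<^sub>e (Reg 18 *\<^sub>e n_reg +\<^sub>e Reg 19)),
     Sto (Reg 18) (Ite (Reg 15 <\<^sub>e Deref (Reg 18)) (Reg 15) (Deref (Reg 18)))]"

definition phase :: "nat \<Rightarrow> prog \<Rightarrow> prog \<Rightarrow> prog" where
  "phase D p q =
    Seq (block phase_setup) (Seq (For 12 6 (block write_weight)) (Seq (call D p [3])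
      (For 12 7 (Seq (block query_setup) (Seq (call D q [13, 14, 17]) (block query_update))))))"

text \<open>At least 16 vertices are needed for a block width b \<ge> 1, since 16 * b * b \<le> V.
  Smaller matrices are handled by clamping indices in a graph of 16 vertices.\<close>

definition size_setup :: "instr list" where
  "size_setup = [Asg 3 (Ite (n_reg <\<^sub>e Lit 16) (Lit 16) n_reg), Asg 5 (Lit 0)]"

text \<open>One step of a linear search for the largest b with 16 * b * b \<le> V; avoiding a square
  root costs only O(V) time.\<close>

definition width_step :: "instr list" where
  "width_step = [Asg 5 (Ite (V_reg <\<^sub>e Lit 16 *\<^sub>e (ctr_reg *\<^sub>e ctr_reg)) b_reg ctr_reg)]"

definition const_setup :: "instr list" where
  "const_setup =
    [Asg 4 (V_reg div\<^sub>e Lit 4), Asg 2 (Lit 64 *\<^sub>e (V_reg div\<^sub>e b_reg +\<^sub>e Lit 1)),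
     Asg 6 (V_reg *\<^sub>e V_reg), Asg 7 (N_reg *\<^sub>e N_reg), Asg 16 (n_reg *\<^sub>e n_reg)]"

text \<open>The candidate for inner index 0 is a genuine upper bound, which avoids a representation
  of infinity.\<close>

definition first_guess :: "instr list" where
  "first_guess = [Sto (Lit 2 *\<^sub>e nn_reg +\<^sub>e ctr_reg)
     (A_at (ctr_reg div\<^sub>e n_reg) (Lit 0) +\<^sub>e B_at (Lit 0) (ctr_reg mod\<^sub>e n_reg))]"

definition copy_back :: "instr list" where
  "copy_back = [Sto ctr_reg (Deref (Lit 2 *\<^sub>e nn_reg +\<^sub>e ctr_reg))]"

text \<open>Memory layout: \<open>A\<close>, then \<open>B\<close>, then the current upper bounds for the product, then the interleaved slices.
  The case \<open>n = 0\<close> is separate since clamping would then yield a negative address.\<close>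

definition min_plus_prog :: "nat \<Rightarrow> prog \<Rightarrow> prog \<Rightarrow> prog" where
  "min_plus_prog D p q =
    Cond 0
      (Seq (block size_setup) (Seq (For 12 3 (block width_step)) (Seq (block const_setup)
        (Seq (For 12 16 (block first_guess)) (Seq (For 8 2 (phase D p q))
          (For 12 16 (block copy_back)))))))
      Skip"

lemma wf_blocks:
  "list_all wf_instr phase_setup" "list_all wf_instr write_weight" "list_all wf_instr query_setup"
  "list_all wf_instr query_update" "list_all wf_instr size_setup" "list_all wf_instr width_step"
  "list_all wf_instr const_setup" "list_all wf_instr first_guess" "list_all wf_instr copy_back"
  by (simp_all add: phase_setup_def write_weight_def query_setup_def query_update_def size_setup_def
      width_step_def const_setup_def first_guess_def copy_back_def weight_exp_def Let_def)

section \<open>Correctness of the reduction\<close>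

locale reduction =
  fixes n V N b R M :: nat and A B :: "nat \<Rightarrow> nat \<Rightarrow> int" and X W Wp :: int
    and p q :: prog and D tp tq :: nat
  assumes n_pos: "0 < n" and V: "V = (if n < 16 then 16 else n)" and N: "N = V div 4"
    and b: "\<And>x. 16 * (x * x) \<le> V \<longleftrightarrow> x \<le> b" and R: "R = 64 * (V div b + 1)"
    and A_bound: "\<And>i j. i < n \<Longrightarrow> j < n \<Longrightarrow> \<bar>A i j\<bar> \<le> int M"
    and B_bound: "\<And>i j. i < n \<Longrightarrow> j < n \<Longrightarrow> \<bar>B i j\<bar> \<le> int M"
    and A_col: "\<And>i j. i < n \<Longrightarrow> Suc j < n \<Longrightarrow> \<bar>A i j - A i (Suc j)\<bar> \<le> 1"
    and A_row: "\<And>i j. Suc i < n \<Longrightarrow> j < n \<Longrightarrow> \<bar>A i j - A (Suc i) j\<bar> \<le> 1"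
    and B_row: "\<And>i j. Suc i < n \<Longrightarrow> j < n \<Longrightarrow> \<bar>B i j - B (Suc i) j\<bar> \<le> 1"
    and X: "8 * int (V * V) + 2 * int M \<le> X" and W: "X ^ 300 \<le> W"
    and Wp: "int V \<le> Wp" "Wp \<le> W" "Wp * int R + int (3 * (n * n) + R) \<le> W"
    and D: "regs_below D p" "regs_below D q" "3 \<le> D"
    and alg: "\<And>G w. ssrp_instance V G w 0 \<Longrightarrow>
       (\<exists>t r m. exec Wp p (init_regs [int V], graph_memory V G w) t (r, m) \<and> t \<le> tp \<and>
          (\<forall>(x, y) \<in> parcs G. \<forall>v \<in> pverts G. \<exists>t' r'.
             exec Wp q (init_regs [int x, int y, int v], m) t' (r', m) \<and>
             t' \<le> tq \<and> dist_regs r' (replacement_dist G w 0 v (x, y))))"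
begin

lemma V_ge: "16 \<le> V" "n \<le> V"
  using V by auto

lemma b_bounds: "0 < b" "b < V" "16 * (b * b) \<le> V"
proof -
  show "0 < b"
    using b[of 1] V_ge by simp
  show *: "16 * (b * b) \<le> V"
    using b by simp
  have "b \<le> b * b"
    by simp
  then show "b < V"
    using * \<open>0 < b\<close> by linarith
qed

lemma N_bounds: "0 < N" "4 * N \<le> V" "V \<le> 8 * N"
proof -
  have "V = 4 * N + V mod 4"
    unfolding N by (simp add: mult_div_mod_eq)
  moreover have "V mod 4 < 4"
    by simp
  ultimately show "0 < N" "4 * N \<le> V" "V \<le> 8 * N"
    using V_ge by linarith+
qed

text \<open>With V \<ge> 16 one gets 64 * (V + 1) \<le> 80 * V \<le> 5 * V * V. Together with the 3
  * n * n cells of the tables this explains the coefficient 8 in the bound on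
  \<open>X\<close>.\<close>

lemma R_bounds: "0 < R" "R \<le> 5 * (V * V)"
proof -
  show "0 < R"
    by (simp add: R)
  have "R \<le> 64 * (V + 1)"
    unfolding R by (intro mult_le_mono add_le_mono) auto
  also have "\<dots> \<le> 5 * (16 * V)"
    using V_ge by simp
  also have "\<dots> \<le> 5 * (V * V)"
    using V_ge by simp
  finally show "R \<le> 5 * (V * V)" .
qed

lemma le_X: "x \<le> 8 * (V * V) \<Longrightarrow> int x \<le> X"
  using X by linarith

lemma le_V_le_X: "x \<le> V \<Longrightarrow> int x \<le> X"
proof (rule le_X)
  assume "x \<le> V"
  also have "V \<le> V * V" by simp
  finally show "x \<le> 8 * (V * V)" by simp
qed

lemma X_ge: "64 \<le> X"
proof -
  have "16 * 16 \<le> V * V"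
    using V_ge by (intro mult_le_mono)
  then show ?thesis
    using X by linarith
qed

lemma M_le: "2 * int M \<le> X"
  using X by linarith

lemma nn_le: "n * n \<le> V * V"
  using V_ge by (intro mult_le_mono)

lemma NN_le: "N * N \<le> V * V"
  using N_bounds by (intro mult_le_mono) linarith+

definition cl :: "nat \<Rightarrow> nat" where
  "cl i = min i (n - 1)"

lemma cl_less [simp]: "cl i < n"
  using n_pos by (simp add: cl_def)

lemma cl_id [simp]: "i < n \<Longrightarrow> cl i = i"
  by (simp add: cl_def)

lemma cl_if: "cl i = (if i < n then i else n - 1)"
  by (auto simp: cl_def)

lemma cl_Suc: "cl (Suc i) = cl i \<or> cl (Suc i) = Suc (cl i) \<and> Suc (cl i) < n"
  using n_pos by (auto simp: cl_def min_def)

text \<open>Clamping maps neighbouring indices to equal or neighbouring ones, so padding by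
  repetition of the last row or column preserves bounded differences.\<close>

lemma lipschitz_cl:
  fixes f :: "nat \<Rightarrow> int"
  assumes "\<And>i. Suc i < n \<Longrightarrow> \<bar>f i - f (Suc i)\<bar> \<le> 1"
  shows "\<bar>f (cl (i + d)) - f (cl i)\<bar> \<le> int d"
proof (induction d)
  case (Suc d)
  have "\<bar>f (cl (i + d)) - f (cl (Suc (i + d)))\<bar> \<le> 1"
    using cl_Suc[of "i + d"] assms[of "cl (i + d)"] by auto
  with Suc show ?case
    by simp
qed simp

definition row_start :: "nat \<Rightarrow> nat" where "row_start \<rho> = (\<rho> mod 8) * N"
definition col_start :: "nat \<Rightarrow> nat" where "col_start \<rho> = (\<rho> div 8) mod 8 * N"
definition inner_start :: "nat \<Rightarrow> nat" where "inner_start \<rho> = cl ((\<rho> div 64) * b)"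

definition \<alpha> :: "nat \<Rightarrow> nat \<Rightarrow> nat \<Rightarrow> int" where
  "\<alpha> \<rho> i k = A (cl (row_start \<rho> + i)) (cl (inner_start \<rho> + k)) - A (cl (row_start \<rho> + i)) (inner_start \<rho>)"

definition \<beta> :: "nat \<Rightarrow> nat \<Rightarrow> nat \<Rightarrow> int" where
  "\<beta> \<rho> k j = B (cl (inner_start \<rho> + k)) (cl (col_start \<rho> + j)) - B (inner_start \<rho>) (cl (col_start \<rho> + j))"

lemma inner_start_less: "inner_start \<rho> < n"
  by (simp add: inner_start_def)

lemma gadget: "gadget N b V (\<alpha> \<rho>) (\<beta> \<rho>)"
proof
  show "0 < b"
    by (rule b_bounds)
  show "3 * N + 4 * (b * b) \<le> V"
    using N_bounds b_bounds by linarith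
  show "\<bar>\<alpha> \<rho> i k\<bar> < int b" if "k < b" for i k
    using lipschitz_cl[of "A (cl (row_start \<rho> + i))", OF A_col, OF cl_less, of "inner_start \<rho>" k] that inner_start_less[of \<rho>]
    by (simp add: \<alpha>_def)
  show "\<bar>\<beta> \<rho> k j\<bar> < int b" if "k < b" for k j
    using lipschitz_cl[of "\<lambda>i. B i (cl (col_start \<rho> + j))", OF B_row[OF _ cl_less], of "inner_start \<rho>" k] that inner_start_less[of \<rho>]
    by (simp add: \<beta>_def)
  \<comment> \<open>\<alpha> is a difference of two entries of the same row of \<open>A\<close>;
    moving by i - i' rows changes each of them by at most i - i', which gives the factor 2.\<close>
  show "\<alpha> \<rho> i k - \<alpha> \<rho> i' k \<le> 2 * (int i - int i')" if "i' \<le> i" for i i' k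
    using lipschitz_cl[of "\<lambda>i. A i (cl (inner_start \<rho> + k))", OF A_row[OF _ cl_less], of "row_start \<rho> + i'" "i - i'"]
      lipschitz_cl[of "\<lambda>i. A i (inner_start \<rho>)", OF A_row[OF _ inner_start_less], of "row_start \<rho> + i'" "i - i'"] that inner_start_less[of \<rho>]
    by (simp add: \<alpha>_def of_nat_diff)
qed

abbreviation wt :: "nat \<Rightarrow> nat \<Rightarrow> nat \<Rightarrow> int" where
  "wt \<rho> \<equiv> gadget.weight N b (\<alpha> \<rho>) (\<beta> \<rho>)"

text \<open>Query z of phase \<rho> compares the candidate with inner index k for the entry (i, j).
  Clamping may make several queries cover the same candidate, which a minimum tolerates.\<close>

definition covers :: "nat \<Rightarrow> nat \<Rightarrow> nat \<Rightarrow> nat \<Rightarrow> nat \<Rightarrow> bool" where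
  "covers \<rho> z i j k \<longleftrightarrow> i = cl (row_start \<rho> + z div N) \<and> j = cl (col_start \<rho> + z mod N) \<and>
     (\<exists>k'<b. k = cl (inner_start \<rho> + k'))"

lemma all_covered:
  assumes "i < n" "j < n" "k < n"
  shows "\<exists>\<rho><R. \<exists>z<N * N. covers \<rho> z i j k"
proof -
  \<comment> \<open>The digits undo \<open>row_start\<close>, \<open>col_start\<close> and
    \<open>inner_start\<close>; the group digits are below 8 because n \<le> V \<le> 8 * N.\<close>
  define \<rho> where "\<rho> = i div N + 8 * (j div N) + 64 * (k div b)"
  define z where "z = (i mod N) * N + j mod N"
  have small: "i div N < 8" "j div N < 8"
    using assms N_bounds V_ge by (auto intro!: less_mult_imp_div_less)
  have \<rho>: "\<rho> mod 8 = i div N" "\<rho> div 8 = j div N + 8 * (k div b)"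
  proof -
    have digit: "(x + 8 * y) mod 8 = x" "(x + 8 * y) div 8 = y" if "x < 8" for x y :: nat
      using that by simp_all
    have "\<rho> = i div N + 8 * (j div N + 8 * (k div b))"
      by (simp add: \<rho>_def)
    then show "\<rho> mod 8 = i div N" "\<rho> div 8 = j div N + 8 * (k div b)"
      by (simp_all only: digit[OF small(1)])
  qed
  have \<rho>': "(\<rho> div 8) mod 8 = j div N" "\<rho> div 64 = k div b"
  proof -
    show "(\<rho> div 8) mod 8 = j div N"
      using small by (simp add: \<rho>(2))
    have "\<rho> div 64 = \<rho> div 8 div 8"
      by (simp add: div_mult2_eq[symmetric])
    then show "\<rho> div 64 = k div b"
      using small by (simp add: \<rho>(2))
  qed
  have "k div b \<le> V div b"
    using assms V_ge by (intro div_le_mono) linarith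
  then have "\<rho> < R"
    unfolding R using small by (simp add: \<rho>_def)
  have mods: "i mod N < N" "j mod N < N" "k mod b < b"
    using N_bounds b_bounds by simp_all
  have z: "z div N = i mod N" "z mod N = j mod N"
    using mods by (simp_all add: z_def)
  have "z < Suc (i mod N) * N"
    using mods by (simp add: z_def)
  also have "\<dots> \<le> N * N"
    using mods by (intro mult_le_mono Suc_leI order_refl)
  finally have "z < N * N" .
  \<comment> \<open>The start of the block that contains k is within range, hence it is not moved by
    clamping.\<close>
  have "k div b * b < n"
    using assms(3) by (rule le_less_trans[OF div_times_less_eq_dividend])
  then have "inner_start \<rho> = k div b * b"
    by (simp only: inner_start_def \<rho>' cl_id)
  then have "k = cl (inner_start \<rho> + k mod b)"
    using assms(3) by (simp only: div_mult_mod_eq cl_id)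
  moreover have "row_start \<rho> + z div N = i" "col_start \<rho> + z mod N = j"
    by (simp_all only: row_start_def col_start_def \<rho>(1) \<rho>'(1) z div_mult_mod_eq)
  ultimately have "covers \<rho> z i j k"
    using assms mods unfolding covers_def by (metis cl_id)
  with \<open>\<rho> < R\<close> \<open>z < N * N\<close> show ?thesis
    by blast
qed

definition inputs :: "(nat \<Rightarrow> int) \<Rightarrow> bool" where
  "inputs m \<longleftrightarrow> (\<forall>i<n. \<forall>j<n. m (i * n + j) = A i j \<and> m (n * n + (i * n + j)) = B i j)"

text \<open>Every stored bound is attained by some k, so it is never below the true entry, and it is
  at most each candidate in \<open>P\<close>. Once \<open>P\<close> holds for all k < n the bound
  must be the minimum.\<close>

definition guess :: "(nat \<Rightarrow> nat \<Rightarrow> nat \<Rightarrow> bool) \<Rightarrow> (nat \<Rightarrow> int) \<Rightarrow> bool" where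
  "guess P m \<longleftrightarrow> (\<forall>i<n. \<forall>j<n. (\<exists>k<n. m (2 * (n * n) + (i * n + j)) = A i k + B k j) \<and>
     (\<forall>k. P i j k \<longrightarrow> m (2 * (n * n) + (i * n + j)) \<le> A i k + B k j))"

definition slice :: "nat \<Rightarrow> nat \<Rightarrow> nat" where
  "slice \<rho> a = 3 * (n * n) + \<rho> + a * R"

text \<open>The slices of this and all later phases are still zero, as an SSRP program expects
  behind its adjacency matrix.\<close>

definition fresh :: "nat \<Rightarrow> (nat \<Rightarrow> int) \<Rightarrow> bool" where
  "fresh \<rho> m \<longleftrightarrow> (\<forall>\<rho>' a. \<rho> \<le> \<rho>' \<and> \<rho>' < R \<longrightarrow> m (slice \<rho>' a) = 0)"

definition const_regs :: "(reg \<Rightarrow> int) \<Rightarrow> bool" where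
  "const_regs r \<longleftrightarrow> r 0 = int n \<and> r 2 = int R \<and> r 3 = int V \<and> r 4 = int N \<and> r 5 = int b \<and>
     r 6 = int (V * V) \<and> r 7 = int (N * N) \<and> r 16 = int (n * n)"

definition phase_regs :: "nat \<Rightarrow> (reg \<Rightarrow> int) \<Rightarrow> bool" where
  "phase_regs \<rho> r \<longleftrightarrow> const_regs r \<and> r 8 = int \<rho> \<and> r 1 = int (3 * (n * n) + \<rho>) \<and> r 9 = int (row_start \<rho>) \<and>
     r 10 = int (col_start \<rho>) \<and> r 11 = int (inner_start \<rho>)"

lemma index_less: "i < n \<Longrightarrow> j < n \<Longrightarrow> i * n + j < n * n"
proof -
  assume "i < n" "j < n"
  then have "i * n + j < Suc i * n" by simp
  also have "\<dots> \<le> n * n"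
    using \<open>i < n\<close> by (intro mult_le_mono) auto
  finally show ?thesis .
qed

lemma slice_inj: "\<rho> < R \<Longrightarrow> \<rho>' < R \<Longrightarrow> slice \<rho> a = slice \<rho>' a' \<longleftrightarrow> \<rho> = \<rho>' \<and> a = a'"
proof -
  assume less: "\<rho> < R" "\<rho>' < R"
  have "\<rho> = \<rho>' \<and> a = a'" if "\<rho> + a * R = \<rho>' + a' * R"
  proof -
    have "(\<rho> + a * R) mod R = \<rho>" "(\<rho>' + a' * R) mod R = \<rho>'"
      using less by simp_all
    then have "\<rho> = \<rho>'" using that by simp
    then show ?thesis using that less by simp
  qed
  then show ?thesis by (auto simp: slice_def)
qed

lemma same_low:
  assumes "\<And>c. c < 3 * (n * n) \<Longrightarrow> m' c = m c"
  shows "inputs m \<Longrightarrow> inputs m'" and "guess P m \<Longrightarrow> guess P m'"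
proof -
  have "m' (i * n + j) = m (i * n + j)" "m' (n * n + (i * n + j)) = m (n * n + (i * n + j))"
    "m' (2 * (n * n) + (i * n + j)) = m (2 * (n * n) + (i * n + j))" if "i < n" "j < n" for i j
    using index_less[OF that] by (simp_all add: assms)
  then show "inputs m \<Longrightarrow> inputs m'" and "guess P m \<Longrightarrow> guess P m'"
    unfolding inputs_def guess_def by simp_all
qed

lemma evals_clamp:
  assumes "evals X e r m (int x)" "r 0 = int n"
  shows "evals X (clamp e) r m (int (cl x))"
proof -
  have "evals X (clamp e) r m (if x < n then int x else int (n - 1))"
    using assms n_pos V_ge X_ge by (intro evals_intros) (auto intro: le_V_le_X)
  then show ?thesis
    by (simp add: cl_if if_distrib[of int])
qed

lemma evals_A:
  assumes "evals X e r m (int i)" "evals X e' r m (int j)" "i < n" "j < n" "r 0 = int n" "inputs m"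
  shows "evals X (A_at e e') r m (A i j)"
proof (rule evals_Deref)
  show "evals X (e *\<^sub>e n_reg +\<^sub>e e') r m (int (i * n + j))"
    using assms V_ge by (intro evals_intros) (auto intro: le_V_le_X)
  show "m (i * n + j) = A i j"
    using assms by (simp add: inputs_def)
  show "\<bar>A i j\<bar> \<le> X"
    using A_bound[OF assms(3,4)] M_le by linarith
qed

lemma evals_B:
  assumes "evals X e r m (int i)" "evals X e' r m (int j)" "i < n" "j < n" "r 0 = int n"
    "r 16 = int (n * n)" "inputs m"
  shows "evals X (B_at e e') r m (B i j)"
proof (rule evals_Deref)
  show "evals X (nn_reg +\<^sub>e (e *\<^sub>e n_reg +\<^sub>e e')) r m (int (n * n + (i * n + j)))"
    using assms V_ge nn_le by (intro evals_intros) (auto intro: le_V_le_X le_X simp del: of_nat_mult)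
  show "m (n * n + (i * n + j)) = B i j"
    using assms by (simp add: inputs_def)
  show "\<bar>B i j\<bar> \<le> X"
    using B_bound[OF assms(3,4)] M_le by linarith
qed

lemma X_ge_2: "2 \<le> X"
  using X_ge by linarith

lemma start_bounds: "row_start \<rho> \<le> 8 * (V * V)" "col_start \<rho> \<le> 8 * (V * V)"
proof -
  have "x mod 8 * N \<le> 8 * (V * V)" for x
  proof -
    have "x mod 8 \<le> 8" "N \<le> V * V"
      using N_bounds V_ge le_trans[of N V "V * V"] by (simp_all add: less_imp_le)
    then show ?thesis
      by (intro mult_le_mono)
  qed
  then show "row_start \<rho> \<le> 8 * (V * V)" "col_start \<rho> \<le> 8 * (V * V)"
    by (simp_all add: row_start_def col_start_def)
qed

lemma reg_bounds:
  "int n \<le> X" "int V \<le> X" "int N \<le> X" "int b \<le> X" "int R \<le> X" "int (V * V) \<le> X" "int (N * N) \<le> X"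
  "int (n * n) \<le> X"
proof -
  show "int n \<le> X" "int V \<le> X" "int N \<le> X" "int b \<le> X"
    using V_ge N_bounds b_bounds by (auto intro!: le_V_le_X)
  show "int R \<le> X" "int (V * V) \<le> X" "int (N * N) \<le> X" "int (n * n) \<le> X"
    using R_bounds nn_le NN_le by (auto intro!: le_X simp del: of_nat_mult)
qed

lemma start_reg_bounds:
  "int (row_start \<rho>) \<le> X" "int (col_start \<rho>) \<le> X" "int (inner_start \<rho>) \<le> X"
  using start_bounds[of \<rho>] inner_start_less[of \<rho>] V_ge by (auto intro: le_X le_V_le_X)

lemma phase_reg_bounds:
  assumes "\<rho> < R"
  shows "int \<rho> \<le> X" "int (3 * (n * n) + \<rho>) \<le> X"
  using assms R_bounds nn_le by (auto intro!: le_X simp del: of_nat_mult of_nat_add)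

lemma evals_weight:
  assumes r: "phase_regs \<rho> r" "r 13 = int u" "r 14 = int v" and uv: "u < V" "v < V" and m: "inputs m"
  shows "evals X weight_exp r m (wt \<rho> u v)"
proof -
  have bounds: "int u \<le> X" "int v \<le> X"
    using uv by (auto intro: le_V_le_X)
  have regs: "r 0 = int n" "r 4 = int N" "r 5 = int b" "r 16 = int (n * n)" "r 9 = int (row_start \<rho>)"
    "r 10 = int (col_start \<rho>)" "r 11 = int (inner_start \<rho>)"
    using r by (simp_all add: phase_regs_def const_regs_def)
  show ?thesis
    unfolding weight_exp_def Let_def gadget.weight_def[OF gadget] \<alpha>_def \<beta>_def
    by (intro evals_intros evals_clamp evals_A evals_B)
      (use regs r(2,3) bounds reg_bounds start_reg_bounds[of \<rho>] X_ge m inner_start_less[of \<rho>] in simp_all)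
qed

lemma wp_phase_setup:
  assumes \<rho>: "\<rho> < R" and r: "const_regs r" "r 8 = int \<rho>"
  shows "wp W (block phase_setup) (cost_block phase_setup) (\<lambda>r' m'. phase_regs \<rho> r' \<and> m' = m) r m"
proof (rule wp_block[OF _ wf_blocks(1) X_ge_2 W])
  note bounds = reg_bounds phase_reg_bounds[OF \<rho>] X_ge
  have regs: "r 0 = int n" "r 4 = int N" "r 5 = int b" "r 16 = int (n * n)"
    using r by (simp_all add: const_regs_def)
  show "wp_block X phase_setup (\<lambda>r' m'. phase_regs \<rho> r' \<and> m' = m) r m"
    unfolding phase_setup_def
  proof (rule wp_block_Asg, rule_tac [2] wp_block_Asg, rule_tac [3] wp_block_Asg,
      rule_tac [4] wp_block_Asg)
    show "evals X (Lit 3 *\<^sub>e nn_reg +\<^sub>e phase_reg) r m (int (3 * (n * n) + \<rho>))"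
      by (intro evals_intros) (use regs r bounds \<rho> in simp_all)
    let ?r1 = "r(1 := int (3 * (n * n) + \<rho>))"
    show "evals X (phase_reg mod\<^sub>e Lit 8 *\<^sub>e N_reg) ?r1 m (int (\<rho> mod 8 * N))"
      by (intro evals_intros) (use regs r bounds \<rho> in simp_all)
    let ?r2 = "?r1(9 := int (\<rho> mod 8 * N))"
    show "evals X (phase_reg div\<^sub>e Lit 8 mod\<^sub>e Lit 8 *\<^sub>e N_reg) ?r2 m (int (\<rho> div 8 mod 8 * N))"
      by (intro evals_intros) (use regs r bounds \<rho> in simp_all)
    let ?r3 = "?r2(10 := int (\<rho> div 8 mod 8 * N))"
    show "evals X (clamp (phase_reg div\<^sub>e Lit 64 *\<^sub>e b_reg)) ?r3 m (int (cl (\<rho> div 64 * b)))"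
      by (intro evals_clamp evals_intros) (use regs r bounds \<rho> in simp_all)
    show "wp_block X [] (\<lambda>r' m'. phase_regs \<rho> r' \<and> m' = m)
        (?r3(11 := int (cl (\<rho> div 64 * b)))) m"
      using r by (simp add: phase_regs_def const_regs_def row_start_def col_start_def inner_start_def)
  qed
qed

abbreviation graph_mem :: "nat \<Rightarrow> nat \<Rightarrow> int" where
  "graph_mem \<rho> \<equiv> graph_memory V (weight_graph V (wt \<rho>)) (case_prod (wt \<rho>))"

lemma low_not_slice: "c < 3 * (n * n) \<Longrightarrow> c \<noteq> slice \<rho> a"
  by (simp add: slice_def)

text \<open>Only the V * V cells of the adjacency matrix are written; the infinitely many zeros
  behind it come from freshness.\<close>

lemma wp_write_graph:
  assumes \<rho>: "\<rho> < R" and r: "phase_regs \<rho> r" and m: "inputs m" "fresh \<rho> m"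
  shows "wp W (For 12 6 (block write_weight)) (V * V * (cost_block write_weight + 10) + 10)
    (\<lambda>r' m'. phase_regs \<rho> r' \<and> (\<forall>a. m' (slice \<rho> a) = graph_mem \<rho> a) \<and>
      (\<forall>c. (\<forall>a. c \<noteq> slice \<rho> a) \<longrightarrow> m' c = m c)) r m"
proof (rule wp_For[where X = X and Inv = "\<lambda>i r' m'. phase_regs \<rho> r' \<and>
    (\<forall>a. m' (slice \<rho> a) = (if a < i then wt \<rho> (a div V) (a mod V) else 0)) \<and>
    (\<forall>c. (\<forall>a. c \<noteq> slice \<rho> a) \<longrightarrow> m' c = m c)"])
  show "2 \<le> X" "X ^ 300 \<le> W" "int (V * V) \<le> X"
    using X_ge_2 W reg_bounds by simp_all
  show "r 6 = int (V * V)"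
    using r by (simp add: phase_regs_def const_regs_def)
  show "phase_regs \<rho> (r(12 := 0)) \<and>
      (\<forall>a. m (slice \<rho> a) = (if a < 0 then wt \<rho> (a div V) (a mod V) else 0)) \<and>
      (\<forall>c. (\<forall>a. c \<noteq> slice \<rho> a) \<longrightarrow> m c = m c)"
    using r m \<rho> by (simp add: phase_regs_def const_regs_def fresh_def)
next
  fix i r' m'
  assume i: "i < V * V" and r12: "r' 12 = int i" and r6: "r' 6 = int (V * V)"
    and inv: "phase_regs \<rho> r' \<and>
      (\<forall>a. m' (slice \<rho> a) = (if a < i then wt \<rho> (a div V) (a mod V) else 0)) \<and>
      (\<forall>c. (\<forall>a. c \<noteq> slice \<rho> a) \<longrightarrow> m' c = m c)"
  have V0: "0 < V"
    using V_ge by linarith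
  have uv: "i div V < V" "i mod V < V"
    using i V0 by (auto simp: less_mult_imp_div_less)
  have regs: "r' 1 = int (3 * (n * n) + \<rho>)" "r' 2 = int R" "r' 3 = int V"
    using inv by (simp_all add: phase_regs_def const_regs_def)
  have inputs: "inputs m'"
    by (rule same_low(1)[OF _ m(1)]) (use inv low_not_slice in blast)
  have bounds: "int i \<le> X"
    using i by (intro le_X) linarith
  note bounds = bounds reg_bounds phase_reg_bounds[OF \<rho>]
  let ?Q = "\<lambda>r' m'. r' 12 = int i \<and> r' 6 = int (V * V) \<and> phase_regs \<rho> (r'(12 := int (Suc i))) \<and>
      (\<forall>a. m' (slice \<rho> a) = (if a < Suc i then wt \<rho> (a div V) (a mod V) else 0)) \<and>
      (\<forall>c. (\<forall>a. c \<noteq> slice \<rho> a) \<longrightarrow> m' c = m c)"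
  show "wp W (block write_weight) (cost_block write_weight) ?Q r' m'"
  proof (rule wp_block[OF _ wf_blocks(2) X_ge_2 W])
    show "wp_block X write_weight ?Q r' m'"
      unfolding write_weight_def
    proof (rule wp_block_Asg, rule_tac [2] wp_block_Asg, rule_tac [3] wp_block_Sto)
      show "evals X (ctr_reg div\<^sub>e V_reg) r' m' (int (i div V))"
        by (intro evals_intros) (use r12 regs bounds in simp_all)
      let ?r1 = "r'(13 := int (i div V))"
      show "evals X (ctr_reg mod\<^sub>e V_reg) ?r1 m' (int (i mod V))"
        by (intro evals_intros) (use r12 regs bounds in simp_all)
      let ?r2 = "?r1(14 := int (i mod V))"
      \<comment> \<open>Register 1 holds the whole offset, so only the outermost sum may be split
        before the structural rules apply.\<close>
      show "evals X (off_reg +\<^sub>e ctr_reg *\<^sub>e str_reg) ?r2 m' (int (3 * (n * n) + \<rho> + i * R))"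
        unfolding of_nat_add[of "3 * (n * n) + \<rho>"]
        by (intro evals_intros) (use r12 regs bounds \<rho> in simp_all)
      show "evals X weight_exp ?r2 m' (wt \<rho> (i div V) (i mod V))"
        by (rule evals_weight) (use inv inputs uv in \<open>auto simp: phase_regs_def const_regs_def\<close>)
      have "?Q ?r2 (m'(slice \<rho> i := wt \<rho> (i div V) (i mod V)))"
        using inv r12 by (auto simp: phase_regs_def const_regs_def slice_inj[OF \<rho> \<rho>] less_Suc_eq)
      then show "wp_block X [] ?Q ?r2
          (m'(3 * (n * n) + \<rho> + i * R := wt \<rho> (i div V) (i mod V)))"
        by (simp add: slice_def)
    qed
  qed
next
  fix r' m'
  assume "phase_regs \<rho> r' \<and>
      (\<forall>a. m' (slice \<rho> a) = (if a < V * V then wt \<rho> (a div V) (a mod V) else 0)) \<and>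
      (\<forall>c. (\<forall>a. c \<noteq> slice \<rho> a) \<longrightarrow> m' c = m c)"
  then show "phase_regs \<rho> r' \<and> (\<forall>a. m' (slice \<rho> a) = graph_mem \<rho> a) \<and>
      (\<forall>c. (\<forall>a. c \<noteq> slice \<rho> a) \<longrightarrow> m' c = m c)"
    by (simp add: graph_memory_weight_graph)
qed simp_all

text \<open>Progress in the lexicographic order of phases and queries: all earlier phases
  completely, and the first z queries of phase \<rho>.\<close>

definition finished :: "nat \<Rightarrow> nat \<Rightarrow> nat \<Rightarrow> nat \<Rightarrow> nat \<Rightarrow> bool" where
  "finished \<rho> z i j k \<longleftrightarrow> (\<exists>\<rho>'<\<rho>. \<exists>z'<N * N. covers \<rho>' z' i j k) \<or> (\<exists>z'<z. covers \<rho> z' i j k)"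

definition block_min :: "nat \<Rightarrow> nat \<Rightarrow> int" where
  "block_min \<rho> z = Min ((\<lambda>k. A (cl (row_start \<rho> + z div N)) (cl (inner_start \<rho> + k)) +
     B (cl (inner_start \<rho> + k)) (cl (col_start \<rho> + z mod N))) ` {..<b})"

lemma block_min_le:
  "covers \<rho> z i j k \<Longrightarrow> block_min \<rho> z \<le> A i k + B k j"
  unfolding covers_def block_min_def by (auto intro!: Min_le)

lemma block_min_attained:
  obtains k where "k < n" "block_min \<rho> z =
    A (cl (row_start \<rho> + z div N)) k + B k (cl (col_start \<rho> + z mod N))"
proof -
  have "block_min \<rho> z \<in> (\<lambda>k. A (cl (row_start \<rho> + z div N)) (cl (inner_start \<rho> + k)) +
     B (cl (inner_start \<rho> + k)) (cl (col_start \<rho> + z mod N))) ` {..<b}"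
    unfolding block_min_def using b_bounds by (intro Min_in) auto
  then show ?thesis
    using that cl_less by blast
qed

text \<open>The entries subtracted by the normalisation do not depend on k, so adding them back
  commutes with the minimum.\<close>

lemma block_min_eq:
  "Min ((\<lambda>k. \<alpha> \<rho> (z div N) k + \<beta> \<rho> k (z mod N)) ` {..<b}) +
     (A (cl (row_start \<rho> + z div N)) (inner_start \<rho>) + B (inner_start \<rho>) (cl (col_start \<rho> + z mod N))) =
   block_min \<rho> z"
proof -
  let ?c = "A (cl (row_start \<rho> + z div N)) (inner_start \<rho>) + B (inner_start \<rho>) (cl (col_start \<rho> + z mod N))"
  let ?S = "(\<lambda>k. \<alpha> \<rho> (z div N) k + \<beta> \<rho> k (z mod N)) ` {..<b}"
  have "Min ((\<lambda>x. x + ?c) ` ?S) = Min ?S + ?c"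
    using b_bounds by (intro mono_Min_commute[symmetric, where f = "\<lambda>x. x + ?c"]) (auto simp: mono_def)
  moreover have "(\<lambda>x. x + ?c) ` ?S =
      (\<lambda>k. A (cl (row_start \<rho> + z div N)) (cl (inner_start \<rho> + k)) +
     B (cl (inner_start \<rho> + k)) (cl (col_start \<rho> + z mod N))) ` {..<b}"
    unfolding image_image by (simp add: \<alpha>_def \<beta>_def)
  ultimately show ?thesis
    by (simp add: block_min_def)
qed

text \<open>A query touches one cell only, and row-major addresses identify its entry. Taking the
  minimum with an attained value keeps the bound attained and adds exactly the candidates covered by
  this query.\<close>

lemma guess_update:
  assumes g: "guess (finished \<rho> z) m"
    and m': "\<And>c. c < 3 * (n * n) \<Longrightarrow> m' c = (if c = a then min (block_min \<rho> z) (m a) else m c)"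
    and a: "a = 2 * (n * n) + (cl (row_start \<rho> + z div N) * n + cl (col_start \<rho> + z mod N))"
  shows "guess (finished \<rho> (Suc z)) m'"
  unfolding guess_def
proof (intro allI impI)
  fix i j assume ij: "i < n" "j < n"
  let ?c = "2 * (n * n) + (i * n + j)"
  let ?i = "cl (row_start \<rho> + z div N)" and ?j = "cl (col_start \<rho> + z mod N)"
  have c: "?c < 3 * (n * n)"
    using index_less[OF ij] by linarith
  from g ij obtain k where k: "k < n" "m ?c = A i k + B k j"
    unfolding guess_def by blast
  have le: "m ?c \<le> A i k + B k j" if "finished \<rho> z i j k" for k
    using g ij that unfolding guess_def by blast
  have eq: "i = ?i \<and> j = ?j" if "?c = a"
  proof -
    have "i * n + j = ?i * n + ?j"
      using that a by simp
    moreover have "(i * n + j) mod n = j" "(?i * n + ?j) mod n = ?j"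
      using ij by simp_all
    ultimately have "j = ?j"
      by simp
    with \<open>i * n + j = ?i * n + ?j\<close> show ?thesis
      using n_pos by simp
  qed
  have a_eq: "?c = a" if "covers \<rho> z i j k" for k
    using that a by (simp add: covers_def)
  have step: "finished \<rho> (Suc z) i j k \<longleftrightarrow> finished \<rho> z i j k \<or> covers \<rho> z i j k" for k
    by (auto simp: finished_def less_Suc_eq)
  show "(\<exists>k<n. m' ?c = A i k + B k j) \<and> (\<forall>k. finished \<rho> (Suc z) i j k \<longrightarrow> m' ?c \<le> A i k + B k j)"
  proof (cases "?c = a")
    case True
    then have m'c: "m' ?c = min (block_min \<rho> z) (m ?c)"
      using m'[OF c] by simp
    obtain k' where k': "k' < n" "block_min \<rho> z = A i k' + B k' j"
      using block_min_attained[of \<rho> z] eq[OF True] by metis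
    have "\<exists>k<n. m' ?c = A i k + B k j"
      using k k' m'c by (metis min_def)
    moreover have "m' ?c \<le> A i k + B k j" if "finished \<rho> (Suc z) i j k" for k
      using that le[of k] block_min_le[of \<rho> z i j k] m'c unfolding step by linarith
    ultimately show ?thesis
      by blast
  next
    case False
    then have "m' ?c = m ?c"
      using m'[OF c] by simp
    with k le a_eq False show ?thesis
      unfolding step by metis
  qed
qed

lemma wp_query_setup:
  assumes r: "phase_regs \<rho> r" "r 12 = int z" and z: "z < N * N"
  shows "wp W (block query_setup) (cost_block query_setup)
    (\<lambda>r' m'. m' = m \<and> phase_regs \<rho> r' \<and> r' 12 = int z \<and> r' 13 = int (2 * (z div N)) \<and>
      r' 14 = int (2 * (z div N) + 1) \<and> r' 17 = int (gadget.target N b (z mod N))) r m"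
proof (rule wp_block[OF _ wf_blocks(3) X_ge_2 W])
  have zN: "z div N < N"
    using z by (auto simp: less_mult_imp_div_less)
  have "2 * (z div N) \<le> V"
    using zN N_bounds by linarith
  then have "int (2 * (z div N)) \<le> X"
    by (rule le_V_le_X)
  moreover have "int z \<le> X"
    using z NN_le by (intro le_X) linarith
  ultimately have "int (2 * (z div N)) \<le> X" "int z \<le> X" .
  note bounds = this reg_bounds start_reg_bounds[of \<rho>] X_ge
  have regs: "r 4 = int N" "r 5 = int b"
    using r by (simp_all add: phase_regs_def const_regs_def)
  let ?Q = "\<lambda>r' m'. m' = m \<and> phase_regs \<rho> r' \<and> r' 12 = int z \<and> r' 13 = int (2 * (z div N)) \<and>
      r' 14 = int (2 * (z div N) + 1) \<and> r' 17 = int (gadget.target N b (z mod N))"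
  show "wp_block X query_setup ?Q r m"
    unfolding query_setup_def
  proof (rule wp_block_Asg, rule_tac [2] wp_block_Asg, rule_tac [3] wp_block_Asg)
    show "evals X (Lit 2 *\<^sub>e (ctr_reg div\<^sub>e N_reg)) r m (int (2 * (z div N)))"
      by (intro evals_intros) (use r regs bounds in simp_all)
    let ?r1 = "r(13 := int (2 * (z div N)))"
    show "evals X (Reg 13 +\<^sub>e Lit 1) ?r1 m (int (2 * (z div N) + 1))"
      unfolding of_nat_add[of "2 * (z div N)"] by (intro evals_intros) (use bounds in simp_all)
    let ?r2 = "?r1(14 := int (2 * (z div N) + 1))"
    show "evals X (Lit 2 *\<^sub>e N_reg +\<^sub>e Lit 4 *\<^sub>e (b_reg *\<^sub>e b_reg) +\<^sub>e ctr_reg mod\<^sub>e N_reg) ?r2 m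
        (int (2 * N + 4 * (b * b) + z mod N))"
      by (intro evals_intros) (use r regs bounds in simp_all)
    show "wp_block X [] ?Q (?r2(17 := int (2 * N + 4 * (b * b) + z mod N))) m"
      using r by (simp add: phase_regs_def const_regs_def gadget.target_def[OF gadget])
  qed
qed

lemma wp_query_update:
  assumes r: "phase_regs \<rho> r" "r 12 = int z" "r 13 = int (2 * (z div N))"
      "r 15 = - 2 * int (z div N) + 2 * int b +
        Min ((\<lambda>k. \<alpha> \<rho> (z div N) k + \<beta> \<rho> k (z mod N)) ` {..<b})"
    and z: "z < N * N" and m: "inputs m" "guess (finished \<rho> z) m"
  shows "wp W (block query_update) (cost_block query_update)
    (\<lambda>r' m'. phase_regs \<rho> r' \<and> r' 12 = int z \<and> inputs m' \<and> guess (finished \<rho> (Suc z)) m' \<and>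
      (\<forall>c. 3 * (n * n) \<le> c \<longrightarrow> m' c = m c)) r m"
proof (rule wp_block[OF _ wf_blocks(4) X_ge_2 W])
  define i where "i = z div N"
  define j where "j = z mod N"
  define ci where "ci = cl (row_start \<rho> + i)"
  define cj where "cj = cl (col_start \<rho> + j)"
  define mn where "mn = Min ((\<lambda>k. \<alpha> \<rho> i k + \<beta> \<rho> k j) ` {..<b})"
  define a where "a = 2 * (n * n) + (ci * n + cj)"
  have i: "i < N"
    using z by (auto simp: i_def less_mult_imp_div_less)
  have c: "ci < n" "cj < n"
    by (simp_all add: ci_def cj_def)
  have a_less: "a < 3 * (n * n)" "2 * (n * n) \<le> a"
    using index_less[OF c] by (simp_all add: a_def)
  have mn: "\<bar>mn\<bar> < 2 * int b"
  proof -
    have "mn \<in> (\<lambda>k. \<alpha> \<rho> i k + \<beta> \<rho> k j) ` {..<b}"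
      unfolding mn_def using b_bounds by (intro Min_in) auto
    then obtain k where "k < b" "mn = \<alpha> \<rho> i k + \<beta> \<rho> k j"
      by auto
    then show ?thesis
      using gadget.\<alpha>_bound[OF gadget \<open>k < b\<close>, of \<rho> i] gadget.\<beta>_bound[OF gadget \<open>k < b\<close>, of \<rho> j]
      by linarith
  qed
  have dist: "r 15 = - 2 * int i + 2 * int b + mn"
    using r(4) by (simp add: i_def j_def mn_def)
  \<comment> \<open>This dominates the returned distance: at most 2 * N from the path, 2 * b from
    the chain offset, and less than 2 * b from \<alpha> + \<beta>.\<close>
  have "int (2 * N + 4 * b) \<le> X"
  proof (rule le_X)
    have "V \<le> V * V" by simp
    then show "2 * N + 4 * b \<le> 8 * (V * V)"
      using N_bounds b_bounds by linarith
  qed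
  then have "\<bar>r 15\<bar> \<le> X"
    unfolding dist using mn i by linarith
  moreover have "int z \<le> X" "int (2 * i) \<le> X" "int ci \<le> X" "int cj \<le> X"
  proof -
    show "int z \<le> X"
      using z NN_le by (intro le_X) linarith
    show "int (2 * i) \<le> X"
      using i N_bounds by (intro le_V_le_X) linarith
    show "int ci \<le> X" "int cj \<le> X"
      using c V_ge by (auto intro!: le_V_le_X)
  qed
  moreover have "int a \<le> X"
    using a_less nn_le by (intro le_X) linarith
  ultimately have bounds: "\<bar>r 15\<bar> \<le> X" "int z \<le> X" "int (2 * i) \<le> X" "int ci \<le> X" "int cj \<le> X"
    "int a \<le> X" by auto
  note bounds = bounds reg_bounds start_reg_bounds[of \<rho>] X_ge
  have regs: "r 0 = int n" "r 4 = int N" "r 5 = int b" "r 16 = int (n * n)" "r 9 = int (row_start \<rho>)"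
    "r 10 = int (col_start \<rho>)" "r 11 = int (inner_start \<rho>)" "r 12 = int z" "r 13 = int (2 * i)"
    using r by (simp_all add: phase_regs_def const_regs_def i_def)
  have cand: "block_min \<rho> z = mn + (A ci (inner_start \<rho>) + B (inner_start \<rho>) cj)"
    using block_min_eq[of \<rho> z] by (simp add: mn_def ci_def cj_def i_def j_def)
  have sum_bound: "\<bar>A x k + B k y\<bar> \<le> X" if "x < n" "k < n" "y < n" for x k y
    using A_bound[of x k] B_bound[of k y] that M_le by linarith
  have cand_bound: "\<bar>block_min \<rho> z\<bar> \<le> X"
    using block_min_attained[of \<rho> z] sum_bound cl_less by metis
  have cell_bound: "\<bar>m a\<bar> \<le> X"
  proof -
    obtain k where "k < n" "m a = A ci k + B k cj"
      using m(2) c unfolding guess_def a_def by blast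
    then show ?thesis
      using sum_bound c by simp
  qed
  let ?Q = "\<lambda>r' m'. phase_regs \<rho> r' \<and> r' 12 = int z \<and> inputs m' \<and> guess (finished \<rho> (Suc z)) m' \<and>
      (\<forall>c. 3 * (n * n) \<le> c \<longrightarrow> m' c = m c)"
  let ?v = "if block_min \<rho> z < m a then block_min \<rho> z else m a"
  show "wp_block X query_update ?Q r m"
    unfolding query_update_def
  proof (rule wp_block_Asg, rule_tac [2] wp_block_Asg, rule_tac [3] wp_block_Asg,
      rule_tac [4] wp_block_Asg, rule_tac [5] wp_block_Sto)
    show "evals X (clamp (row_reg +\<^sub>e ctr_reg div\<^sub>e N_reg)) r m (int ci)"
      unfolding ci_def i_def by (intro evals_clamp evals_intros) (use regs bounds in simp_all)
    let ?r1 = "r(18 := int ci)"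
    show "evals X (clamp (col_reg +\<^sub>e ctr_reg mod\<^sub>e N_reg)) ?r1 m (int cj)"
      unfolding cj_def j_def by (intro evals_clamp evals_intros) (use regs bounds in simp_all)
    let ?r2 = "?r1(19 := int cj)"
    have "evals X (Reg 15 +\<^sub>e Reg 13 -\<^sub>e Lit 2 *\<^sub>e b_reg +\<^sub>e
        (A_at (Reg 18) inner_reg +\<^sub>e B_at inner_reg (Reg 19))) ?r2 m
        (r 15 + int (2 * i) - 2 * int b + (A ci (inner_start \<rho>) + B (inner_start \<rho>) cj))"
      by (intro evals_intros evals_A evals_B)
        (use regs bounds m c inner_start_less[of \<rho>] in simp_all)
    then show "evals X (Reg 15 +\<^sub>e Reg 13 -\<^sub>e Lit 2 *\<^sub>e b_reg +\<^sub>e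
        (A_at (Reg 18) inner_reg +\<^sub>e B_at inner_reg (Reg 19))) ?r2 m (block_min \<rho> z)"
      by (simp add: cand dist)
    let ?r3 = "?r2(15 := block_min \<rho> z)"
    show "evals X (Lit 2 *\<^sub>e nn_reg +\<^sub>e (Reg 18 *\<^sub>e n_reg +\<^sub>e Reg 19)) ?r3 m (int a)"
      unfolding a_def by (intro evals_intros) (use regs bounds in simp_all)
    let ?r4 = "?r3(18 := int a)"
    show "evals X (Reg 18) ?r4 m (int a)"
      by (intro evals_intros) (use bounds in simp_all)
    show "evals X (Ite (Reg 15 <\<^sub>e Deref (Reg 18)) (Reg 15) (Deref (Reg 18))) ?r4 m ?v"
      by (intro evals_intros evals_Deref[where x = a])
        (use bounds cand_bound cell_bound in simp_all)
    have "inputs (m(a := ?v))"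
      unfolding inputs_def
    proof (intro allI impI)
      fix x y assume xy: "x < n" "y < n"
      have "x * n + y \<noteq> a" "n * n + (x * n + y) \<noteq> a"
        using index_less[OF xy] a_less(2) by linarith+
      then show "(m(a := ?v)) (x * n + y) = A x y \<and> (m(a := ?v)) (n * n + (x * n + y)) = B x y"
        using m(1) xy by (simp add: inputs_def)
    qed
    moreover have "guess (finished \<rho> (Suc z)) (m(a := ?v))"
      by (rule guess_update[OF m(2), where a = a])
        (simp_all add: a_def ci_def cj_def i_def j_def min_def)
    moreover have "\<forall>c. 3 * (n * n) \<le> c \<longrightarrow> (m(a := ?v)) c = m c"
      using a_less by simp
    moreover have "phase_regs \<rho> ?r4 \<and> ?r4 12 = int z"
      using r by (simp add: phase_regs_def const_regs_def)
    ultimately show "wp_block X [] ?Q ?r4 (m(a := ?v))"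
      by simp
  qed
qed

definition query_time :: nat where
  "query_time = cost_block query_setup + ((2 * D + 3 * tq + 3) + cost_block query_update)"

definition phase_time :: nat where
  "phase_time = cost_block phase_setup + ((V * V * (cost_block write_weight + 10) + 10) +
     ((2 * D + 3 * tp + 3) + (N * N * (query_time + 10) + 10)))"

text \<open>\<open>Wp\<close> is the word bound of the SSRP programs, hence also a bound on their
  addresses; \<open>W\<close> must hold these addresses after scaling by the stride and adding the
  offset of any phase.\<close>

lemma call_bounds: "Wp * int R + int (3 * (n * n) + \<rho>) \<le> W" if "\<rho> < R"
  using Wp(3) that by linarith

lemma Wp_pos: "2 \<le> Wp"
  using Wp(1) V_ge by linarith

lemma wp_query:
  assumes r: "phase_regs \<rho> r" "r 12 = int z" and z: "z < N * N" and \<rho>: "\<rho> < R"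
    and m: "inputs m" "guess (finished \<rho> z) m"
    and mem: "\<forall>a. m (slice \<rho> a) = mem a" "\<forall>a. \<bar>mem a\<bar> \<le> Wp"
    and q: "\<And>x y v. (x, y) \<in> parcs (weight_graph V (wt \<rho>)) \<Longrightarrow> v < V \<Longrightarrow>
      \<exists>t' r'. exec Wp q (init_regs [int x, int y, int v], mem) t' (r', mem) \<and> t' \<le> tq \<and>
        dist_regs r' (replacement_dist (weight_graph V (wt \<rho>)) (case_prod (wt \<rho>)) 0 v (x, y))"
  shows "wp W (Seq (block query_setup) (Seq (call D q [13, 14, 17]) (block query_update))) query_time
    (\<lambda>r' m'. phase_regs \<rho> r' \<and> r' 12 = int z \<and> inputs m' \<and> guess (finished \<rho> (Suc z)) m' \<and>
      (\<forall>c. 3 * (n * n) \<le> c \<longrightarrow> m' c = m c)) r m"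
  unfolding query_time_def
proof (rule wp_Seq, rule wp_mono[OF wp_query_setup[OF r z] order_refl], elim conjE, hypsubst)
  interpret g: gadget N b V "\<alpha> \<rho>" "\<beta> \<rho>"
    by (rule gadget)
  let ?i = "z div N" and ?j = "z mod N"
  fix r1
  assume r1: "phase_regs \<rho> r1" "r1 12 = int z" "r1 13 = int (2 * ?i)" "r1 14 = int (2 * ?i + 1)"
    "r1 17 = int (g.target ?j)"
  have ij: "?i < N" "?j < N"
    using z N_bounds by (auto simp: less_mult_imp_div_less)
  have less: "2 * ?i + 1 < 2 * N" "2 * ?i + 1 < V" "g.target ?j < V"
    using ij g.size unfolding g.target_def by linarith+
  have arc: "(2 * ?i, 2 * ?i + 1) \<in> parcs (weight_graph V (wt \<rho>))"
    using g.weight_path[OF less(1)] less(2) by simp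
  obtain t' r' where 1: "exec Wp q (init_regs [int (2 * ?i), int (2 * ?i + 1), int (g.target ?j)], mem)
      t' (r', mem)" "t' \<le> tq"
      "dist_regs r' (replacement_dist (weight_graph V (wt \<rho>)) (case_prod (wt \<rho>)) 0
        (g.target ?j) (2 * ?i, 2 * ?i + 1))"
    using q[OF arc less(3)] by blast
  \<comment> \<open>The distance is finite, so \<open>dist_regs\<close> makes register 1 carry its
    value.\<close>
  have r'1: "r' 1 = - 2 * int ?i + 2 * int b +
      Min ((\<lambda>k. \<alpha> \<rho> ?i k + \<beta> \<rho> k ?j) ` {..<b})" (is "_ = ?d")
  proof -
    have "ereal (real_of_int (r' 1)) = ereal (real_of_int ?d)"
      using 1(3) unfolding g.replacement_dist_gadget[OF ij] dist_regs_def by simp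
    then show ?thesis
      by simp
  qed
  have "wp W (call D q [13, 14, 17]) (2 * D + 3 * t' + 3)
     (wp W (block query_update) (cost_block query_update)
       (\<lambda>r' m'. phase_regs \<rho> r' \<and> r' 12 = int z \<and> inputs m' \<and> guess (finished \<rho> (Suc z)) m' \<and>
      (\<forall>c. 3 * (n * n) \<le> c \<longrightarrow> m' c = m c))) r1 m"
  proof (rule wp_call[where W = Wp and str = R and off = "3 * (n * n) + \<rho>" and mem = mem])
    show "exec Wp q (init_regs (map r1 [13, 14, 17]), mem) t' (r', mem)"
      using 1(1) r1 by (simp del: of_nat_mult of_nat_add)
    show "\<forall>x\<in>set [13, 14, 17]. x < 20 \<and> \<bar>r1 x\<bar> \<le> Wp"
      using r1(3-5) less Wp(1) by simp
    show "Wp * int R + int (3 * (n * n) + \<rho>) \<le> W"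
      by (rule call_bounds[OF \<rho>])
    show "\<forall>a. m (3 * (n * n) + \<rho> + a * R) = mem a"
      using mem(1) by (simp add: slice_def)
    fix m' assume m': "\<forall>a. m' (3 * (n * n) + \<rho> + a * R) = mem a"
      "\<forall>c. (\<forall>a. c \<noteq> 3 * (n * n) + \<rho> + a * R) \<longrightarrow> m' c = m c"
    \<comment> \<open>The query program preserves its slice and a call changes nothing outside it,
      so the table remains usable for the next query.\<close>
    have "m' = m"
    proof
      fix c
      show "m' c = m c"
      proof (cases "\<exists>a. c = slice \<rho> a")
        case True
        then show ?thesis
          using m'(1) mem(1) by (auto simp: slice_def)
      next
        case False
        then show ?thesis
          using m'(2) by (simp add: slice_def)
      qed
    qed
    show "wp W (block query_update) (cost_block query_update)
       (\<lambda>r' m'. phase_regs \<rho> r' \<and> r' 12 = int z \<and> inputs m' \<and> guess (finished \<rho> (Suc z)) m' \<and>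
      (\<forall>c. 3 * (n * n) \<le> c \<longrightarrow> m' c = m c)) (r1(15 := r' 1)) m'"
      unfolding \<open>m' = m\<close>
      by (rule wp_query_update)
        (use r1 z m r'1 in \<open>simp_all add: phase_regs_def const_regs_def\<close>)
  qed (use D Wp Wp_pos mem R_bounds r1(1) in \<open>simp_all add: phase_regs_def const_regs_def\<close>)
  then show "wp W (Seq (call D q [13, 14, 17]) (block query_update))
      (2 * D + 3 * tq + 3 + cost_block query_update)
       (\<lambda>r' m'. phase_regs \<rho> r' \<and> r' 12 = int z \<and> inputs m' \<and> guess (finished \<rho> (Suc z)) m' \<and>
      (\<forall>c. 3 * (n * n) \<le> c \<longrightarrow> m' c = m c)) r1 m"
    using 1(2) by (intro wp_Seq) (auto elim!: wp_mono)
qed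

lemma wp_queries:
  assumes r: "phase_regs \<rho> r" and \<rho>: "\<rho> < R"
    and m: "inputs m" "guess (finished \<rho> 0) m" "fresh (Suc \<rho>) m"
    and mem: "\<forall>a. m (slice \<rho> a) = mem a" "\<forall>a. \<bar>mem a\<bar> \<le> Wp"
    and q: "\<And>x y v. (x, y) \<in> parcs (weight_graph V (wt \<rho>)) \<Longrightarrow> v < V \<Longrightarrow>
      \<exists>t' r'. exec Wp q (init_regs [int x, int y, int v], mem) t' (r', mem) \<and> t' \<le> tq \<and>
        dist_regs r' (replacement_dist (weight_graph V (wt \<rho>)) (case_prod (wt \<rho>)) 0 v (x, y))"
  shows "wp W (For 12 7 (Seq (block query_setup) (Seq (call D q [13, 14, 17]) (block query_update))))
    (N * N * (query_time + 10) + 10)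
    (\<lambda>r' m'. phase_regs \<rho> r' \<and> inputs m' \<and> guess (finished \<rho> (N * N)) m' \<and> fresh (Suc \<rho>) m') r m"
proof (rule wp_For[where X = X and Inv = "\<lambda>z r' m'. phase_regs \<rho> r' \<and> inputs m' \<and>
    guess (finished \<rho> z) m' \<and> (\<forall>c. 3 * (n * n) \<le> c \<longrightarrow> m' c = m c)"])
  show "2 \<le> X" "X ^ 300 \<le> W" "int (N * N) \<le> X"
    using X_ge_2 W reg_bounds by simp_all
  show "r 7 = int (N * N)"
    using r by (simp add: phase_regs_def const_regs_def)
  show "phase_regs \<rho> (r(12 := 0)) \<and> inputs m \<and> guess (finished \<rho> 0) m \<and>
      (\<forall>c. 3 * (n * n) \<le> c \<longrightarrow> m c = m c)"
    using r m by (simp add: phase_regs_def const_regs_def)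
next
  fix z r' m'
  assume z: "z < N * N" "r' 12 = int z" "r' 7 = int (N * N)"
    and inv: "phase_regs \<rho> r' \<and> inputs m' \<and> guess (finished \<rho> z) m' \<and>
      (\<forall>c. 3 * (n * n) \<le> c \<longrightarrow> m' c = m c)"
  have "\<forall>a. m' (slice \<rho> a) = mem a"
    using inv mem(1) by (simp add: slice_def)
  with inv have "wp W (Seq (block query_setup) (Seq (call D q [13, 14, 17]) (block query_update)))
      query_time (\<lambda>r' m''. phase_regs \<rho> r' \<and> r' 12 = int z \<and> inputs m'' \<and>
        guess (finished \<rho> (Suc z)) m'' \<and> (\<forall>c. 3 * (n * n) \<le> c \<longrightarrow> m'' c = m' c)) r' m'"
    by (intro wp_query[where mem = mem] z \<rho> mem(2) q) simp_all
  then show "wp W (Seq (block query_setup) (Seq (call D q [13, 14, 17]) (block query_update)))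
      query_time (\<lambda>r' m'. r' 12 = int z \<and> r' 7 = int (N * N) \<and>
        phase_regs \<rho> (r'(12 := int (Suc z))) \<and> inputs m' \<and> guess (finished \<rho> (Suc z)) m' \<and>
        (\<forall>c. 3 * (n * n) \<le> c \<longrightarrow> m' c = m c)) r' m'"
    by (rule wp_mono) (use inv in \<open>auto simp: phase_regs_def const_regs_def\<close>)
next
  fix r' m'
  assume "phase_regs \<rho> r' \<and> inputs m' \<and> guess (finished \<rho> (N * N)) m' \<and>
      (\<forall>c. 3 * (n * n) \<le> c \<longrightarrow> m' c = m c)"
  with m(3) show "phase_regs \<rho> r' \<and> inputs m' \<and> guess (finished \<rho> (N * N)) m' \<and> fresh (Suc \<rho>) m'"
    by (simp add: fresh_def slice_def)
qed simp_all

lemma wp_phase: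
  assumes \<rho>: "\<rho> < R" and r: "const_regs r" "r 8 = int \<rho>"
    and m: "inputs m" "guess (finished \<rho> 0) m" "fresh \<rho> m"
  shows "wp W (phase D p q) phase_time
    (\<lambda>r' m'. const_regs r' \<and> r' 8 = int \<rho> \<and> inputs m' \<and> guess (finished (Suc \<rho>) 0) m' \<and>
      fresh (Suc \<rho>) m') r m" (is "wp _ _ _ ?Q _ _")
proof -
  interpret g: gadget N b V "\<alpha> \<rho>" "\<beta> \<rho>"
    by (rule gadget)
  let ?loop = "For 12 7 (Seq (block query_setup) (Seq (call D q [13, 14, 17]) (block query_update)))"
  obtain t rp mem where p: "exec Wp p (init_regs [int V], graph_mem \<rho>) t (rp, mem)" "t \<le> tp"
    and q: "\<forall>(x, y) \<in> parcs (weight_graph V (wt \<rho>)). \<forall>v \<in> pverts (weight_graph V (wt \<rho>)). \<exists>t' r'.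
      exec Wp q (init_regs [int x, int y, int v], mem) t' (r', mem) \<and> t' \<le> tq \<and>
      dist_regs r' (replacement_dist (weight_graph V (wt \<rho>)) (case_prod (wt \<rho>)) 0 v (x, y))"
    using alg[OF g.ssrp_instance_gadget[OF N_bounds(1)]] by blast
  have graph_bound: "\<bar>graph_mem \<rho> a\<bar> \<le> Wp" for a
    using Wp_pos g.weight_increasing[of "a div V" "a mod V"]
    unfolding graph_memory_weight_graph by (cases "wt \<rho> (a div V) (a mod V) = 2") auto
  have "\<bar>init_regs [int V] x\<bar> \<le> Wp" for x
    using Wp(1) Wp_pos by (simp add: init_regs_def)
  then have mem: "\<forall>a. \<bar>mem a\<bar> \<le> Wp"
    using exec_bounded[OF p(1)] graph_bound by simp
  have loop: "wp W ?loop (N * N * (query_time + 10) + 10) ?Q r2 m2"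
    if "phase_regs \<rho> r2" "\<forall>a. m2 (slice \<rho> a) = mem a"
      "\<And>c. (\<And>a. c \<noteq> slice \<rho> a) \<Longrightarrow> m2 c = m c" for r2 m2
  proof -
    have low: "m2 c = m c" if "c < 3 * (n * n)" for c
      using low_not_slice[OF that] \<open>\<And>c. (\<And>a. c \<noteq> slice \<rho> a) \<Longrightarrow> m2 c = m c\<close> by blast
    have "fresh (Suc \<rho>) m2"
      unfolding fresh_def
    proof (intro allI impI)
      fix \<rho>' a assume \<rho>': "Suc \<rho> \<le> \<rho>' \<and> \<rho>' < R"
      then have "slice \<rho>' a \<noteq> slice \<rho> a'" for a'
        using slice_inj[of \<rho>' \<rho> a a'] \<rho> by auto
      then have "m2 (slice \<rho>' a) = m (slice \<rho>' a)"
        using that(3) by blast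
      then show "m2 (slice \<rho>' a) = 0"
        using m(3) \<rho>' by (simp add: fresh_def)
    qed
    moreover have "inputs m2" "guess (finished \<rho> 0) m2"
      using same_low[of m2 m, OF low] m by blast+
    moreover have "\<exists>t' r'. exec Wp q (init_regs [int x, int y, int v], mem) t' (r', mem) \<and> t' \<le> tq \<and>
        dist_regs r' (replacement_dist (weight_graph V (wt \<rho>)) (case_prod (wt \<rho>)) 0 v (x, y))"
      if "(x, y) \<in> parcs (weight_graph V (wt \<rho>))" "v < V" for x y v
    proof -
      have "v \<in> pverts (weight_graph V (wt \<rho>))"
        using that(2) by simp
      from q[THEN bspec, OF that(1), unfolded prod.case, THEN bspec, OF this] show ?thesis .
    qed
    ultimately have "wp W ?loop (N * N * (query_time + 10) + 10) (\<lambda>r' m'. phase_regs \<rho> r' \<and>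
        inputs m' \<and> guess (finished \<rho> (N * N)) m' \<and> fresh (Suc \<rho>) m') r2 m2"
      using that(1,2) mem \<rho> by (intro wp_queries)
    \<comment> \<open>Finishing the last query of a phase is the same as being about to start the
      next phase.\<close>
    moreover have "finished (Suc \<rho>) 0 = finished \<rho> (N * N)"
      by (intro ext) (auto simp: finished_def less_Suc_eq)
    ultimately show ?thesis
      by (auto elim!: wp_mono simp: phase_regs_def)
  qed
  have call: "wp W (call D p [3]) (2 * D + 3 * tp + 3) (wp W ?loop (N * N * (query_time + 10) + 10) ?Q) r1 m1"
    if r1: "phase_regs \<rho> r1" and m1: "\<forall>a. m1 (slice \<rho> a) = graph_mem \<rho> a"
      "\<forall>c. (\<forall>a. c \<noteq> slice \<rho> a) \<longrightarrow> m1 c = m c" for r1 m1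
  proof -
    have "wp W (call D p [3]) (2 * D + 3 * t + 3)
        (wp W ?loop (N * N * (query_time + 10) + 10) ?Q) r1 m1"
    proof (rule wp_call[where W = Wp and str = R and off = "3 * (n * n) + \<rho>" and mem = "graph_mem \<rho>"])
      show "exec Wp p (init_regs (map r1 [3]), graph_mem \<rho>) t (rp, mem)"
        using p(1) r1 by (simp add: phase_regs_def const_regs_def)
      show "Wp * int R + int (3 * (n * n) + \<rho>) \<le> W"
        by (rule call_bounds[OF \<rho>])
      show "\<forall>a. m1 (3 * (n * n) + \<rho> + a * R) = graph_mem \<rho> a"
        using m1(1) by (simp add: slice_def)
      show "\<forall>a. \<bar>graph_mem \<rho> a\<bar> \<le> Wp"
        using graph_bound by blast
      show "\<forall>x\<in>set [3]. x < 20 \<and> \<bar>r1 x\<bar> \<le> Wp"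
        using r1 Wp(1) by (simp add: phase_regs_def const_regs_def)
      fix m' assume m': "\<forall>a. m' (3 * (n * n) + \<rho> + a * R) = mem a"
        "\<forall>c. (\<forall>a. c \<noteq> 3 * (n * n) + \<rho> + a * R) \<longrightarrow> m' c = m1 c"
      show "wp W ?loop (N * N * (query_time + 10) + 10) ?Q (r1(15 := rp 1)) m'"
      proof (rule loop)
        show "phase_regs \<rho> (r1(15 := rp 1))"
          using r1 by (simp add: phase_regs_def const_regs_def)
        show "\<forall>a. m' (slice \<rho> a) = mem a"
          using m'(1) by (simp add: slice_def)
        show "m' c = m c" if "\<And>a. c \<noteq> slice \<rho> a" for c
          using that m'(2) m1(2) by (simp add: slice_def)
      qed
    qed (use D Wp Wp_pos R_bounds r1 in \<open>simp_all add: phase_regs_def const_regs_def\<close>)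
    then show ?thesis
      by (rule wp_mono) (use p(2) in simp_all)
  qed
  have "wp W (For 12 6 (block write_weight)) (V * V * (cost_block write_weight + 10) + 10)
      (wp W (Seq (call D p [3]) ?loop) ((2 * D + 3 * tp + 3) + (N * N * (query_time + 10) + 10)) ?Q) r1 m"
    if "phase_regs \<rho> r1" for r1
    by (rule wp_mono[OF wp_write_graph[OF \<rho> that m(1,3)] order_refl])
      (use call in \<open>blast intro: wp_Seq\<close>)
  then have graph: "wp W (Seq (For 12 6 (block write_weight)) (Seq (call D p [3]) ?loop))
      ((V * V * (cost_block write_weight + 10) + 10) +
        ((2 * D + 3 * tp + 3) + (N * N * (query_time + 10) + 10))) ?Q r1 m"
    if "phase_regs \<rho> r1" for r1
    using that by (intro wp_Seq)
  show ?thesis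
    unfolding phase_def phase_time_def
    by (rule wp_Seq, rule wp_mono[OF wp_phase_setup[OF \<rho> r, of m] order_refl])
      (use graph in blast)
qed

section \<open>The frame of the program around the phases\<close>

definition total_time :: nat where
  "total_time = cost_block size_setup + ((V * (cost_block width_step + 10) + 10) +
     (cost_block const_setup + ((n * n * (cost_block first_guess + 10) + 10) +
     ((R * (phase_time + 10) + 10) + (n * n * (cost_block copy_back + 10) + 10)))))"

lemma wp_size_setup:
  assumes r: "r 0 = int n"
  shows "wp W (block size_setup) (cost_block size_setup)
    (\<lambda>r' m'. m' = m \<and> r' 0 = int n \<and> r' 3 = int V \<and> r' 5 = 0) r m"
proof (rule wp_block[OF _ wf_blocks(5) X_ge_2 W])
  let ?Q = "\<lambda>r' m'. m' = m \<and> r' 0 = int n \<and> r' 3 = int V \<and> r' 5 = 0"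
  show "wp_block X size_setup ?Q r m"
    unfolding size_setup_def
  proof (rule wp_block_Asg, rule_tac [2] wp_block_Asg)
    have "evals X (Ite (n_reg <\<^sub>e Lit 16) (Lit 16) n_reg) r m (if n < 16 then int 16 else int n)"
      by (intro evals_intros) (use r reg_bounds X_ge in simp_all)
    then show "evals X (Ite (n_reg <\<^sub>e Lit 16) (Lit 16) n_reg) r m (int V)"
      by (simp add: V if_distrib[of int])
    show "evals X (Lit 0) (r(3 := int V)) m 0"
      by (intro evals_intros) (use X_ge in simp_all)
    show "wp_block X [] ?Q (r(3 := int V, 5 := 0)) m"
      using r by simp
  qed
qed

lemma wp_width:
  assumes r: "r 0 = int n" "r 3 = int V" "r 5 = 0"
  shows "wp W (For 12 3 (block width_step)) (V * (cost_block width_step + 10) + 10)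
    (\<lambda>r' m'. m' = m \<and> r' 0 = int n \<and> r' 3 = int V \<and> r' 5 = int b) r m"
\<comment> \<open>Before round x the widths 0, ..., x - 1 have been tried. The truncated x - 1 makes
  the invariant correct for the initial value 0, and b < V makes the final value equal to b.\<close>
proof (rule wp_For[where X = X and
    Inv = "\<lambda>x r' m'. m' = m \<and> r' 0 = int n \<and> r' 3 = int V \<and> r' 5 = int (min b (x - 1))"])
  show "2 \<le> X" "X ^ 300 \<le> W" "int V \<le> X"
    using X_ge_2 W reg_bounds by simp_all
  show "r 3 = int V"
    by fact
  show "m = m \<and> (r(12 := 0)) 0 = int n \<and> (r(12 := 0)) 3 = int V \<and>
      (r(12 := 0)) 5 = int (min b (0 - 1))"
    using r by simp
next
  fix x and r' m' :: "nat \<Rightarrow> int"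
  assume x: "x < V" "r' 12 = int x" "r' 3 = int V"
    and inv: "m' = m \<and> r' 0 = int n \<and> r' 3 = int V \<and> r' 5 = int (min b (x - 1))"
  have bounds: "int x \<le> X" "int (min b (x - 1)) \<le> X"
    using x b_bounds by (auto intro!: le_V_le_X)
  let ?Q = "\<lambda>r' m'. r' 12 = int x \<and> r' 3 = int V \<and> m' = m \<and> (r'(12 := int (Suc x))) 0 = int n \<and>
      (r'(12 := int (Suc x))) 3 = int V \<and> (r'(12 := int (Suc x))) 5 = int (min b (Suc x - 1))"
  show "wp W (block width_step) (cost_block width_step) ?Q r' m'"
  proof (rule wp_block[OF _ wf_blocks(6) X_ge_2 W])
    show "wp_block X width_step ?Q r' m'"
      unfolding width_step_def
    proof (rule wp_block_Asg)
      have "evals X (Ite (V_reg <\<^sub>e Lit 16 *\<^sub>e (ctr_reg *\<^sub>e ctr_reg)) b_reg ctr_reg) r' m'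
          (if V < 16 * (x * x) then int (min b (x - 1)) else int x)"
        by (intro evals_intros) (use x inv bounds reg_bounds X_ge in simp_all)
      moreover have "(if V < 16 * (x * x) then int (min b (x - 1)) else int x) = int (min b x)"
        using b[of x] by (auto simp: not_le[symmetric] min_def)
      ultimately show "evals X (Ite (V_reg <\<^sub>e Lit 16 *\<^sub>e (ctr_reg *\<^sub>e ctr_reg)) b_reg ctr_reg) r' m'
          (int (min b x))"
        by simp
      show "wp_block X [] ?Q (r'(5 := int (min b x))) m'"
        using x inv by simp
    qed
  qed
next
  fix r' m' :: "nat \<Rightarrow> int"
  assume "m' = m \<and> r' 0 = int n \<and> r' 3 = int V \<and> r' 5 = int (min b (V - 1))"
  moreover have "min b (V - 1) = b"
    using b_bounds by simp
  ultimately show "m' = m \<and> r' 0 = int n \<and> r' 3 = int V \<and> r' 5 = int b"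
    by simp
qed simp_all

lemma wp_const_setup:
  assumes r: "r 0 = int n" "r 3 = int V" "r 5 = int b"
  shows "wp W (block const_setup) (cost_block const_setup) (\<lambda>r' m'. m' = m \<and> const_regs r') r m"
proof (rule wp_block[OF _ wf_blocks(7) X_ge_2 W])
  let ?Q = "\<lambda>r' m'. m' = m \<and> const_regs r'"
  note bounds = reg_bounds X_ge
  show "wp_block X const_setup ?Q r m"
    unfolding const_setup_def
  proof (rule wp_block_Asg, rule_tac [2] wp_block_Asg, rule_tac [3] wp_block_Asg,
      rule_tac [4] wp_block_Asg, rule_tac [5] wp_block_Asg)
    show "evals X (V_reg div\<^sub>e Lit 4) r m (int (V div 4))"
      by (intro evals_intros) (use r bounds in simp_all)
    let ?r1 = "r(4 := int (V div 4))"
    show "evals X (Lit 64 *\<^sub>e (V_reg div\<^sub>e b_reg +\<^sub>e Lit 1)) ?r1 m (int (64 * (V div b + 1)))"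
      by (intro evals_intros) (use r bounds in simp_all)
    let ?r2 = "?r1(2 := int (64 * (V div b + 1)))"
    show "evals X (V_reg *\<^sub>e V_reg) ?r2 m (int (V * V))"
      by (intro evals_intros) (use r bounds in simp_all)
    let ?r3 = "?r2(6 := int (V * V))"
    show "evals X (N_reg *\<^sub>e N_reg) ?r3 m (int (N * N))"
      by (intro evals_intros) (use bounds in \<open>simp_all add: N\<close>)
    let ?r4 = "?r3(7 := int (N * N))"
    show "evals X (n_reg *\<^sub>e n_reg) ?r4 m (int (n * n))"
      by (intro evals_intros) (use r bounds in simp_all)
    have "const_regs (?r4(16 := int (n * n)))"
      unfolding const_regs_def using r by (simp add: R N)
    then show "wp_block X [] ?Q (?r4(16 := int (n * n))) m"
      by simp
  qed
qed

lemma div_mod_less: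
  assumes "a < n * n"
  shows "a div n < n" "a mod n < n" "a div n * n + a mod n = a"
  using assms n_pos by (auto simp: less_mult_imp_div_less)

lemma wp_first_guess:
  assumes r: "const_regs r" and m: "inputs m" "\<forall>c. 2 * (n * n) \<le> c \<longrightarrow> m c = 0"
  shows "wp W (For 12 16 (block first_guess)) (n * n * (cost_block first_guess + 10) + 10)
    (\<lambda>r' m'. const_regs r' \<and> inputs m' \<and> guess (finished 0 0) m' \<and> fresh 0 m') r m"
proof (rule wp_For[where X = X and Inv = "\<lambda>x r' m'. const_regs r' \<and>
    (\<forall>a<x. m' (2 * (n * n) + a) = A (a div n) 0 + B 0 (a mod n)) \<and>
    (\<forall>c. c < 2 * (n * n) \<or> 3 * (n * n) \<le> c \<longrightarrow> m' c = m c)"])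
  show "2 \<le> X" "X ^ 300 \<le> W" "int (n * n) \<le> X"
    using X_ge_2 W reg_bounds by simp_all
  show "r 16 = int (n * n)"
    using r by (simp add: const_regs_def)
  show "const_regs (r(12 := 0)) \<and>
    (\<forall>a<0. m (2 * (n * n) + a) = A (a div n) 0 + B 0 (a mod n)) \<and>
    (\<forall>c. c < 2 * (n * n) \<or> 3 * (n * n) \<le> c \<longrightarrow> m c = m c)"
    using r by (simp add: const_regs_def)
next
  fix x and r' m' :: "nat \<Rightarrow> int"
  assume x: "x < n * n" "r' 12 = int x" "r' 16 = int (n * n)"
    and inv: "const_regs r' \<and>
    (\<forall>a<x. m' (2 * (n * n) + a) = A (a div n) 0 + B 0 (a mod n)) \<and>
    (\<forall>c. c < 2 * (n * n) \<or> 3 * (n * n) \<le> c \<longrightarrow> m' c = m c)"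
  have bounds: "int x \<le> X"
    using x nn_le by (intro le_X) linarith
  have regs: "r' 0 = int n"
    using inv by (simp add: const_regs_def)
  have "inputs m'"
    unfolding inputs_def
  proof (intro allI impI)
    fix i j assume "i < n" "j < n"
    then have "m' (i * n + j) = m (i * n + j)" "m' (n * n + (i * n + j)) = m (n * n + (i * n + j))"
      using inv index_less[of i j] by simp_all
    then show "m' (i * n + j) = A i j \<and> m' (n * n + (i * n + j)) = B i j"
      using m(1) \<open>i < n\<close> \<open>j < n\<close> by (simp add: inputs_def)
  qed
  let ?Q = "\<lambda>r' m'. r' 12 = int x \<and> r' 16 = int (n * n) \<and> const_regs (r'(12 := int (Suc x))) \<and>
    (\<forall>a<Suc x. m' (2 * (n * n) + a) = A (a div n) 0 + B 0 (a mod n)) \<and>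
    (\<forall>c. c < 2 * (n * n) \<or> 3 * (n * n) \<le> c \<longrightarrow> m' c = m c)"
  show "wp W (block first_guess) (cost_block first_guess) ?Q r' m'"
  proof (rule wp_block[OF _ wf_blocks(8) X_ge_2 W])
    show "wp_block X first_guess ?Q r' m'"
      unfolding first_guess_def
    proof (rule wp_block_Sto)
      show "evals X (Lit 2 *\<^sub>e nn_reg +\<^sub>e ctr_reg) r' m' (int (2 * (n * n) + x))"
        by (intro evals_intros) (use x(2,3) bounds reg_bounds X_ge in simp_all)
      show "evals X (A_at (ctr_reg div\<^sub>e n_reg) (Lit 0) +\<^sub>e B_at (Lit 0) (ctr_reg mod\<^sub>e n_reg)) r' m'
          (A (x div n) 0 + B 0 (x mod n))"
        by (intro evals_Add(1) evals_A evals_B evals_intros)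
          (use x(2,3) regs bounds reg_bounds X_ge n_pos \<open>inputs m'\<close> div_mod_less[OF x(1)] in simp_all)
      have "2 * (n * n) + x < 3 * (n * n)"
        using x by linarith
      then show "wp_block X [] ?Q r' (m'(2 * (n * n) + x := A (x div n) 0 + B 0 (x mod n)))"
        using x inv by (auto simp: const_regs_def less_Suc_eq)
    qed
  qed
next
  fix r' m' :: "nat \<Rightarrow> int"
  assume inv: "const_regs r' \<and>
    (\<forall>a<n * n. m' (2 * (n * n) + a) = A (a div n) 0 + B 0 (a mod n)) \<and>
    (\<forall>c. c < 2 * (n * n) \<or> 3 * (n * n) \<le> c \<longrightarrow> m' c = m c)"
  have "inputs m'"
    unfolding inputs_def
  proof (intro allI impI)
    fix i j assume "i < n" "j < n"
    then have "m' (i * n + j) = m (i * n + j)" "m' (n * n + (i * n + j)) = m (n * n + (i * n + j))"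
      using inv index_less[of i j] by simp_all
    then show "m' (i * n + j) = A i j \<and> m' (n * n + (i * n + j)) = B i j"
      using m(1) \<open>i < n\<close> \<open>j < n\<close> by (simp add: inputs_def)
  qed
  moreover have "guess (finished 0 0) m'"
    unfolding guess_def
  proof (intro allI impI conjI)
    fix i j assume "i < n" "j < n"
    then have "m' (2 * (n * n) + (i * n + j)) = A i 0 + B 0 j"
      using inv index_less[of i j] by simp
    then show "\<exists>k<n. m' (2 * (n * n) + (i * n + j)) = A i k + B k j"
      using n_pos by blast
  qed (simp add: finished_def)
  moreover have "fresh 0 m'"
    using inv m(2) by (simp add: fresh_def slice_def)
  ultimately show "const_regs r' \<and> inputs m' \<and> guess (finished 0 0) m' \<and> fresh 0 m'"
    using inv by blast
qed simp_all

lemma wp_phases: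
  assumes r: "const_regs r" and m: "inputs m" "guess (finished 0 0) m" "fresh 0 m"
  shows "wp W (For 8 2 (phase D p q)) (R * (phase_time + 10) + 10)
    (\<lambda>r' m'. const_regs r' \<and> guess (finished R 0) m') r m"
proof (rule wp_For[where X = X and Inv = "\<lambda>\<rho> r' m'. const_regs r' \<and> inputs m' \<and>
    guess (finished \<rho> 0) m' \<and> fresh \<rho> m'"])
  show "2 \<le> X" "X ^ 300 \<le> W" "int R \<le> X"
    using X_ge_2 W reg_bounds by simp_all
  show "r 2 = int R"
    using r by (simp add: const_regs_def)
  show "const_regs (r(8 := 0)) \<and> inputs m \<and> guess (finished 0 0) m \<and> fresh 0 m"
    using r m by (simp add: const_regs_def)
next
  fix \<rho> r' m'
  assume "\<rho> < R" "r' 8 = int \<rho>" "const_regs r' \<and> inputs m' \<and> guess (finished \<rho> 0) m' \<and> fresh \<rho> m'"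
  then have "wp W (phase D p q) phase_time
    (\<lambda>r' m'. const_regs r' \<and> r' 8 = int \<rho> \<and> inputs m' \<and> guess (finished (Suc \<rho>) 0) m' \<and>
      fresh (Suc \<rho>) m') r' m'"
    by (intro wp_phase) simp_all
  then show "wp W (phase D p q) phase_time
    (\<lambda>r' m'. r' 8 = int \<rho> \<and> r' 2 = int R \<and> const_regs (r'(8 := int (Suc \<rho>))) \<and> inputs m' \<and>
      guess (finished (Suc \<rho>) 0) m' \<and> fresh (Suc \<rho>) m') r' m'"
    by (rule wp_mono) (auto simp: const_regs_def)
qed simp_all

lemma guess_finished:
  assumes "guess (finished R 0) m" "i < n" "j < n"
  shows "m (2 * (n * n) + (i * n + j)) = Min ((\<lambda>k. A i k + B k j) ` {..<n})"
proof -
  obtain k where k: "k < n" "m (2 * (n * n) + (i * n + j)) = A i k + B k j"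
    using assms unfolding guess_def by blast
  have "m (2 * (n * n) + (i * n + j)) \<le> A i k + B k j" if "k < n" for k
  proof -
    have "finished R 0 i j k"
      using all_covered[OF assms(2,3) that] by (auto simp: finished_def)
    then show ?thesis
      using assms unfolding guess_def by blast
  qed
  then show ?thesis
    using k by (intro Min_eqI[symmetric]) auto
qed

text \<open>The destination is the area of \<open>A\<close>, which may now be overwritten; the
  source lies behind both matrices and is not affected.\<close>

lemma wp_copy_back:
  assumes r: "const_regs r" and m: "guess (finished R 0) m"
  shows "wp W (For 12 16 (block copy_back)) (n * n * (cost_block copy_back + 10) + 10)
    (\<lambda>r' m'. \<forall>i<n. \<forall>j<n. m' (i * n + j) = Min ((\<lambda>k. A i k + B k j) ` {..<n})) r m"
proof (rule wp_For[where X = X and Inv = "\<lambda>x r' m'. const_regs r' \<and>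
    (\<forall>a<x. m' a = m (2 * (n * n) + a)) \<and> (\<forall>c. n * n \<le> c \<longrightarrow> m' c = m c)"])
  show "2 \<le> X" "X ^ 300 \<le> W" "int (n * n) \<le> X"
    using X_ge_2 W reg_bounds by simp_all
  show "r 16 = int (n * n)"
    using r by (simp add: const_regs_def)
  show "const_regs (r(12 := 0)) \<and> (\<forall>a<0. m a = m (2 * (n * n) + a)) \<and>
      (\<forall>c. n * n \<le> c \<longrightarrow> m c = m c)"
    using r by (simp add: const_regs_def)
next
  fix x and r' m' :: "nat \<Rightarrow> int"
  assume x: "x < n * n" "r' 12 = int x" "r' 16 = int (n * n)"
    and inv: "const_regs r' \<and> (\<forall>a<x. m' a = m (2 * (n * n) + a)) \<and>
      (\<forall>c. n * n \<le> c \<longrightarrow> m' c = m c)"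
  have bounds: "int x \<le> X"
    using x nn_le by (intro le_X) linarith
  have "\<bar>m (2 * (n * n) + x)\<bar> \<le> X"
  proof -
    obtain k where "k < n" "m (2 * (n * n) + (x div n * n + x mod n)) = A (x div n) k + B k (x mod n)"
      using m div_mod_less(1,2)[OF x(1)] unfolding guess_def by blast
    then show ?thesis
      using A_bound[of "x div n" k] B_bound[of k "x mod n"] div_mod_less[OF x(1)] M_le by simp
  qed
  then have cell: "m' (2 * (n * n) + x) = m (2 * (n * n) + x)" "\<bar>m (2 * (n * n) + x)\<bar> \<le> X"
    using inv by simp_all
  let ?Q = "\<lambda>r' m'. r' 12 = int x \<and> r' 16 = int (n * n) \<and> const_regs (r'(12 := int (Suc x))) \<and>
    (\<forall>a<Suc x. m' a = m (2 * (n * n) + a)) \<and> (\<forall>c. n * n \<le> c \<longrightarrow> m' c = m c)"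
  show "wp W (block copy_back) (cost_block copy_back) ?Q r' m'"
  proof (rule wp_block[OF _ wf_blocks(9) X_ge_2 W])
    show "wp_block X copy_back ?Q r' m'"
      unfolding copy_back_def
    proof (rule wp_block_Sto)
      show "evals X ctr_reg r' m' (int x)"
        by (intro evals_intros) (use x bounds in simp_all)
      show "evals X (Deref (Lit 2 *\<^sub>e nn_reg +\<^sub>e ctr_reg)) r' m' (m (2 * (n * n) + x))"
        by (intro evals_Deref[where x = "2 * (n * n) + x"] evals_intros)
          (use x(2,3) bounds reg_bounds X_ge cell in simp_all)
      show "wp_block X [] ?Q r' (m'(x := m (2 * (n * n) + x)))"
        using x inv by (auto simp: const_regs_def less_Suc_eq)
    qed
  qed
next
  fix r' m' :: "nat \<Rightarrow> int"
  assume inv: "const_regs r' \<and> (\<forall>a<n * n. m' a = m (2 * (n * n) + a)) \<and>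
      (\<forall>c. n * n \<le> c \<longrightarrow> m' c = m c)"
  then show "\<forall>i<n. \<forall>j<n. m' (i * n + j) = Min ((\<lambda>k. A i k + B k j) ` {..<n})"
    using index_less guess_finished[OF m] by simp
qed simp_all

lemma exec_min_plus_prog:
  assumes r: "r 0 = int n" and m: "inputs m" "\<forall>c. 2 * (n * n) \<le> c \<longrightarrow> m c = 0"
  shows "\<exists>t r' m'. exec W (min_plus_prog D p q) (r, m) t (r', m') \<and> t \<le> total_time + 1 \<and>
    (\<forall>i<n. \<forall>j<n. m' (i * n + j) = Min ((\<lambda>k. A i k + B k j) ` {..<n}))"
proof -
  let ?Q = "\<lambda>r' m'. \<forall>i<n. \<forall>j<n. m' (i * n + j) = Min ((\<lambda>k. A i k + B k j) ` {..<n})"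
  let ?c = "For 12 16 (block copy_back)"
  let ?p = "For 8 2 (phase D p q)"
  let ?f = "For 12 16 (block first_guess)"
  let ?b = "block const_setup"
  let ?w = "For 12 3 (block width_step)"
  have 1: "wp W (Seq ?p ?c) ((R * (phase_time + 10) + 10) + (n * n * (cost_block copy_back + 10) + 10)) ?Q r m"
    if "const_regs r" "inputs m" "guess (finished 0 0) m" "fresh 0 m" for r m
    by (rule wp_Seq, rule wp_mono[OF wp_phases[OF that] order_refl], rule wp_copy_back) auto
  have 2: "wp W (Seq ?f (Seq ?p ?c)) ((n * n * (cost_block first_guess + 10) + 10) +
      ((R * (phase_time + 10) + 10) + (n * n * (cost_block copy_back + 10) + 10))) ?Q r m"
    if "const_regs r" for r
    by (rule wp_Seq, rule wp_mono[OF wp_first_guess[OF that m] order_refl], rule 1) auto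
  have 3: "wp W (Seq ?b (Seq ?f (Seq ?p ?c))) (cost_block const_setup +
      ((n * n * (cost_block first_guess + 10) + 10) +
      ((R * (phase_time + 10) + 10) + (n * n * (cost_block copy_back + 10) + 10)))) ?Q r m"
    if "r 0 = int n" "r 3 = int V" "r 5 = int b" for r
    by (rule wp_Seq, rule wp_mono[OF wp_const_setup[OF that, of m] order_refl]) (use 2 in blast)
  have 4: "wp W (Seq ?w (Seq ?b (Seq ?f (Seq ?p ?c)))) ((V * (cost_block width_step + 10) + 10) +
      (cost_block const_setup + ((n * n * (cost_block first_guess + 10) + 10) +
      ((R * (phase_time + 10) + 10) + (n * n * (cost_block copy_back + 10) + 10))))) ?Q r m"
    if "r 0 = int n" "r 3 = int V" "r 5 = 0" for r
    by (rule wp_Seq, rule wp_mono[OF wp_width[OF that, of m] order_refl]) (use 3 in blast)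
  have "wp W (Seq (block size_setup) (Seq ?w (Seq ?b (Seq ?f (Seq ?p ?c))))) total_time ?Q r m"
    unfolding total_time_def
    by (rule wp_Seq, rule wp_mono[OF wp_size_setup[of r m, OF r] order_refl]) (use 4 in blast)
  moreover have "same_vars r r"
    by (simp add: same_vars_def)
  ultimately obtain t r1 m' where t: "exec W (Seq (block size_setup) (Seq ?w (Seq ?b (Seq ?f (Seq ?p ?c)))))
      (r, m) t (r1, m')" "t \<le> total_time"
      "\<forall>i<n. \<forall>j<n. m' (i * n + j) = Min ((\<lambda>k. A i k + B k j) ` {..<n})"
    unfolding wp_def by blast
  have "exec W (min_plus_prog D p q) (r, m) (t + 1) (r1, m')"
    unfolding min_plus_prog_def using n_pos r t(1) by (intro exec.CondTrue) simp_all
  with t show ?thesis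
    by (intro exI[of _ "t + 1"] exI[of _ r1] exI[of _ m']) simp
qed

end

section \<open>Running time and word size\<close>

definition overhead :: "nat \<Rightarrow> nat \<Rightarrow> nat" where
  "overhead D tq = cost_block size_setup + cost_block width_step + cost_block const_setup +
     cost_block first_guess + cost_block copy_back + cost_block phase_setup + cost_block write_weight +
     cost_block query_setup + cost_block query_update + 4 * D + 3 * tq + 150"

text \<open>One phase costs O(V * V + tp): writing the graph, one SSRP run and N * N constant-time
  queries. All remaining work is dominated by R such phases, because R \<ge> 1 and V \<le> V *
  V.\<close>

lemma (in reduction) total_time_le: "total_time + 2 \<le> overhead D tq * (R * (V * V + tp))"
proof -
  define Y where "Y = V * V + tp"
  have "V \<le> V * V"
    by simp
  then have Y: "1 \<le> Y" "V * V \<le> Y" "V \<le> Y" "tp \<le> Y"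
    using V_ge unfolding Y_def by linarith+
  define P where "P = cost_block phase_setup + cost_block write_weight + query_time + 2 * D + 46"
  have cY: "c \<le> c * Y" for c
    using Y(1) by simp
  have "V * V * (cost_block write_weight + 10) \<le> (cost_block write_weight + 10) * Y"
    using Y(2) by (simp add: mult.commute mult_le_mono)
  moreover have "N * N * (query_time + 10) \<le> (query_time + 10) * Y"
    using Y(2) NN_le by (simp add: mult.commute mult_le_mono)
  moreover have "cost_block phase_setup \<le> cost_block phase_setup * Y" "2 * D + 23 \<le> (2 * D + 23) * Y"
    by (rule cY)+
  moreover have "P * Y = cost_block phase_setup * Y + (cost_block write_weight + 10) * Y +
      (query_time + 10) * Y + (2 * D + 23) * Y + 3 * Y"
    by (simp add: P_def algebra_simps)
  ultimately have phase: "phase_time \<le> P * Y"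
    using Y(4) unfolding phase_time_def by linarith
  define Z where "Z = R * Y"
  have "1 * Y \<le> R * Y"
    using R_bounds by (intro mult_le_mono) simp_all
  then have Z: "1 \<le> Z" "V * V \<le> Z" "V \<le> Z"
    using Y unfolding Z_def by linarith+
  have cZ: "c \<le> c * Z" for c
    using Z(1) by simp
  have "R * (phase_time + 10) \<le> R * (P * Y + 10 * Y)"
    using phase cY[of 10] by (intro mult_le_mono) simp_all
  also have "\<dots> = (P + 10) * Z"
    by (simp add: Z_def algebra_simps)
  finally have "R * (phase_time + 10) \<le> (P + 10) * Z" .
  moreover have "V * (cost_block width_step + 10) \<le> (cost_block width_step + 10) * Z"
    using Z(3) by (simp add: mult.commute mult_le_mono)
  moreover have "n * n * (cost_block first_guess + 10) \<le> (cost_block first_guess + 10) * Z"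
    "n * n * (cost_block copy_back + 10) \<le> (cost_block copy_back + 10) * Z"
    using order_trans[OF nn_le Z(2)] by (simp_all add: mult.commute mult_le_mono)
  moreover have "cost_block size_setup + cost_block const_setup + 42 \<le>
      (cost_block size_setup + cost_block const_setup + 42) * Z"
    by (rule cZ)
  ultimately have "total_time + 2 \<le> (cost_block size_setup + cost_block const_setup + 42 +
      (P + 10) + (cost_block width_step + 10) + (cost_block first_guess + 10) +
      (cost_block copy_back + 10)) * Z"
    unfolding total_time_def distrib_right by linarith
  also have "\<dots> \<le> overhead D tq * Z"
    by (intro mult_le_mono) (simp_all add: overhead_def P_def query_time_def)
  finally show ?thesis
    by (simp add: Z_def Y_def)
qed

lemma ex_width: "\<exists>b. \<forall>x. 16 * (x * x) \<le> V \<longleftrightarrow> x \<le> b" for V :: nat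
proof -
  let ?S = "{x. 16 * (x * x) \<le> V}"
  have "?S \<subseteq> {..V}"
  proof
    fix x assume "x \<in> ?S"
    then have "16 * (x * x) \<le> V"
      by simp
    moreover have "x \<le> x * x"
      by simp
    ultimately show "x \<in> {..V}"
      unfolding atMost_iff by linarith
  qed
  then have fin: "finite ?S"
    by (rule finite_subset) simp
  moreover have "0 \<in> ?S"
    by simp
  ultimately have Max: "16 * (Max ?S * Max ?S) \<le> V"
    using Max_in[of ?S] by blast
  have "16 * (x * x) \<le> V \<longleftrightarrow> x \<le> Max ?S" for x
  proof
    assume "16 * (x * x) \<le> V"
    then show "x \<le> Max ?S"
      using fin by (intro Max_ge) simp_all
  next
    assume "x \<le> Max ?S"
    then have "x * x \<le> Max ?S * Max ?S"
      by (intro mult_le_mono)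
    then show "16 * (x * x) \<le> V"
      using Max by linarith
  qed
  then show ?thesis
    by blast
qed

lemma word_bounds:
  fixes n M V R c :: nat and P :: int
  assumes V: "V \<le> n + 16" and R: "R \<le> 64 * (V + 1)" and P: "P = int n + int M + 2"
  shows "(8 * int (V * V) + 2 * int M) ^ 300 \<le> P ^ (5 * (c + 904))"
    and "(int V + 2) ^ c \<le> P ^ (5 * (c + 904))"
    and "(int V + 2) ^ c * int R + int (3 * (n * n) + R) \<le> P ^ (5 * (c + 904))"
proof -
  \<comment> \<open>Z exceeds V + 2 and all additive constants, so the bounds become powers of Z:
    \<open>X\<close> is at most Z^3, whence 900 = 3 * 300, and the relocated addresses need Z^(c +
    4). The exponent c + 904 covers both.\<close>
  define Z where "Z = P ^ 5"
  have P2: "2 \<le> P"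
    using P by simp
  have "2 ^ 4 * P \<le> P ^ 4 * P"
    using P2 by (intro mult_right_mono power_mono) simp_all
  then have PZ: "16 * P \<le> Z"
    by (simp add: Z_def power_numeral_reduce)
  have Z: "int V + 2 \<le> Z" "int M \<le> Z" "32 \<le> Z" "int n \<le> Z"
    using PZ P V P2 by linarith+
  have eq: "P ^ (5 * (c + 904)) = Z ^ (c + 904)"
    unfolding Z_def by (rule power_mult)
  have mono: "Z ^ i \<le> Z ^ j" if "i \<le> j" for i j
    using Z that by (intro power_increasing) simp_all
  have VV: "int (V * V) \<le> Z ^ 2"
    using Z(1) by (simp add: power2_eq_square mult_mono)
  have nn: "int (n * n) \<le> Z ^ 2"
    using Z(4) by (simp add: power2_eq_square mult_mono)
  have lin: "32 * Z ^ i \<le> Z ^ Suc i" for i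
    using Z(3) by (simp add: mult_right_mono)
  have Z2: "32 * Z \<le> Z ^ 2"
    using lin[of 1] by (simp add: power2_eq_square)
  have Z3: "32 * Z ^ 2 \<le> Z ^ 3"
    using mult_right_mono[of 32 Z "Z ^ 2"] Z(3)
    by (simp add: power3_eq_cube power2_eq_square mult.assoc)
  have "8 * int (V * V) + 2 * int M \<le> Z ^ 3"
    using VV Z(2,3) Z2 Z3 by linarith
  then have "(8 * int (V * V) + 2 * int M) ^ 300 \<le> (Z ^ 3) ^ 300"
    by (intro power_mono) simp_all
  also have "\<dots> = Z ^ 900"
    by (simp flip: power_mult)
  also have "\<dots> \<le> Z ^ (c + 904)"
    by (rule mono) simp
  finally show "(8 * int (V * V) + 2 * int M) ^ 300 \<le> P ^ (5 * (c + 904))"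
    by (simp only: eq)
  have Vc: "(int V + 2) ^ c \<le> Z ^ c"
    using Z(1) by (intro power_mono) simp_all
  also have "\<dots> \<le> Z ^ (c + 904)"
    by (rule mono) simp
  finally show "(int V + 2) ^ c \<le> P ^ (5 * (c + 904))"
    by (simp only: eq)
  have "int R \<le> int (64 * (V + 1))"
    using R by (simp only: of_nat_le_iff)
  then have "int R \<le> 64 * Z"
    using Z by simp
  then have RZ: "int R \<le> Z ^ 3"
    using Z(3) Z2 Z3 by linarith
  have "(int V + 2) ^ c * int R \<le> Z ^ c * Z ^ 3"
    using Vc RZ Z(3) by (intro mult_mono) simp_all
  then have "(int V + 2) ^ c * int R \<le> Z ^ (c + 3)"
    by (simp add: power_add)
  moreover have "int (3 * (n * n) + R) \<le> 2 * Z ^ 3"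
  proof -
    have "int (3 * (n * n) + R) = 3 * int (n * n) + int R"
      by simp
    then show ?thesis
      using nn RZ Z3 Z(3) zero_le_power2[of Z] by linarith
  qed
  moreover have "Z ^ 3 \<le> Z ^ (c + 3)"
    by (rule mono) simp
  moreover have "32 * Z ^ (c + 3) \<le> Z ^ (c + 904)"
    using lin[of "c + 3"] mono[of "Suc (c + 3)" "c + 904"] by simp
  moreover have "0 \<le> Z ^ (c + 3)"
    using Z(3) by simp
  ultimately show "(int V + 2) ^ c * int R + int (3 * (n * n) + R) \<le> P ^ (5 * (c + 904))"
    unfolding eq by linarith
qed

theorem theorem1p3:
  fixes T :: "nat \<Rightarrow> real"
  assumes "\<exists>p q. ssrp_algorithm p q T"
  shows "\<exists>p' T'. bd_min_plus_algorithm p' T' \<and> T' \<in> O(\<lambda>n. T n * sqrt (real n))"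
proof -
  obtain p q where pq: "ssrp_algorithm p q T"
    using assms by blast
  obtain c tq where alg: "\<And>n G w s. ssrp_instance n G w s \<Longrightarrow>
       (\<exists>t r m. exec ((int n + 2) ^ c) p
             (init_regs [int n, int s], graph_memory n G w) t (r, m) \<and>
          real t \<le> T n \<and>
          (\<forall>(x, y) \<in> parcs G. \<forall>v \<in> pverts G. \<exists>t' r'.
             exec ((int n + 2) ^ c) q (init_regs [int x, int y, int v], m) t' (r', m) \<and>
             t' \<le> tq \<and> dist_regs r' (replacement_dist G w s v (x, y))))"
    using pq unfolding ssrp_algorithm_def by blast
  obtain D where D: "regs_below D p" "regs_below D q" "3 \<le> D"
  proof -
    obtain D1 D2 where "regs_below D1 p" "regs_below D2 q"
      using ex_regs_below by blast
    then show ?thesis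
      using that[of "D1 + D2 + 3"] regs_below_mono by simp
  qed
  obtain width :: "nat \<Rightarrow> nat" where width: "\<And>V x. 16 * (x * x) \<le> V \<longleftrightarrow> x \<le> width V"
    using choice[of "\<lambda>V b. \<forall>x. 16 * (x * x) \<le> V \<longleftrightarrow> x \<le> b"] ex_width by blast
  \<comment> \<open>A graph has exactly n vertices as soon as n \<ge> 16. This is essential because
    nothing relates the values of T at different sizes.\<close>
  define Vf where "Vf n = (if n < 16 then 16 else n)" for n :: nat
  define Rf where "Rf n = 64 * (Vf n div width (Vf n) + 1)" for n
  define tp where "tp n = nat \<lfloor>T (Vf n)\<rfloor>" for n
  define T' where "T' n = real (overhead D tq * (Rf n * (Vf n * Vf n + tp n)))" for n
  have "bd_min_plus_algorithm (min_plus_prog D p q) T'"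
    unfolding bd_min_plus_algorithm_def
  \<comment> \<open>The successor ensures that even for c = 0 the SSRP words can hold the number of
    vertices.\<close>
  proof (rule exI[of _ "5 * (Suc c + 904)"], intro allI impI)
    fix n M and A B :: "int mat"
    assume h: "A \<in> carrier_mat n n \<and> B \<in> carrier_mat n n \<and> bounded_difference A \<and>
      bounded_difference B \<and> (\<forall>i<n. \<forall>j<n. \<bar>A $$ (i, j)\<bar> \<le> int M \<and> \<bar>B $$ (i, j)\<bar> \<le> int M)"
    let ?W = "(int n + int M + 2) ^ (5 * (Suc c + 904))"
    have T'_ge: "2 \<le> T' n"
    proof -
      have "1 \<le> Rf n" "1 \<le> Vf n" "2 \<le> overhead D tq"
        by (simp_all add: overhead_def Rf_def Vf_def)
      then have "2 * (1 * (1 * 1 + 0)) \<le> overhead D tq * (Rf n * (Vf n * Vf n + tp n))"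
        by (intro mult_le_mono add_le_mono) simp_all
      then have "real 2 \<le> T' n"
        unfolding T'_def of_nat_le_iff by simp
      then show ?thesis
        by simp
    qed
    show "\<exists>t r m. exec ?W (min_plus_prog D p q) (init_regs [int n], matrices_memory n A B) t (r, m) \<and>
        real t \<le> T' n \<and> (\<forall>i<n. \<forall>j<n. m (i * n + j) = (A \<star> B) $$ (i, j))"
    proof (cases "n = 0")
      case True
      have "init_regs [int n] 0 = 0"
        using True by (simp add: init_regs_def)
      from exec.CondFalse[where r = "init_regs [int n]" and x = 0, OF this exec.Skip]
      have "exec ?W (min_plus_prog D p q) (init_regs [int n], matrices_memory n A B) (1 + 1)
          (init_regs [int n], matrices_memory n A B)"
        unfolding min_plus_prog_def .
      moreover have "real (1 + 1) \<le> T' n"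
        using T'_ge by simp
      ultimately show ?thesis
        using True by (metis not_less_zero)
    next
      case False
      have Vn: "Vf n \<le> n + 16"
        by (simp add: Vf_def)
      have Rn: "Rf n \<le> 64 * (Vf n + 1)"
        unfolding Rf_def by (intro mult_le_mono add_le_mono) auto
      note word = word_bounds[where M = M and c = "Suc c", OF Vn Rn refl]
      have bd: "bounded_difference A" "bounded_difference B"
        and dims: "dim_row A = n" "dim_col A = n" "dim_row B = n" "dim_col B = n"
        using h by auto
      interpret reduction n "Vf n" "Vf n div 4" "width (Vf n)" "Rf n" M
        "\<lambda>i j. A $$ (i, j)" "\<lambda>i j. B $$ (i, j)" "8 * int (Vf n * Vf n) + 2 * int M" ?W
        "(int (Vf n) + 2) ^ Suc c" p q D "tp n" tq
      proof
        show "int (Vf n) \<le> (int (Vf n) + 2) ^ Suc c"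
        proof -
          have "int (Vf n) + 2 \<le> (int (Vf n) + 2) ^ Suc c"
            by (rule self_le_power) simp_all
          then show ?thesis
            by linarith
        qed
        fix G w assume "ssrp_instance (Vf n) G w 0"
        from alg[OF this] obtain t r m where 1: "exec ((int (Vf n) + 2) ^ c) p
            (init_regs [int (Vf n), int 0], graph_memory (Vf n) G w) t (r, m)"
          "real t \<le> T (Vf n)" and 2: "\<forall>(x, y) \<in> parcs G. \<forall>v \<in> pverts G. \<exists>t' r'.
             exec ((int (Vf n) + 2) ^ c) q (init_regs [int x, int y, int v], m) t' (r', m) \<and>
             t' \<le> tq \<and> dist_regs r' (replacement_dist G w 0 v (x, y))"
          by blast
        have le: "(int (Vf n) + 2) ^ c \<le> (int (Vf n) + 2) ^ Suc c"
          by (intro power_increasing) simp_all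
        \<comment> \<open>Registers default to 0 and the source is vertex 0, so passing the size
          alone is enough.\<close>
        have "init_regs [int (Vf n), int 0] = init_regs [int (Vf n)]"
          by (auto simp: init_regs_def less_Suc_eq)
        then have "exec ((int (Vf n) + 2) ^ Suc c) p
            (init_regs [int (Vf n)], graph_memory (Vf n) G w) t (r, m)"
          using exec_mono[OF 1(1) le] by simp
        moreover have "t \<le> tp n"
          using 1(2) by (simp add: tp_def le_nat_floor)
        moreover have "\<forall>(x, y) \<in> parcs G. \<forall>v \<in> pverts G. \<exists>t' r'.
             exec ((int (Vf n) + 2) ^ Suc c) q (init_regs [int x, int y, int v], m) t' (r', m) \<and>
             t' \<le> tq \<and> dist_regs r' (replacement_dist G w 0 v (x, y))"
        proof (intro ballI, clarify)
          fix x y v assume "(x, y) \<in> parcs G" "v \<in> pverts G"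
          with 2 obtain t' r' where
            "exec ((int (Vf n) + 2) ^ c) q (init_regs [int x, int y, int v], m) t' (r', m)"
            "t' \<le> tq" "dist_regs r' (replacement_dist G w 0 v (x, y))"
            by blast
          then show "\<exists>t' r'.
             exec ((int (Vf n) + 2) ^ Suc c) q (init_regs [int x, int y, int v], m) t' (r', m) \<and>
             t' \<le> tq \<and> dist_regs r' (replacement_dist G w 0 v (x, y))"
            using exec_mono[OF _ le] by blast
        qed
        ultimately show "\<exists>t r m. exec ((int (Vf n) + 2) ^ Suc c) p
            (init_regs [int (Vf n)], graph_memory (Vf n) G w) t (r, m) \<and> t \<le> tp n \<and>
            (\<forall>(x, y) \<in> parcs G. \<forall>v \<in> pverts G. \<exists>t' r'.
             exec ((int (Vf n) + 2) ^ Suc c) q (init_regs [int x, int y, int v], m) t' (r', m) \<and>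
             t' \<le> tq \<and> dist_regs r' (replacement_dist G w 0 v (x, y)))"
          by blast
      next
        show "0 < n" "Vf n = (if n < 16 then 16 else n)" "Vf n div 4 = Vf n div 4"
          "Rf n = 64 * (Vf n div width (Vf n) + 1)"
          using False by (simp_all add: Vf_def Rf_def)
        show "16 * (x * x) \<le> Vf n \<longleftrightarrow> x \<le> width (Vf n)" for x
          by (rule width)
        show "\<bar>A $$ (i, j)\<bar> \<le> int M" "\<bar>B $$ (i, j)\<bar> \<le> int M" if "i < n" "j < n" for i j
          using h that by blast+
        show "\<bar>A $$ (i, j) - A $$ (i, Suc j)\<bar> \<le> 1" if "i < n" "Suc j < n" for i j
          using bd(1) that unfolding bounded_difference_def dims by simp
        show "\<bar>A $$ (i, j) - A $$ (Suc i, j)\<bar> \<le> 1" if "Suc i < n" "j < n" for i j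
          using bd(1) that unfolding bounded_difference_def dims by simp
        show "\<bar>B $$ (i, j) - B $$ (Suc i, j)\<bar> \<le> 1" if "Suc i < n" "j < n" for i j
          using bd(2) that unfolding bounded_difference_def dims by simp
      qed (rule D word order_refl)+
      have "inputs (matrices_memory n A B)"
        unfolding inputs_def
      proof (intro allI impI)
        fix i j assume ij: "i < n" "j < n"
        have "(i * n + j) div n = i" "(i * n + j) mod n = j"
          using ij by simp_all
        then show "matrices_memory n A B (i * n + j) = A $$ (i, j) \<and>
            matrices_memory n A B (n * n + (i * n + j)) = B $$ (i, j)"
          using index_less[OF ij] by (simp add: matrices_memory_def)
      qed
      moreover have "init_regs [int n] 0 = int n"
        by (simp add: init_regs_def)
      moreover have "\<forall>a. 2 * (n * n) \<le> a \<longrightarrow> matrices_memory n A B a = 0"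
        by (simp add: matrices_memory_def)
      ultimately obtain t r m where t: "exec ?W (min_plus_prog D p q)
          (init_regs [int n], matrices_memory n A B) t (r, m)" "t \<le> total_time + 1"
          "\<forall>i<n. \<forall>j<n. m (i * n + j) = Min ((\<lambda>k. A $$ (i, k) + B $$ (k, j)) ` {..<n})"
        using exec_min_plus_prog by blast
      have "t \<le> overhead D tq * (Rf n * (Vf n * Vf n + tp n))"
        using t(2) total_time_le by linarith
      then have "real t \<le> T' n"
        unfolding T'_def of_nat_le_iff .
      moreover have "\<forall>i<n. \<forall>j<n. m (i * n + j) = (A \<star> B) $$ (i, j)"
        using t(3) dims by (simp add: min_plus_product_def)
      ultimately show ?thesis
        using t(1) by blast
    qed
  qed
  moreover have "T' \<in> O(\<lambda>n. T n * sqrt (real n))"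
  proof -
    obtain k where k: "\<And>n. 2 \<le> n \<Longrightarrow> real (((n - 2) div 2) * ((n - 2) div 2)) \<le> T n + real k"
      using ssrp_time_lower_bound[OF pq] by blast
    \<comment> \<open>R is at most 64 * (8 * sqrt n + 1) \<le> 576 * sqrt n, and n * n + tp is at
      most 33 * T n. The threshold 32 * k absorbs the additive constant of the lower bound.\<close>
    have "norm (T' n) \<le> real (overhead D tq) * 576 * 33 * norm (T n * sqrt (real n))"
      if n: "16 + 32 * k \<le> n" for n
    proof -
      have n16: "16 \<le> n"
        using n by simp
      have Vn: "Vf n = n"
        using n16 by (simp add: Vf_def)
      define h where "h = (n - 2) div 2"
      have "n \<le> 4 * h"
        using n16 by (simp add: h_def)
      then have "real n * real n \<le> (4 * real h) * (4 * real h)"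
        by (intro mult_mono) simp_all
      then have "real n * real n \<le> 16 * real (h * h)"
        by simp
      also have "\<dots> \<le> 16 * (T n + real k)"
        using k[of n] n16 by (simp add: h_def)
      finally have "real n * real n \<le> 16 * T n + 16 * real k"
        by simp
      moreover have "32 * real k \<le> real n * real n"
      proof -
        have "32 * k \<le> n * 1" "n * 1 \<le> n * n"
          using n n16 by (simp, intro mult_le_mono, simp_all)
        then have "32 * k \<le> n * n"
          by (rule order_trans)
        then show ?thesis
          by (metis of_nat_le_iff of_nat_mult of_nat_numeral)
      qed
      ultimately have nn: "real n * real n \<le> 32 * T n"
        by linarith
      \<comment> \<open>T is an arbitrary real function; its sign, needed to drop the norm, comes
        from the lower bound as well.\<close>
      then have T: "0 \<le> T n"
        using zero_le_square[of "real n"] by linarith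
      then have "real (tp n) \<le> T n"
        by (simp add: tp_def Vn)
      with nn have work: "real (n * n + tp n) \<le> 33 * T n"
        by simp
      define b where "b = width n"
      \<comment> \<open>Maximality of the width gives n < 16 * (b + 1)^2, hence sqrt n \<le> 4 * (b
        + 1) \<le> 8 * b, and n / b \<le> 8 * sqrt n blocks.\<close>
      have b: "1 \<le> b" "n < 16 * ((b + 1) * (b + 1))"
        using width[of 1 n] width[of "b + 1" n] n16 by (auto simp: b_def)
      have "real n \<le> (4 * (real b + 1)) * (4 * (real b + 1))"
      proof -
        have "real n \<le> real (16 * ((b + 1) * (b + 1)))"
          using b(2) unfolding of_nat_le_iff by (rule less_imp_le)
        then show ?thesis
          by (simp add: algebra_simps)
      qed
      then have "sqrt (real n) \<le> 4 * (real b + 1)"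
        by (intro real_le_lsqrt) (simp_all add: power2_eq_square)
      also have "\<dots> \<le> 8 * real b"
        using b(1) by simp
      finally have sqrt: "sqrt (real n) \<le> 8 * real b" .
      have "real (n div b) \<le> real n / real b"
        by (rule of_nat_div_le_of_nat)
      also have "\<dots> \<le> 8 * sqrt (real n)"
      proof -
        have "real n = sqrt (real n) * sqrt (real n)"
          by simp
        also have "\<dots> \<le> sqrt (real n) * (8 * real b)"
          using sqrt by (intro mult_left_mono) simp_all
        finally show ?thesis
          using b(1) by (simp add: field_simps)
      qed
      finally have "real (n div b) \<le> 8 * sqrt (real n)" .
      moreover have "1 \<le> sqrt (real n)"
        using n16 by simp
      moreover have "real (Rf n) = 64 * real (n div b) + 64"
        by (simp add: Rf_def Vn b_def)
      ultimately have "real (Rf n) \<le> 576 * sqrt (real n)"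
        by linarith
      then have "real (Rf n) * real (n * n + tp n) \<le> (576 * sqrt (real n)) * (33 * T n)"
        using work by (intro mult_mono) simp_all
      then have "real (overhead D tq) * (real (Rf n) * real (n * n + tp n)) \<le>
          real (overhead D tq) * ((576 * sqrt (real n)) * (33 * T n))"
        by (intro mult_left_mono) simp_all
      moreover have "norm (T' n) = real (overhead D tq) * (real (Rf n) * real (n * n + tp n))"
        by (simp add: T'_def Vn)
      moreover have "norm (T n * sqrt (real n)) = T n * sqrt (real n)"
        using T by simp
      ultimately show ?thesis
        by (simp add: mult_ac)
    qed
    then show ?thesis
      by (intro bigoI eventually_at_top_linorderI)
  qed
  ultimately show ?thesis
    by blast
qed

end
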